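(* (a) There exists an algorithm for computing the specialization at its removable singularity $z=\mathbf 1$ of a rational function of the form $$g_{\mathcal P}(z)=\sum_{i\in I}\epsilon_i\frac{z^{a_i}}{\prod_{j=1}^{s_i}(1-z^{b_{ij}})}$$ which runs in time polynomial in the encoding size of its data $\epsilon_i\in\mathbb Q$, $a_i\in\mathbb Z^n$ ($i\in I$), $b_{ij}\in\mathbb Z^n$ ($i\in I$, $j=1,\dots,s_i$), even when the dimension $n$ and the numbers $s_i$ are not fixed. (b) In particular, there exists a polynomial-time algorithm that, given such data describing the rational generating function $g_{\mathcal P}$ of a polytope $\mathcal P\subseteq\mathbb R^n$ in this form, computes a vector $\lambda\in\mathbb Q^n$ with $\langle\lambda,b_{ij}\rangle\ne0$ for all $i,j$ and rational weights $w_{i,l}$ for $i\in I$, $l=0,\dots,s_i$, such that $$\#(\mathcal P\cap\mathbb Z^n)=\sum_{i\in I}\epsilon_i\sum_{l=0}^{s_i}w_{i,l}\langle\lambda,a_i\rangle^l.$$ (c) Likewise, if an integral polytope $\mathcal P$ has dilations with parametric rational generating functions $$g_{k\mathcal P}(z)=\sum_{i\in I}\epsilon_i\frac{z^{a_i+(k-1)v_i}}{\prod_{j=1}^{s_i}(1-z^{b_{ij}})}\quad(k\ge1),$$ with $v_i\in\mathbb Z^n$, then with $\lambda$ and $w_{i,l}$ as in (b) (computed from the data $\epsilon_i,a_i,b_{ij}$), the Ehrhart polynomial $i(\mathcal P,k)=\#(k\mathcal P\cap\mathbb Z^n)$ is given by $$i(\mathcal P,k)=\sum_{m=0}^M\Big(\sum_{i\in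 I}\epsilon_i\langle\lambda,v_i\rangle^m\sum_{l=m}^{s_i}\binom{l}{m}w_{i,l}\langle\lambda,a_i-v_i\rangle^{l-m}\Big)k^m,$$ where $s=\max_{i\in I}s_i$ and $M=\min\{s,\dim\mathcal P\}$.
   Context: $z^{a}=\prod_{l=1}^n z_l^{a_l}$; $\langle\cdot,\cdot\rangle$ is the standard inner product. For a polytope $\mathcal P$, the generating function $g_{\mathcal P}(z)=\sum_{\alpha\in\mathcal P\cap\mathbb Z^n}z^\alpha$, so $g_{\mathcal P}(\mathbf 1)=\#(\mathcal P\cap\mathbb Z^n)$; a sum of the displayed form equals a Laurent polynomial and $z=\mathbf 1$ is a removable singularity, although it is a pole of individual summands. $k\mathcal P=\{k\alpha:\alpha\in\mathcal P\}$. *)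

theory Defs
  imports
    "HOL-Analysis.Analysis"
    "HOL-Analysis.Finite_Function_Topology"
    "HOL-Computational_Algebra.Computational_Algebra"
    "HOL-Library.Log_Nat"
begin

section \<open>Polynomial time\<close>

text \<open>
  The machine model is the random access machine with logarithmic cost criterion (Aho, Hopcroft and
  Ullman), with a one-way input tape and an output tape of integers and with structured control flow
  instead of jumps. The memory is organised into integer-indexed arrays of integers, one for each
  name (a program mentions only finitely many); a scalar variable is an array used at a fixed index.
  Every integer that occurs as an operand, an address or a result is charged with the length of its
  binary representation, so running times agree with those of Turing machines up to a polynomial.
\<close>

type_synonym mem = "string \<Rightarrow> int \<Rightarrow> int"

datatype binop = Add | Sub | Mul | Quo | Less | Equal

datatype aexp = Const int | Cell string aexp | Op binop aexp aexp

datatype com =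
    Skip
  | Assign string aexp aexp  \<comment> \<open>\<open>Assign x e f\<close> is \<open>x[e] := f\<close>\<close>
  | Read string aexp         \<comment> \<open>move the next input integer to \<open>x[e]\<close>\<close>
  | Write aexp
  | Seq com com
  | Cond aexp com com        \<comment> \<open>nonzero means true, as in \<open>While\<close>\<close>
  | While aexp com

fun binop_val :: "binop \<Rightarrow> int \<Rightarrow> int \<Rightarrow> int" where
  "binop_val Add x y = x + y"
| "binop_val Sub x y = x - y"
| "binop_val Mul x y = x * y"
| "binop_val Quo x y = x div y"
| "binop_val Less x y = (if x < y then 1 else 0)"
| "binop_val Equal x y = (if x = y then 1 else 0)"

fun aval :: "mem \<Rightarrow> aexp \<Rightarrow> int" where
  "aval m (Const c) = c"
| "aval m (Cell x e) = m x (aval m e)"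
| "aval m (Op f e1 e2) = binop_val f (aval m e1) (aval m e2)"

text \<open>Binary digits of the absolute value plus one sign bit.\<close>

definition bit_size :: "int \<Rightarrow> nat" where
  "bit_size x = 1 + floorlog 2 (nat \<bar>x\<bar>)"

definition tape_size :: "int list \<Rightarrow> nat" where
  "tape_size xs = sum_list (map bit_size xs)"

fun acost :: "mem \<Rightarrow> aexp \<Rightarrow> nat" where
  "acost m (Const c) = bit_size c"
| "acost m (Cell x e) = acost m e + bit_size (aval m (Cell x e))"
| "acost m (Op f e1 e2) = acost m e1 + acost m e2 + bit_size (aval m (Op f e1 e2))"

text \<open>\<open>exec c s t s'\<close>: started in \<open>s\<close>, the program \<open>c\<close> halts in \<open>s'\<close> at cost \<open>t\<close>. A state consists
  of the memory, the unread part of the input tape, and the output written so far.\<close>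

inductive exec :: "com \<Rightarrow> mem \<times> int list \<times> int list \<Rightarrow> nat \<Rightarrow> mem \<times> int list \<times> int list \<Rightarrow> bool" where
  Skip: "exec Skip s 1 s"
| Assign: "exec (Assign x e f) (m, inp, out) (1 + acost m e + acost m f)
    (m(x := (m x)(aval m e := aval m f)), inp, out)"
| Read: "exec (Read x e) (m, z # inp, out) (1 + acost m e + bit_size z)
    (m(x := (m x)(aval m e := z)), inp, out)"
| Write: "exec (Write e) (m, inp, out) (1 + acost m e) (m, inp, out @ [aval m e])"
| Seq: "exec c1 s t1 s' \<Longrightarrow> exec c2 s' t2 s'' \<Longrightarrow> exec (Seq c1 c2) s (1 + t1 + t2) s''"
| CondTrue: "aval (fst s) e \<noteq> 0 \<Longrightarrow> exec c1 s t s' \<Longrightarrow> exec (Cond e c1 c2) s (1 + acost (fst s) e + t) s'"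
| CondFalse: "aval (fst s) e = 0 \<Longrightarrow> exec c2 s t s' \<Longrightarrow> exec (Cond e c1 c2) s (1 + acost (fst s) e + t) s'"
| WhileFalse: "aval (fst s) e = 0 \<Longrightarrow> exec (While e c) s (1 + acost (fst s) e) s"
| WhileTrue: "aval (fst s) e \<noteq> 0 \<Longrightarrow> exec c s t1 s' \<Longrightarrow> exec (While e c) s' t2 s'' \<Longrightarrow>
    exec (While e c) s (1 + acost (fst s) e + t1 + t2) s''"

definition computes :: "com \<Rightarrow> int list \<Rightarrow> nat \<Rightarrow> int list \<Rightarrow> bool" where
  "computes c xs t ys \<longleftrightarrow> (\<exists>m rest. exec c (\<lambda>_ _. 0, xs, []) t (m, rest, ys))"

text \<open>On every instance satisfying the promise, the program halts within time polynomial in the bit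
  size of the encoded instance, with an output that is correct for the instance.\<close>

definition polytime_algorithm ::
  "com \<Rightarrow> ('a \<Rightarrow> int list) \<Rightarrow> ('a \<Rightarrow> bool) \<Rightarrow> ('a \<Rightarrow> int list \<Rightarrow> bool) \<Rightarrow> bool" where
  "polytime_algorithm c enc promise correct \<longleftrightarrow>
    (\<exists>p :: nat poly. \<forall>x. promise x \<longrightarrow>
      (\<exists>t ys. computes c (enc x) t ys \<and> t \<le> poly p (tape_size (enc x)) \<and> correct x ys))"

text \<open>Rational numbers are written as fractions with positive denominator, not necessarily in lowest
  terms.\<close>

definition codes_rats :: "rat list \<Rightarrow> int list \<Rightarrow> bool" where
  "codes_rats rs ys \<longleftrightarrow> (\<exists>ps :: (int \<times> int) list. (\<forall>(p, q) \<in> set ps. q > 0) \<and>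
     rs = map (\<lambda>(p, q). of_int p / of_int q) ps \<and> ys = concat (map (\<lambda>(p, q). [p, q]) ps))"


section \<open>Vectors and polytopes\<close>

text \<open>The dimension \<open>n\<close> is part of the input of the algorithms, so it cannot be a type: vectors of
  length \<open>n\<close> are finitely supported functions on \<open>nat\<close> that vanish outside \<open>{..<n}\<close>. The type
  \<open>nat \<Rightarrow>\<^sub>0 real\<close> is a real vector space, which makes \<^const>\<open>polytope\<close> available.\<close>

definition vecs :: "nat \<Rightarrow> (nat \<Rightarrow>\<^sub>0 'a::zero) set" where
  "vecs n = {x. Poly_Mapping.keys x \<subseteq> {..<n}}"

definition dot :: "nat \<Rightarrow> (nat \<Rightarrow>\<^sub>0 rat) \<Rightarrow> (nat \<Rightarrow>\<^sub>0 int) \<Rightarrow> rat" where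
  "dot n x a = (\<Sum>l<n. Poly_Mapping.lookup x l * of_int (Poly_Mapping.lookup a l))"

definition real_vec :: "(nat \<Rightarrow>\<^sub>0 int) \<Rightarrow> (nat \<Rightarrow>\<^sub>0 real)" where
  "real_vec a = Poly_Mapping.map of_int a"

definition lattice_points :: "(nat \<Rightarrow>\<^sub>0 real) set \<Rightarrow> (nat \<Rightarrow>\<^sub>0 int) set" where
  "lattice_points P = {\<alpha>. real_vec \<alpha> \<in> P}"

definition polytope_in :: "nat \<Rightarrow> (nat \<Rightarrow>\<^sub>0 real) set \<Rightarrow> bool" where
  "polytope_in n P \<longleftrightarrow> polytope P \<and> P \<subseteq> vecs n"

definition integral_polytope_in :: "nat \<Rightarrow> (nat \<Rightarrow>\<^sub>0 real) set \<Rightarrow> bool" where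
  "integral_polytope_in n P \<longleftrightarrow>
     polytope_in n P \<and> (\<forall>x. x extreme_point_of P \<longrightarrow> x \<in> range real_vec)"

text \<open>\<^const>\<open>aff_dim\<close> is only available on Euclidean spaces. As there, the empty set gets \<open>-1\<close>.\<close>

definition affine_dim :: "(nat \<Rightarrow>\<^sub>0 real) set \<Rightarrow> int" where
  "affine_dim P = (if P = {} then - 1 else int (dim {x - y | x y. x \<in> P \<and> y \<in> P}))"

definition dilate :: "nat \<Rightarrow> (nat \<Rightarrow>\<^sub>0 real) set \<Rightarrow> (nat \<Rightarrow>\<^sub>0 real) set" where
  "dilate k P = (\<lambda>x. real k *\<^sub>R x) ` P"


section \<open>Rational generating functions\<close>

text \<open>Laurent polynomials over \<open>\<rat>\<close> form the group algebra of the exponent lattice. It is an integral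
  domain, and rational functions are the elements of its fraction field.\<close>

type_synonym laurent = "(nat \<Rightarrow>\<^sub>0 int) \<Rightarrow>\<^sub>0 rat"

definition monomial :: "(nat \<Rightarrow>\<^sub>0 int) \<Rightarrow> laurent" where
  "monomial a = Poly_Mapping.single a 1"

definition scalar :: "rat \<Rightarrow> laurent" where
  "scalar c = Poly_Mapping.single 0 c"

definition at_one :: "laurent \<Rightarrow> rat" where
  "at_one p = (\<Sum>a\<in>Poly_Mapping.keys p. Poly_Mapping.lookup p a)"

text \<open>A rational function is regular at \<open>(1, \<dots>, 1)\<close>, i.e. its singularity there (if any) is
  removable, if it has a representation whose denominator does not vanish there.\<close>

definition specializes_to :: "laurent fract \<Rightarrow> rat \<Rightarrow> bool" where
  "specializes_to f r \<longleftrightarrow>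
     (\<exists>p q. f = Fract p q \<and> at_one q \<noteq> 0 \<and> r = at_one p / at_one q)"

definition gen_fun :: "(nat \<Rightarrow>\<^sub>0 real) set \<Rightarrow> laurent" where
  "gen_fun P = (\<Sum>\<alpha>\<in>lattice_points P. monomial \<alpha>)"

text \<open>In \<open>GF n ts\<close>, the list \<open>ts\<close> consists of the triples \<open>(\<epsilon>\<^sub>i, a\<^sub>i, [b\<^sub>i\<^sub>1, \<dots>, b\<^sub>i\<^sub>s])\<close>; indices are
  counted from \<open>0\<close>.\<close>

datatype gf_data =
  GF (gf_dim: nat) (gf_terms: "(rat \<times> (nat \<Rightarrow>\<^sub>0 int) \<times> (nat \<Rightarrow>\<^sub>0 int) list) list")

definition gf_index :: "gf_data \<Rightarrow> nat set" where
  "gf_index D = {..<length (gf_terms D)}"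

definition gf_coeff :: "gf_data \<Rightarrow> nat \<Rightarrow> rat" where
  "gf_coeff D i = fst (gf_terms D ! i)"

definition gf_num :: "gf_data \<Rightarrow> nat \<Rightarrow> (nat \<Rightarrow>\<^sub>0 int)" where
  "gf_num D i = fst (snd (gf_terms D ! i))"

definition gf_len :: "gf_data \<Rightarrow> nat \<Rightarrow> nat" where
  "gf_len D i = length (snd (snd (gf_terms D ! i)))"

definition gf_den :: "gf_data \<Rightarrow> nat \<Rightarrow> nat \<Rightarrow> (nat \<Rightarrow>\<^sub>0 int)" where
  "gf_den D i j = snd (snd (gf_terms D ! i)) ! j"

text \<open>The exponents in the denominators must be nonzero for the summands to be defined.\<close>

definition valid_gf :: "gf_data \<Rightarrow> bool" where
  "valid_gf D \<longleftrightarrow> (\<forall>i\<in>gf_index D. gf_num D i \<in> vecs (gf_dim D) \<and>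
     (\<forall>j<gf_len D i. gf_den D i j \<in> vecs (gf_dim D) \<and> gf_den D i j \<noteq> 0))"

text \<open>The numerator exponents are a parameter, to be used with \<open>a\<^sub>i\<close> and with \<open>a\<^sub>i + (k - 1) v\<^sub>i\<close>.\<close>

definition rat_fun :: "gf_data \<Rightarrow> (nat \<Rightarrow> (nat \<Rightarrow>\<^sub>0 int)) \<Rightarrow> laurent fract" where
  "rat_fun D a = (\<Sum>i\<in>gf_index D. to_fract (scalar (gf_coeff D i)) *
     (to_fract (monomial (a i)) / (\<Prod>j<gf_len D i. 1 - to_fract (monomial (gf_den D i j)))))"

definition represents :: "gf_data \<Rightarrow> (nat \<Rightarrow>\<^sub>0 real) set \<Rightarrow> bool" where
  "represents D P \<longleftrightarrow> rat_fun D (gf_num D) = to_fract (gen_fun P)"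

definition enc_vec :: "nat \<Rightarrow> (nat \<Rightarrow>\<^sub>0 'a::zero) \<Rightarrow> 'a list" where
  "enc_vec n a = map (Poly_Mapping.lookup a) [0..<n]"

text \<open>The dimension is written in unary. This only matters if there are no summands: otherwise some
  vector of length \<open>n\<close> is part of the data, which takes at least \<open>n\<close> bits anyway.\<close>

definition enc_gf :: "gf_data \<Rightarrow> int list" where
  "enc_gf D = replicate (gf_dim D) 1 @ [0, int (length (gf_terms D))] @
     concat (map (\<lambda>(\<epsilon>, a, bs).
       [fst (quotient_of \<epsilon>), snd (quotient_of \<epsilon>), int (length bs)] @
       enc_vec (gf_dim D) a @ concat (map (enc_vec (gf_dim D)) bs)) (gf_terms D))"

end

theory Submission
  imports Defs
begin

text \<open>
  Fix \<open>\<lambda>\<close> with \<open>\<langle>\<lambda>, b\<^sub>i\<^sub>j\<rangle> \<noteq> 0\<close>. Substituting \<open>z\<^sub>l = exp (\<lambda>\<^sub>l t)\<close> is a ring homomorphism from Laurent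
  polynomials to power series in \<open>t\<close> whose constant term is evaluation at \<open>z = 1\<close>, so the
  specialization is the constant term of \<open>\<Sum>\<^sub>i \<epsilon>\<^sub>i exp (\<alpha>\<^sub>i t) / \<Prod>\<^sub>j (1 - exp (\<beta>\<^sub>i\<^sub>j t))\<close> with
  \<open>\<alpha>\<^sub>i = \<langle>\<lambda>, a\<^sub>i\<rangle>\<close> and \<open>\<beta>\<^sub>i\<^sub>j = \<langle>\<lambda>, b\<^sub>i\<^sub>j\<rangle>\<close>, where the poles of the summands cancel. Since
  \<open>1 - exp (\<beta> t) = - \<beta> t T\<^sub>\<beta>(t)\<close> with \<open>T\<^sub>\<beta>(t) = \<Sum>\<^sub>k (\<beta> t)\<^sup>k / (k + 1)!\<close>, one may take \<open>w\<^sub>i\<^sub>,\<^sub>l\<close> to be the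
  coefficient of \<open>t\<close> to the \<open>s\<^sub>i - l\<close> in \<open>\<Prod>\<^sub>j 1 / T\<^sub>\<beta>\<close> over \<open>\<beta> = \<beta>\<^sub>i\<^sub>j\<close>, divided by \<open>l! \<Prod>\<^sub>j (- \<beta>\<^sub>i\<^sub>j)\<close>.

  The same weights applied to \<open>a\<^sub>i + (k - 1) v\<^sub>i\<close> give a polynomial in \<open>k\<close> of degree at most \<open>s\<close>. Its
  coefficients above \<open>dim P\<close> vanish, because \<open>dim P\<close> suitable coordinates determine the points of
  \<open>k P\<close>, which therefore contains only \<open>O(k\<^sup>d)\<close> lattice points for \<open>d = dim P\<close>.

  For polynomial time, choose \<open>\<lambda>\<^sub>l = \<Phi> X\<^sup>l\<close>, where \<open>X\<close> exceeds the absolute value of every input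
  number (so that \<open>\<langle>\<lambda>, b\<rangle>\<close> is \<open>\<Phi>\<close> times a nonzero number in base \<open>X\<close>) and \<open>\<Phi>\<close> is the factorial of
  the input length. Then \<open>(k + 1)!\<close> divides \<open>\<alpha>\<close> and \<open>\<beta>\<close> in the relevant range, so the series
  \<open>exp (\<alpha> t)\<close> and \<open>T\<^sub>\<beta>\<close> have integral coefficients there, and as \<open>T\<^sub>\<beta>(0) = 1\<close> dividing by them takes
  place in the integers; all coefficients have polynomially many bits.
\<close>

section \<open>Extending a ring homomorphism to fractions\<close>

locale hom_to_field =
  fixes \<phi> :: "'a::idom \<Rightarrow> 'b::field"
  assumes hom_add: "\<phi> (x + y) = \<phi> x + \<phi> y"
    and hom_mult: "\<phi> (x * y) = \<phi> x * \<phi> y"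
    and hom_1: "\<phi> 1 = 1"
begin

text \<open>Partial, because \<open>\<phi>\<close> may vanish on the denominators of a fraction.\<close>

definition fract_image :: "'a fract \<Rightarrow> 'b \<Rightarrow> bool" where
  "fract_image f y \<longleftrightarrow> (\<exists>p q. f = Fract p q \<and> \<phi> q \<noteq> 0 \<and> y = \<phi> p / \<phi> q)"

lemma hom_0: "\<phi> 0 = 0"
  using hom_add[of 0 0] by (metis add_0 add_left_imp_eq add.right_neutral)

lemma hom_sum: "\<phi> (sum f A) = (\<Sum>x\<in>A. \<phi> (f x))"
  by (induction A rule: infinite_finite_induct) (simp_all add: hom_0 hom_add)

lemma fract_imageE:
  assumes "fract_image f y"
  obtains p q where "f = Fract p q" "q \<noteq> 0" "\<phi> q \<noteq> 0" "y = \<phi> p / \<phi> q"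
  using assms hom_0 unfolding fract_image_def by metis

lemma fract_image_unique:
  assumes "fract_image f y" "fract_image f z"
  shows "y = z"
proof -
  from assms(1) obtain p q where pq: "f = Fract p q" "q \<noteq> 0" "\<phi> q \<noteq> 0" "y = \<phi> p / \<phi> q"
    by (rule fract_imageE)
  from assms(2) obtain p' q' where
    pq': "f = Fract p' q'" "q' \<noteq> 0" "\<phi> q' \<noteq> 0" "z = \<phi> p' / \<phi> q'"
    by (rule fract_imageE)
  have "p * q' = p' * q" using pq pq' by (simp add: eq_fract)
  then have "\<phi> p * \<phi> q' = \<phi> p' * \<phi> q" by (metis hom_mult)
  then show ?thesis using pq pq' by (simp add: frac_eq_eq)
qed

lemma fract_image_to_fract: "fract_image (to_fract p) (\<phi> p)"
  unfolding fract_image_def to_fract_def by (intro exI[of _ p] exI[of _ 1]) (simp add: hom_1)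

lemma fract_image_add:
  assumes "fract_image f y" "fract_image g z"
  shows "fract_image (f + g) (y + z)"
proof -
  from assms(1) obtain p q where pq: "f = Fract p q" "q \<noteq> 0" "\<phi> q \<noteq> 0" "y = \<phi> p / \<phi> q"
    by (rule fract_imageE)
  from assms(2) obtain p' q' where
    pq': "g = Fract p' q'" "q' \<noteq> 0" "\<phi> q' \<noteq> 0" "z = \<phi> p' / \<phi> q'"
    by (rule fract_imageE)
  have "f + g = Fract (p * q' + p' * q) (q * q')" using pq pq' by simp
  moreover have "y + z = \<phi> (p * q' + p' * q) / \<phi> (q * q')"
    using pq pq' by (simp add: add_frac_eq hom_add hom_mult)
  ultimately show ?thesis unfolding fract_image_def using pq(3) pq'(3)
    by (metis hom_mult no_zero_divisors)
qed

lemma fract_image_mult: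
  assumes "fract_image f y" "fract_image g z"
  shows "fract_image (f * g) (y * z)"
proof -
  from assms(1) obtain p q where pq: "f = Fract p q" "\<phi> q \<noteq> 0" "y = \<phi> p / \<phi> q"
    by (rule fract_imageE)
  from assms(2) obtain p' q' where pq': "g = Fract p' q'" "\<phi> q' \<noteq> 0" "z = \<phi> p' / \<phi> q'"
    by (rule fract_imageE)
  show ?thesis unfolding fract_image_def
    by (intro exI[of _ "p * p'"] exI[of _ "q * q'"]) (simp add: pq pq' hom_mult)
qed

lemma fract_image_inverse:
  assumes "fract_image f y" "y \<noteq> 0"
  shows "fract_image (inverse f) (inverse y)"
proof -
  from assms(1) obtain p q where pq: "f = Fract p q" "\<phi> q \<noteq> 0" "y = \<phi> p / \<phi> q"
    by (rule fract_imageE)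
  then show ?thesis unfolding fract_image_def using assms(2)
    by (intro exI[of _ q] exI[of _ p]) auto
qed

lemma fract_image_divide:
  "fract_image f y \<Longrightarrow> fract_image g z \<Longrightarrow> z \<noteq> 0 \<Longrightarrow> fract_image (f / g) (y / z)"
  unfolding divide_inverse by (intro fract_image_mult fract_image_inverse)

lemma fract_image_sum:
  "(\<And>i. i \<in> A \<Longrightarrow> fract_image (f i) (y i)) \<Longrightarrow> fract_image (sum f A) (sum y A)"
proof (induction A rule: infinite_finite_induct)
  case (insert x A)
  then show ?case by (auto intro: fract_image_add)
qed (use fract_image_to_fract[of 0] hom_0 in auto)

end

section \<open>Exponential substitution\<close>

definition exp_series :: "('g \<Rightarrow> 'a) \<Rightarrow> ('g \<Rightarrow>\<^sub>0 'a) \<Rightarrow> 'a::field_char_0 fps" where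
  "exp_series h p = (\<Sum>a\<in>Poly_Mapping.keys p. fps_const (Poly_Mapping.lookup p a) * fps_exp (h a))"

lemma exp_series_superset:
  assumes "finite A" "Poly_Mapping.keys p \<subseteq> A"
  shows "exp_series h p = (\<Sum>a\<in>A. fps_const (Poly_Mapping.lookup p a) * fps_exp (h a))"
  unfolding exp_series_def using assms
  by (intro sum.mono_neutral_left) (auto simp: in_keys_iff)

lemma exp_series_add: "exp_series h (p + q) = exp_series h p + exp_series h q"
proof -
  let ?A = "Poly_Mapping.keys p \<union> Poly_Mapping.keys q"
  have "Poly_Mapping.keys (p + q) \<subseteq> ?A" by (rule keys_add)
  then show ?thesis
    by (simp add: exp_series_superset[of ?A] lookup_add sum.distrib algebra_simps
        flip: fps_const_add)
qed

lemma exp_series_diff: "exp_series h (p - q) = exp_series h p - exp_series h q"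
  for p q :: "'g \<Rightarrow>\<^sub>0 'a::field_char_0"
  using exp_series_add[of h "p - q" q] by simp

lemma exp_series_single:
  "exp_series h (Poly_Mapping.single a c) = fps_const c * fps_exp (h a)"
  by (cases "c = 0") (auto simp: exp_series_def)

lemma exp_series_sum: "exp_series h (sum f A) = (\<Sum>x\<in>A. exp_series h (f x))"
proof (induction A rule: infinite_finite_induct)
  case (insert x A)
  then show ?case by (simp add: exp_series_add)
qed (simp_all add: exp_series_def)

lemma exp_series_1: "Modules.additive h \<Longrightarrow> exp_series h 1 = 1"
  using exp_series_single[of h 0 1] Modules.additive.zero[of h] by simp

lemma exp_series_mult:
  assumes "Modules.additive h"
  shows "exp_series h (p * q) = exp_series h p * exp_series h q"
proof -
  let ?s = "\<lambda>p a. Poly_Mapping.single a (Poly_Mapping.lookup p a)"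
  have decomp: "p = (\<Sum>a\<in>Poly_Mapping.keys p. ?s p a)" for p :: "'a \<Rightarrow>\<^sub>0 'b"
    by (rule poly_mapping_eqI) (simp add: lookup_sum lookup_single when_def in_keys_iff)
  have "p * q = (\<Sum>a\<in>Poly_Mapping.keys p. \<Sum>b\<in>Poly_Mapping.keys q. ?s p a * ?s q b)"
    by (subst decomp[of p], subst decomp[of q]) (simp add: sum_product)
  also have "exp_series h \<dots> = (\<Sum>a\<in>Poly_Mapping.keys p. \<Sum>b\<in>Poly_Mapping.keys q.
      (fps_const (Poly_Mapping.lookup p a) * fps_exp (h a)) *
      (fps_const (Poly_Mapping.lookup q b) * fps_exp (h b)))"
    by (simp add: exp_series_sum mult_single exp_series_single Modules.additive.add[OF assms]
        fps_exp_add_mult mult_ac flip: fps_const_mult)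
  also have "\<dots> = exp_series h p * exp_series h q"
    by (simp add: exp_series_def sum_product)
  finally show ?thesis .
qed

lemma exp_series_nth_0: "fps_nth (exp_series h p) 0 = at_one p"
  by (simp add: exp_series_def at_one_def fps_sum_nth)

interpretation at_one: hom_to_field at_one
proof
  have "Modules.additive (\<lambda>_ :: nat \<Rightarrow>\<^sub>0 int. 0 :: rat)" by (simp add: Modules.additive_def)
  then show "at_one (p * q) = at_one p * at_one q" "at_one (p + q) = at_one p + at_one q"
    "at_one 1 = 1" for p q
    by (simp_all add: exp_series_add exp_series_mult exp_series_1
        flip: exp_series_nth_0[of "\<lambda>_. 0"])
qed

lemma specializes_to_iff: "specializes_to f r \<longleftrightarrow> at_one.fract_image f r"
  by (simp add: specializes_to_def at_one.fract_image_def)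

lemma specializes_to_gen_fun:
  "specializes_to (to_fract (gen_fun P)) (of_nat (card (lattice_points P)))"
proof -
  have "at_one (gen_fun P) = of_nat (card (lattice_points P))"
    by (simp add: gen_fun_def at_one.hom_sum) (simp add: monomial_def at_one_def)
  then show ?thesis
    using at_one.fract_image_to_fract[of "gen_fun P"] by (simp add: specializes_to_iff)
qed

abbreviation exp_laurent :: "((nat \<Rightarrow>\<^sub>0 int) \<Rightarrow> rat) \<Rightarrow> laurent \<Rightarrow> rat fls" where
  "exp_laurent h p \<equiv> fps_to_fls (exp_series h p)"

lemma hom_exp_laurent: "Modules.additive h \<Longrightarrow> hom_to_field (exp_laurent h)"
  by unfold_locales
    (simp_all add: exp_series_add exp_series_mult exp_series_1 fls_times_fps_to_fls)

lemma specializes_to_exp_laurent: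
  assumes h: "Modules.additive h" and "specializes_to f r"
      "hom_to_field.fract_image (exp_laurent h) f F"
  shows "r = fls_nth F 0"
proof -
  interpret exp: hom_to_field "exp_laurent h" using h by (rule hom_exp_laurent)
  from assms(2) obtain p q where
    pq: "f = Fract p q" "at_one q \<noteq> 0" "r = at_one p / at_one q"
    unfolding specializes_to_def by auto
  let ?p = "exp_series h p" and ?q = "exp_series h q"
  have q0: "fps_nth ?q 0 \<noteq> 0" using pq by (simp add: exp_series_nth_0)
  then have "?q \<noteq> 0" by auto
  then have "exp.fract_image f (fps_to_fls ?p / fps_to_fls ?q)"
    using pq unfolding exp.fract_image_def by auto
  with assms(3) have "F = fps_to_fls ?p / fps_to_fls ?q" by (rule exp.fract_image_unique)
  also have "\<dots> = fps_to_fls (?p * inverse ?q)"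
    using q0 by (simp add: fls_times_fps_to_fls fls_inverse_fps_to_fls divide_inverse)
  finally show ?thesis using pq q0 by (simp add: exp_series_nth_0 divide_inverse)
qed

section \<open>Weights from Todd polynomials\<close>

definition todd_factor :: "rat \<Rightarrow> rat fps" where
  "todd_factor b = Abs_fps (\<lambda>k. b ^ k / fact (Suc k))"

definition todd_series :: "rat list \<Rightarrow> rat fps" where
  "todd_series bs = (\<Prod>b\<leftarrow>bs. inverse (todd_factor b))"

definition weight :: "rat list \<Rightarrow> nat \<Rightarrow> rat" where
  "weight bs l = fps_nth (todd_series bs) (length bs - l) / (fact l * (\<Prod>b\<leftarrow>bs. - b))"

lemma todd_factor_0 [simp]: "fps_nth (todd_factor b) 0 = 1"
  by (simp add: todd_factor_def)

lemma todd_factor_inverse: "todd_factor b * inverse (todd_factor b) = 1"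
  using inverse_mult_eq_1[of "todd_factor b"] by (simp add: mult.commute)

lemma one_minus_exp: "1 - fps_exp b = fps_const (- b) * fps_X * todd_factor b"
proof (rule fps_ext)
  fix k
  show "fps_nth (1 - fps_exp b) k = fps_nth (fps_const (- b) * fps_X * todd_factor b) k"
    by (cases k) (simp_all add: todd_factor_def mult.assoc del: fact_Suc)
qed

lemma prod_one_minus_exp:
  "(\<Prod>b\<leftarrow>bs. 1 - fps_exp b) * todd_series bs = fps_const (\<Prod>b\<leftarrow>bs. - b) * fps_X ^ length bs"
proof (induction bs)
  case Nil
  then show ?case by (simp add: todd_series_def)
next
  case (Cons b bs)
  have factor: "(1 - fps_exp b) * inverse (todd_factor b) = fps_const (- b) * fps_X"
    by (simp add: one_minus_exp mult.assoc todd_factor_inverse)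
  have "(\<Prod>b\<leftarrow>b # bs. 1 - fps_exp b) * todd_series (b # bs) =
     ((1 - fps_exp b) * inverse (todd_factor b)) * ((\<Prod>b\<leftarrow>bs. 1 - fps_exp b) * todd_series bs)"
    by (simp add: todd_series_def mult_ac)
  also have "\<dots> = fps_const (- b) * fps_X * (fps_const (\<Prod>b\<leftarrow>bs. - b) * fps_X ^ length bs)"
    by (simp only: factor Cons)
  also have "\<dots> = (fps_const (- b) * fps_const (\<Prod>b\<leftarrow>bs. - b)) * fps_X ^ length (b # bs)"
    by (simp add: mult_ac del: fps_const_neg fps_const_mult)
  finally show ?case by simp
qed

lemma prod_one_minus_exp_nonzero: "0 \<notin> set bs \<Longrightarrow> (\<Prod>b\<leftarrow>bs. 1 - fps_exp b) \<noteq> (0 :: rat fps)"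
  using prod_one_minus_exp[of bs] by (auto simp: prod_list_zero_iff)

lemma nth_0_exp_div_prod:
  assumes "0 \<notin> set bs"
  shows "fls_nth (fps_to_fls (fps_exp a) / fps_to_fls (\<Prod>b\<leftarrow>bs. 1 - fps_exp b)) 0 =
    (\<Sum>l=0..length bs. weight bs l * a ^ l)"
proof -
  let ?s = "length bs" and ?c = "\<Prod>b\<leftarrow>bs. - b" and ?T = "todd_series bs"
  let ?P = "\<Prod>b\<leftarrow>bs. 1 - fps_exp b"
  let ?Q = "fps_to_fls (fps_exp a) / fps_to_fls ?P"
  have nonzero: "?c \<noteq> 0" using assms by (auto simp: prod_list_zero_iff)
  have prod_eq: "?P * ?T = fps_const ?c * fps_X ^ ?s" by (rule prod_one_minus_exp)
  have "?Q * fps_to_fls (?P * ?T) = fps_to_fls (fps_exp a * ?T)"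
    using prod_one_minus_exp_nonzero[OF assms] by (simp add: fls_times_fps_to_fls)
  then have "fls_shift (- int ?s) (fls_const ?c * ?Q) = fps_to_fls (fps_exp a * ?T)"
    unfolding prod_eq
    by (simp add: fls_times_fps_to_fls fps_to_fls_power mult.assoc[symmetric] mult.commute[of ?Q]
        fls_X_power_times_conv_shift(2)[symmetric])
      (simp add: mult_ac)
  then have "fls_nth (fls_shift (- int ?s) (fls_const ?c * ?Q)) (int ?s) =
      fls_nth (fps_to_fls (fps_exp a * ?T)) (int ?s)"
    by (rule arg_cong)
  then have "fls_nth ?Q 0 = fps_nth (fps_exp a * ?T) ?s / ?c"
    using nonzero by (simp add: eq_divide_eq mult.commute del: times_divide_eq_right)
  also have "\<dots> = (\<Sum>l=0..?s. weight bs l * a ^ l)"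
    by (simp add: fps_mult_nth sum_divide_distrib weight_def field_simps)
  finally show ?thesis .
qed

definition gf_dens :: "gf_data \<Rightarrow> nat \<Rightarrow> (nat \<Rightarrow>\<^sub>0 int) list" where
  "gf_dens D i = snd (snd (gf_terms D ! i))"

lemma gf_len_eq: "gf_len D i = length (gf_dens D i)"
  by (simp add: gf_len_def gf_dens_def)

lemma gf_den_eq: "gf_den D i j = gf_dens D i ! j"
  by (simp add: gf_den_def gf_dens_def)

lemma fract_image_summand:
  assumes h: "Modules.additive h" and ne: "0 \<notin> set (map h bs)"
  shows "hom_to_field.fract_image (exp_laurent h)
    (to_fract (scalar c) *
      (to_fract (monomial a) / (\<Prod>j<length bs. 1 - to_fract (monomial (bs ! j)))))
    (fls_const c * (fps_to_fls (fps_exp (h a)) / fps_to_fls (\<Prod>b\<leftarrow>map h bs. 1 - fps_exp b)))"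
proof -
  interpret exp: hom_to_field "exp_laurent h" using h by (rule hom_exp_laurent)
  let ?p = "\<Prod>j<length bs. 1 - monomial (bs ! j)"
  have "exp_series h (prod f {..<k}) = (\<Prod>j<k. exp_series h (f j))" for f and k :: nat
    by (induction k) (simp_all add: exp_series_1 exp_series_mult h)
  then have "exp_laurent h ?p = fps_to_fls (\<Prod>j<length bs. 1 - fps_exp (h (bs ! j)))"
    by (simp add: exp_series_diff exp_series_single exp_series_1 h monomial_def)
  also have "(\<Prod>j<length bs. 1 - fps_exp (h (bs ! j))) = (\<Prod>b\<leftarrow>map h bs. 1 - fps_exp b)"
    by (simp add: prod.list_conv_set_nth atLeast0LessThan)
  finally have den: "exp_laurent h ?p = fps_to_fls (\<Prod>b\<leftarrow>map h bs. 1 - fps_exp b)" .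
  have "to_fract (prod f {..<k}) = (\<Prod>j<k. to_fract (f j))" for f :: "nat \<Rightarrow> laurent" and k
    by (induction k) simp_all
  then have "(\<Prod>j<length bs. 1 - to_fract (monomial (bs ! j))) = to_fract ?p" by simp
  moreover have "exp_laurent h (scalar c) = fls_const c"
    "exp_laurent h (monomial a) = fps_to_fls (fps_exp (h a))"
    by (simp_all add: scalar_def monomial_def exp_series_single Modules.additive.zero[OF h])
  moreover have "exp_laurent h ?p \<noteq> 0"
    unfolding den using prod_one_minus_exp_nonzero[OF ne] by simp
  ultimately show ?thesis
    unfolding den[symmetric]
    by (metis exp.fract_image_mult exp.fract_image_divide exp.fract_image_to_fract)
qed

theorem specialization_eq_weighted_sum:
  assumes h: "Modules.additive h" and sp: "specializes_to (rat_fun D a) r"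
    and ne: "\<And>i. i \<in> gf_index D \<Longrightarrow> 0 \<notin> set (map h (gf_dens D i))"
  shows "r = (\<Sum>i\<in>gf_index D. gf_coeff D i *
    (\<Sum>l=0..gf_len D i. weight (map h (gf_dens D i)) l * h (a i) ^ l))"
proof -
  interpret exp: hom_to_field "exp_laurent h" using h by (rule hom_exp_laurent)
  let ?F = "\<lambda>i. fls_const (gf_coeff D i) *
    (fps_to_fls (fps_exp (h (a i))) / fps_to_fls (\<Prod>b\<leftarrow>map h (gf_dens D i). 1 - fps_exp b))"
  have "exp.fract_image (rat_fun D a) (\<Sum>i\<in>gf_index D. ?F i)"
    unfolding rat_fun_def gf_len_eq gf_den_eq
    by (intro exp.fract_image_sum fract_image_summand h ne)
  with h sp have "r = fls_nth (\<Sum>i\<in>gf_index D. ?F i) 0"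
    by (rule specializes_to_exp_laurent)
  also have "\<dots> = (\<Sum>i\<in>gf_index D. gf_coeff D i *
      (\<Sum>l=0..gf_len D i. weight (map h (gf_dens D i)) l * h (a i) ^ l))"
    unfolding fls_nth_sum fls_mult_const_nth gf_len_eq
    using nth_0_exp_div_prod[OF ne] by (intro sum.cong) auto
  finally show ?thesis .
qed

section \<open>Growth of lattice point counts\<close>

lemma lookup_scaleR [simp]:
  "Poly_Mapping.lookup (r *\<^sub>R x) l = r *\<^sub>R Poly_Mapping.lookup x l"
proof -
  have "finite {l. r *\<^sub>R Poly_Mapping.lookup x l \<noteq> 0}"
    by (rule finite_subset[OF _ finite_lookup[of x]]) auto
  then show ?thesis by (simp add: scaleR_poly_mapping_def)
qed

lemma lookup_real_vec [simp]:
  "Poly_Mapping.lookup (real_vec a) l = of_int (Poly_Mapping.lookup a l)"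
  by (simp add: real_vec_def Poly_Mapping.map.rep_eq when_def)

lemma inj_real_vec: "inj real_vec"
  by (rule injI) (metis lookup_real_vec of_int_eq_iff poly_mapping_eqI)

lemma linear_lookup: "linear (\<lambda>x :: 'a \<Rightarrow>\<^sub>0 real. Poly_Mapping.lookup x l)"
  by (rule linearI) (simp_all add: lookup_add)

lemma abs_lookup_le_norm: "\<bar>Poly_Mapping.lookup x l\<bar> \<le> norm x"
  for x :: "'a \<Rightarrow>\<^sub>0 real"
proof (cases "l \<in> Poly_Mapping.keys x")
  case True
  then show ?thesis
    using member_le_sum[of l "Poly_Mapping.keys x" "\<lambda>l. \<bar>Poly_Mapping.lookup x l\<bar>"]
    by (simp add: norm_poly_mapping_def dist_poly_mapping_def)
qed (simp add: in_keys_iff)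

lemma in_vecs_iff: "x \<in> vecs n \<longleftrightarrow> (\<forall>l\<ge>n. Poly_Mapping.lookup x l = 0)"
  by (auto simp: vecs_def in_keys_iff subset_iff) (metis not_le)

lemma subspace_vecs: "subspace (vecs n :: (nat \<Rightarrow>\<^sub>0 real) set)"
  by (auto simp: subspace_def in_vecs_iff lookup_add)

lemma vecs_subset_span:
  "(vecs n :: (nat \<Rightarrow>\<^sub>0 real) set) \<subseteq> span ((\<lambda>l. Poly_Mapping.single l 1) ` {..<n})"
proof
  fix x :: "nat \<Rightarrow>\<^sub>0 real"
  assume "x \<in> vecs n"
  then have "x = (\<Sum>l<n. Poly_Mapping.lookup x l *\<^sub>R Poly_Mapping.single l 1)"
    by (intro poly_mapping_eqI)
      (auto simp: lookup_sum lookup_single when_def in_vecs_iff not_less sum.delta' if_distrib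
          cong: if_cong)
  also have "\<dots> \<in> span ((\<lambda>l. Poly_Mapping.single l 1) ` {..<n})"
    by (intro span_sum span_scale span_base) auto
  finally show "x \<in> span ((\<lambda>l. Poly_Mapping.single l 1) ` {..<n})" .
qed

lemma card_independent_le_dim:
  fixes V :: "(nat \<Rightarrow>\<^sub>0 real) set"
  assumes "V \<subseteq> vecs n" "S \<subseteq> span V" "independent S"
  shows "card S \<le> dim V"
proof -
  obtain B where B: "B \<subseteq> V" "independent B" "V \<subseteq> span B" "card B = dim V"
    using basis_exists by blast
  have "B \<subseteq> span ((\<lambda>l. Poly_Mapping.single l 1) ` {..<n})"
    using B(1) assms(1) vecs_subset_span by blast
  then have "finite B" using independent_span_bound[OF _ B(2)] by blast
  moreover have "S \<subseteq> span B"
    using assms(2) B(3) by (metis span_minimal subspace_span subset_trans)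
  ultimately show "card S \<le> dim V"
    using independent_span_bound[of B S] assms(3) B(4) by auto
qed

lemma independent_dual_family:
  fixes f :: "'i \<Rightarrow> 'v::real_vector" and \<phi> :: "'i \<Rightarrow> 'v \<Rightarrow> real"
  assumes "\<And>i. i \<in> S \<Longrightarrow> linear (\<phi> i)"
    and dual: "\<And>i j. i \<in> S \<Longrightarrow> j \<in> S \<Longrightarrow> \<phi> i (f j) = 0 \<longleftrightarrow> i \<noteq> j"
  shows "independent (f ` S)" "inj_on f S"
proof -
  show "inj_on f S" by (rule inj_onI) (metis dual)
  show "independent (f ` S)"
  proof (subst independent_explicit_finite_subsets, intro allI impI ballI)
    fix A u v
    assume A: "A \<subseteq> f ` S" "finite A" "(\<Sum>w\<in>A. u w *\<^sub>R w) = 0" "v \<in> A"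
    then obtain i where i: "i \<in> S" "v = f i" by blast
    have lin: "linear (\<phi> i)" using assms(1) i by blast
    have "0 = \<phi> i (\<Sum>w\<in>A. u w *\<^sub>R w)" using A(3) linear_0[OF lin] by simp
    also have "\<dots> = (\<Sum>w\<in>A. u w * \<phi> i w)"
      by (simp add: linear_sum[OF lin] linear_scale[OF lin])
    also have "\<dots> = (\<Sum>w\<in>A. if w = v then u v * \<phi> i v else 0)"
    proof (rule sum.cong[OF refl])
      fix w assume "w \<in> A"
      then obtain j where j: "j \<in> S" "w = f j" using A(1) by blast
      then show "u w * \<phi> i w = (if w = v then u v * \<phi> i v else 0)"
        using dual[OF i(1) j(1)] i(2) by auto
    qed
    also have "\<dots> = u v * \<phi> i v" using A by simp
    finally show "u v = 0" using i dual by simp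
  qed
qed

definition separates :: "'a set \<Rightarrow> ('a \<Rightarrow>\<^sub>0 real) set \<Rightarrow> bool" where
  "separates S V \<longleftrightarrow> (\<forall>x\<in>V. (\<forall>l\<in>S. Poly_Mapping.lookup x l = 0) \<longrightarrow> x = 0)"

lemma separates_vecs: "separates {..<n} (vecs n)"
  unfolding separates_def Ball_def in_vecs_iff
  by (metis lessThan_iff lookup_zero not_le poly_mapping_eqI)

text \<open>A separating set of coordinates that is minimal under inclusion has as many elements as a
  family of vectors dual to it, which is independent.\<close>

lemma separates_few_coordinates:
  fixes V :: "(nat \<Rightarrow>\<^sub>0 real) set"
  assumes "V \<subseteq> vecs n"
  obtains S where "finite S" "card S \<le> dim V" "separates S V"
proof -
  have "span V \<subseteq> vecs n" using assms subspace_vecs by (simp add: span_minimal)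
  then have "separates {..<n} (span V)" using separates_vecs[of n] by (auto simp: separates_def)
  then obtain S where S: "S \<subseteq> {..<n}" "separates S (span V)"
    and "\<forall>T\<in>{T. T \<subseteq> {..<n} \<and> separates T (span V)}. T \<subseteq> S \<longrightarrow> S = T"
    using finite_has_minimal2[of "{T. T \<subseteq> {..<n} \<and> separates T (span V)}" "{..<n}"]
    by auto
  then have minimal: "\<not> separates T (span V)" if "T \<subset> S" for T using that by blast
  have "\<exists>x\<in>span V. \<forall>k\<in>S. Poly_Mapping.lookup x k = 0 \<longleftrightarrow> k \<noteq> l" if "l \<in> S" for l
  proof -
    have "\<not> separates (S - {l}) (span V)" using that by (intro minimal) auto
    then show ?thesis using S(2) unfolding separates_def by blast
  qed
  then obtain f where dual: "\<And>l. l \<in> S \<Longrightarrow> f l \<in> span V"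
    "\<And>l k. l \<in> S \<Longrightarrow> k \<in> S \<Longrightarrow> Poly_Mapping.lookup (f l) k = 0 \<longleftrightarrow> k \<noteq> l"
    by metis
  have "independent (f ` S)" "inj_on f S"
    using independent_dual_family[of S "\<lambda>k x. Poly_Mapping.lookup x k" f] dual(2)
    by (auto simp: linear_lookup)
  moreover have "f ` S \<subseteq> span V" using dual(1) by blast
  ultimately have "card S \<le> dim V"
    using card_independent_le_dim[OF assms] card_image by metis
  moreover have "separates S V" using S(2) span_base by (auto simp: separates_def)
  ultimately show thesis using that S(1) finite_subset by blast
qed

lemma card_le_power_of_separating_coordinates:
  fixes L :: "('a \<Rightarrow>\<^sub>0 int) set"
  assumes "finite S" and inj: "inj_on (\<lambda>\<alpha>. restrict (Poly_Mapping.lookup \<alpha>) S) L"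
    and bound: "\<And>\<alpha> l. \<alpha> \<in> L \<Longrightarrow> \<bar>Poly_Mapping.lookup \<alpha> l\<bar> \<le> int M"
  shows "card L \<le> (2 * M + 1) ^ card S"
proof -
  let ?r = "\<lambda>\<alpha>. restrict (Poly_Mapping.lookup \<alpha>) S"
  have "?r ` L \<subseteq> S \<rightarrow>\<^sub>E {- int M..int M}"
    using bound by (auto simp: abs_le_iff minus_le_iff)
  then have "card (?r ` L) \<le> card (S \<rightarrow>\<^sub>E {- int M..int M})"
    using assms(1) by (intro card_mono finite_PiE) auto
  also have "\<dots> = (2 * M + 1) ^ card S"
    using assms(1) by (simp add: card_PiE nat_add_distrib nat_mult_distrib mult.commute)
  finally show ?thesis using card_image[OF inj] by simp
qed

lemma dilateE:
  assumes "\<alpha> \<in> lattice_points (dilate k P)"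
  obtains x where "x \<in> P" "real_vec \<alpha> = real k *\<^sub>R x"
  using assms by (auto simp: lattice_points_def dilate_def)

lemma inj_on_restrict_lattice_points_dilate:
  assumes "separates S {x - y | x y. x \<in> P \<and> y \<in> P}" "k \<ge> 1"
  shows "inj_on (\<lambda>\<alpha>. restrict (Poly_Mapping.lookup \<alpha>) S) (lattice_points (dilate k P))"
proof (rule inj_onI)
  fix \<alpha> \<beta>
  assume \<alpha>: "\<alpha> \<in> lattice_points (dilate k P)" and \<beta>: "\<beta> \<in> lattice_points (dilate k P)"
    and restrict_eq: "restrict (Poly_Mapping.lookup \<alpha>) S = restrict (Poly_Mapping.lookup \<beta>) S"
  obtain x where x: "x \<in> P" "real_vec \<alpha> = real k *\<^sub>R x" using \<alpha> by (rule dilateE)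
  obtain y where y: "y \<in> P" "real_vec \<beta> = real k *\<^sub>R y" using \<beta> by (rule dilateE)
  have "Poly_Mapping.lookup (x - y) l = 0" if "l \<in> S" for l
  proof -
    have "Poly_Mapping.lookup \<alpha> l = Poly_Mapping.lookup \<beta> l"
      using restrict_eq that by (metis restrict_apply')
    then have "Poly_Mapping.lookup (real_vec \<alpha>) l = Poly_Mapping.lookup (real_vec \<beta>) l" by simp
    then show ?thesis using assms(2) unfolding x(2) y(2) by (simp add: lookup_minus)
  qed
  then have "x - y = 0" using assms(1) x(1) y(1) unfolding separates_def by blast
  then have "real_vec \<alpha> = real_vec \<beta>" using x(2) y(2) by simp
  then show "\<alpha> = \<beta>" using inj_real_vec by (simp add: inj_eq)
qed

lemma lookup_lattice_points_dilate_bounded: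
  assumes "polytope P"
  obtains C where "\<And>k \<alpha> l. \<alpha> \<in> lattice_points (dilate k P) \<Longrightarrow>
    \<bar>Poly_Mapping.lookup \<alpha> l\<bar> \<le> int (C * k)"
proof -
  from polytope_imp_bounded[OF assms] obtain b where b: "\<And>x. x \<in> P \<Longrightarrow> norm x \<le> b"
    by (auto simp: bounded_iff)
  have "\<bar>Poly_Mapping.lookup \<alpha> l\<bar> \<le> int (nat \<lceil>b\<rceil> * k)"
    if \<alpha>: "\<alpha> \<in> lattice_points (dilate k P)" for k \<alpha> l
  proof -
    obtain x where x: "x \<in> P" "real_vec \<alpha> = real k *\<^sub>R x" using \<alpha> by (rule dilateE)
    have "real_of_int (Poly_Mapping.lookup \<alpha> l) = Poly_Mapping.lookup x l * real k"
      using lookup_real_vec[of \<alpha> l] unfolding x(2) by (simp add: mult.commute)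
    then have "\<bar>real_of_int (Poly_Mapping.lookup \<alpha> l)\<bar> = \<bar>Poly_Mapping.lookup x l\<bar> * real k"
      by (simp add: abs_mult)
    also have "\<dots> \<le> real (nat \<lceil>b\<rceil>) * real k"
      using abs_lookup_le_norm[of x l] b[OF x(1)] by (intro mult_right_mono) linarith+
    finally show ?thesis by (metis of_int_abs of_int_le_iff of_int_of_nat_eq of_nat_mult)
  qed
  then show thesis by (rule that)
qed

lemma card_lattice_points_dilate_le:
  assumes "polytope_in n P" "affine_dim P = int d"
  obtains C :: nat where "\<And>k. k \<ge> 1 \<Longrightarrow> card (lattice_points (dilate k P)) \<le> C * k ^ d"
proof -
  let ?V = "{x - y | x y. x \<in> P \<and> y \<in> P}"
  have P: "polytope P" "P \<subseteq> vecs n" using assms(1) by (auto simp: polytope_in_def)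
  have dim_eq: "dim ?V = d" using assms(2) by (simp add: affine_dim_def split: if_splits)
  have "?V \<subseteq> vecs n" using P(2) subspace_vecs[of n] by (auto intro: subspace_diff)
  then obtain S where S: "finite S" "card S \<le> d" "separates S ?V"
    by (rule separates_few_coordinates) (use dim_eq in simp)
  obtain C where C: "\<And>k \<alpha> l. \<alpha> \<in> lattice_points (dilate k P) \<Longrightarrow>
      \<bar>Poly_Mapping.lookup \<alpha> l\<bar> \<le> int (C * k)"
    using lookup_lattice_points_dilate_bounded[OF P(1)] by blast
  have "card (lattice_points (dilate k P)) \<le> (2 * C + 1) ^ d * k ^ d" if k: "k \<ge> 1" for k
  proof -
    have "card (lattice_points (dilate k P)) \<le> (2 * (C * k) + 1) ^ card S"
      using inj_on_restrict_lattice_points_dilate[OF S(3) k] S(1) C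
      by (intro card_le_power_of_separating_coordinates)
    also have "\<dots> \<le> (2 * (C * k) + 1) ^ d" using S(2) by (intro power_increasing) auto
    also have "\<dots> \<le> ((2 * C + 1) * k) ^ d" using k by (intro power_mono) (auto simp: algebra_simps)
    finally show ?thesis by (simp only: power_mult_distrib)
  qed
  then show thesis by (rule that)
qed

lemma degree_le_of_growth:
  fixes p :: "real poly"
  assumes "\<And>k :: nat. k \<ge> 1 \<Longrightarrow> \<bar>poly p (real k)\<bar> \<le> C * real k ^ d"
  shows "degree p \<le> d"
proof (rule ccontr)
  assume "\<not> degree p \<le> d"
  then obtain e where degree_eq: "degree p = d + Suc e"
    by (metis not_le less_imp_add_positive gr0_implies_Suc)
  have at_top: "filterlim (\<lambda>k. real k) at_infinity sequentially"
    by (intro filterlim_at_top_imp_at_infinity filterlim_real_sequentially)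
  have "(\<lambda>k. poly p (real k) / real k ^ degree p) \<longlonglongrightarrow> lead_coeff p"
    by (rule filterlim_compose[OF poly_divide_tendsto_aux at_top])
  moreover have "(\<lambda>k. poly p (real k) / real k ^ degree p) \<longlonglongrightarrow> 0"
  proof (rule Lim_null_comparison)
    show "(\<lambda>k. \<bar>C\<bar> / real k) \<longlonglongrightarrow> 0" by (rule lim_const_over_n)
    have "norm (poly p (real k) / real k ^ degree p) \<le> \<bar>C\<bar> / real k" if k: "k \<ge> 1" for k
    proof -
      have "\<bar>poly p (real k)\<bar> * real k \<le> C * real k ^ d * real k"
        using assms[OF k] by (intro mult_right_mono) auto
      also have "\<dots> \<le> \<bar>C\<bar> * real k ^ (d + Suc e)"
        unfolding mult.assoc using k
        by (intro mult_mono) (auto simp: power_Suc2[symmetric] simp del: power_Suc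
          intro!: power_increasing)
      finally show ?thesis using k by (simp add: degree_eq field_simps)
    qed
    then show "\<forall>\<^sub>F k in sequentially. norm (poly p (real k) / real k ^ degree p) \<le> \<bar>C\<bar> / real k"
      by (rule eventually_sequentiallyI)
  qed
  ultimately have "lead_coeff p = 0" by (rule LIMSEQ_unique)
  then have "p = 0" by (simp only: leading_coeff_0_iff)
  then show False using degree_eq by simp
qed

lemma dilation_count_coeff_eq_0:
  fixes c :: "nat \<Rightarrow> rat"
  assumes P: "polytope_in n P" "affine_dim P = int d"
    and count: "\<And>k. k \<ge> 1 \<Longrightarrow>
      of_nat (card (lattice_points (dilate k P))) = (\<Sum>m\<le>S. c m * of_nat k ^ m)"
    and m: "m \<le> S" "d < m"
  shows "c m = 0"
proof -
  obtain C where C: "\<And>k. k \<ge> 1 \<Longrightarrow> card (lattice_points (dilate k P)) \<le> C * k ^ d"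
    using card_lattice_points_dilate_le[OF P] by blast
  define p where "p = (\<Sum>m\<le>S. monom (real_of_rat (c m)) m)"
  have "poly p (real k) = real (card (lattice_points (dilate k P)))" if "k \<ge> 1" for k
  proof -
    have "poly p (real k) = real_of_rat (\<Sum>m\<le>S. c m * of_nat k ^ m)"
      by (simp add: p_def poly_sum poly_monom of_rat_sum of_rat_mult of_rat_power)
    then show ?thesis by (simp flip: count[OF that])
  qed
  moreover have "real (card (lattice_points (dilate k P))) \<le> real C * real k ^ d" if "k \<ge> 1" for k
    using C[OF that] by (metis of_nat_le_iff of_nat_mult of_nat_power)
  ultimately have "degree p \<le> d" by (intro degree_le_of_growth[where C = "real C"]) simp
  then have "coeff p m = 0" using m(2) by (intro coeff_eq_0) simp
  then show "c m = 0" using m(1) by (simp add: p_def coeff_sum)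
qed

lemma dilation_count_truncate:
  fixes c :: "nat \<Rightarrow> rat"
  assumes P: "polytope_in n P"
    and count: "\<And>k. k \<ge> 1 \<Longrightarrow>
      of_nat (card (lattice_points (dilate k P))) = (\<Sum>m\<le>S. c m * of_nat k ^ m)"
    and k: "k \<ge> 1"
  shows "of_nat (card (lattice_points (dilate k P))) =
    (\<Sum>m | int m \<le> min (int S) (affine_dim P). c m * of_nat k ^ m)"
proof (cases "P = {}")
  case True
  then have "{m. int m \<le> min (int S) (affine_dim P)} = {}" by (auto simp: affine_dim_def)
  moreover have "card (lattice_points (dilate k P)) = 0"
    using True by (simp add: lattice_points_def dilate_def)
  ultimately show ?thesis by (simp only: sum.empty of_nat_0)
next
  case False
  then obtain d where dim_eq: "affine_dim P = int d" by (simp add: affine_dim_def)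
  have "c m = 0" if "m \<le> S" "d < m" for m
    by (rule dilation_count_coeff_eq_0[OF P dim_eq count that])
  then have "(\<Sum>m\<le>S. c m * of_nat k ^ m) =
      (\<Sum>m | int m \<le> min (int S) (affine_dim P). c m * of_nat k ^ m)"
    by (intro sum.mono_neutral_right) (auto simp: dim_eq)
  then show ?thesis using count[OF k] by simp
qed

section \<open>Counting lattice points with weights\<close>

definition gf_weight :: "gf_data \<Rightarrow> (nat \<Rightarrow>\<^sub>0 rat) \<Rightarrow> nat \<Rightarrow> nat \<Rightarrow> rat" where
  "gf_weight D lam i l = weight (map (dot (gf_dim D) lam) (gf_dens D i)) l"

definition weighted_sum ::
  "gf_data \<Rightarrow> (nat \<Rightarrow>\<^sub>0 rat) \<Rightarrow> (nat \<Rightarrow> nat \<Rightarrow> rat) \<Rightarrow> (nat \<Rightarrow> (nat \<Rightarrow>\<^sub>0 int)) \<Rightarrow> rat" where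
  "weighted_sum D lam w a = (\<Sum>i\<in>gf_index D. gf_coeff D i *
     (\<Sum>l=0..gf_len D i. w i l * dot (gf_dim D) lam (a i) ^ l))"

definition generic_for :: "(nat \<Rightarrow>\<^sub>0 rat) \<Rightarrow> gf_data \<Rightarrow> bool" where
  "generic_for lam D \<longleftrightarrow>
     (\<forall>i\<in>gf_index D. \<forall>j<gf_len D i. dot (gf_dim D) lam (gf_den D i j) \<noteq> 0)"

lemma additive_dot: "Modules.additive (dot n lam)"
  by (simp add: Modules.additive_def dot_def lookup_add distrib_left sum.distrib)

lemma generic_for_iff:
  "generic_for lam D \<longleftrightarrow> (\<forall>i\<in>gf_index D. 0 \<notin> set (map (dot (gf_dim D) lam) (gf_dens D i)))"
  unfolding generic_for_def gf_len_eq gf_den_eq by (auto simp: image_iff all_set_conv_all_nth)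

lemma specialization_eq:
  assumes "generic_for lam D" "specializes_to (rat_fun D a) r"
  shows "r = weighted_sum D lam (gf_weight D lam) a"
  unfolding weighted_sum_def gf_weight_def
  using assms by (intro specialization_eq_weighted_sum additive_dot) (auto simp: generic_for_iff)

lemma card_lattice_points_eq:
  assumes "generic_for lam D" "rat_fun D a = to_fract (gen_fun P)"
  shows "of_nat (card (lattice_points P)) = weighted_sum D lam (gf_weight D lam) a"
  using specializes_to_gen_fun[of P] assms by (intro specialization_eq) simp_all

lemma sum_shifted_powers:
  fixes A V x :: "'a :: comm_ring_1"
  assumes "s \<le> S"
  shows "(\<Sum>l=0..s. w l * (A + x * V) ^ l) =
    (\<Sum>m\<le>S. V ^ m * (\<Sum>l=m..s. of_nat (l choose m) * w l * A ^ (l - m)) * x ^ m)"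
proof -
  let ?f = "\<lambda>l m. V ^ m * (of_nat (l choose m) * w l * A ^ (l - m)) * x ^ m"
  have "w l * (A + x * V) ^ l = (\<Sum>m\<le>S. if m \<le> l then ?f l m else 0)" if l: "l \<in> {0..s}" for l
  proof -
    have "w l * (A + x * V) ^ l = w l * (\<Sum>m\<le>l. of_nat (l choose m) * (x * V) ^ m * A ^ (l - m))"
      by (simp only: add.commute[of A] binomial_ring)
    also have "\<dots> = (\<Sum>m\<le>l. ?f l m)"
      by (simp add: sum_distrib_left power_mult_distrib mult_ac)
    also have "\<dots> = (\<Sum>m\<le>S. if m \<le> l then ?f l m else 0)"
      using l assms by (intro sum.mono_neutral_cong_left) auto
    finally show ?thesis .
  qed
  then have "(\<Sum>l=0..s. w l * (A + x * V) ^ l) = (\<Sum>l=0..s. \<Sum>m\<le>S. if m \<le> l then ?f l m else 0)"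
    by (intro sum.cong) auto
  also have "\<dots> = (\<Sum>m\<le>S. \<Sum>l=0..s. if m \<le> l then ?f l m else 0)" by (rule sum.swap)
  also have "\<dots> = (\<Sum>m\<le>S. \<Sum>l=m..s. ?f l m)"
    by (intro sum.cong refl sum.mono_neutral_cong_right) auto
  finally show ?thesis by (simp add: sum_distrib_left sum_distrib_right)
qed

lemma weighted_sum_shift:
  assumes "\<And>i. i \<in> gf_index D \<Longrightarrow> gf_len D i \<le> S"
  shows "weighted_sum D lam w (\<lambda>i. a i + frag_cmul (int k - 1) (v i)) =
    (\<Sum>m\<le>S. (\<Sum>i\<in>gf_index D. gf_coeff D i * dot (gf_dim D) lam (v i) ^ m *
       (\<Sum>l=m..gf_len D i. of_nat (l choose m) * w i l * dot (gf_dim D) lam (a i - v i) ^ (l - m))) *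
       of_nat k ^ m)"
proof -
  let ?d = "dot (gf_dim D) lam"
  let ?c = "\<lambda>i m. \<Sum>l=m..gf_len D i. of_nat (l choose m) * w i l * ?d (a i - v i) ^ (l - m)"
  have shift: "?d (a i + frag_cmul (int k - 1) (v i)) = ?d (a i - v i) + of_nat k * ?d (v i)" for i
    by (simp add: dot_def lookup_add lookup_minus algebra_simps sum.distrib sum_subtractf
      sum_distrib_left)
  have "weighted_sum D lam w (\<lambda>i. a i + frag_cmul (int k - 1) (v i)) =
      (\<Sum>i\<in>gf_index D. gf_coeff D i * (\<Sum>m\<le>S. ?d (v i) ^ m * ?c i m * of_nat k ^ m))"
    unfolding weighted_sum_def shift
    by (intro sum.cong refl arg_cong2[where f = "(*)"] sum_shifted_powers assms)
  also have "\<dots> = (\<Sum>i\<in>gf_index D. \<Sum>m\<le>S. gf_coeff D i * ?d (v i) ^ m * ?c i m * of_nat k ^ m)"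
    by (rule sum.cong[OF refl], subst sum_distrib_left) (simp only: mult.assoc)
  also have "\<dots> = (\<Sum>m\<le>S. \<Sum>i\<in>gf_index D. gf_coeff D i * ?d (v i) ^ m * ?c i m * of_nat k ^ m)"
    by (rule sum.swap)
  finally show ?thesis by (simp only: sum_distrib_right)
qed

theorem ehrhart_polynomial_eq:
  assumes gen: "generic_for lam D" and P: "polytope_in n P"
    and gf: "\<And>k. k \<ge> 1 \<Longrightarrow> rat_fun D (\<lambda>i. gf_num D i + frag_cmul (int k - 1) (v i)) =
      to_fract (gen_fun (dilate k P))"
    and k: "k \<ge> 1"
  shows "of_nat (card (lattice_points (dilate k P))) =
    (\<Sum>m | int m \<le> min (int (Max (gf_len D ` gf_index D))) (affine_dim P).
       (\<Sum>i\<in>gf_index D. gf_coeff D i * dot (gf_dim D) lam (v i) ^ m *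
          (\<Sum>l=m..gf_len D i. of_nat (l choose m) * gf_weight D lam i l *
             dot (gf_dim D) lam (gf_num D i - v i) ^ (l - m))) *
       of_nat k ^ m)"
proof (rule dilation_count_truncate[OF P _ k])
  fix k :: nat assume "k \<ge> 1"
  from card_lattice_points_eq[OF gen gf[OF this]]
  show "of_nat (card (lattice_points (dilate k P))) =
    (\<Sum>m\<le>Max (gf_len D ` gf_index D).
       (\<Sum>i\<in>gf_index D. gf_coeff D i * dot (gf_dim D) lam (v i) ^ m *
          (\<Sum>l=m..gf_len D i. of_nat (l choose m) * gf_weight D lam i l *
             dot (gf_dim D) lam (gf_num D i - v i) ^ (l - m))) *
       of_nat k ^ m)"
    by (subst (asm) weighted_sum_shift) (simp_all add: gf_index_def)
qed

definition counting_weights :: "gf_data \<Rightarrow> (nat \<Rightarrow>\<^sub>0 rat) \<Rightarrow> rat list list \<Rightarrow> bool" where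
  "counting_weights D lam w \<longleftrightarrow>
     lam \<in> vecs (gf_dim D) \<and>
     (\<forall>i\<in>gf_index D. \<forall>j<gf_len D i. dot (gf_dim D) lam (gf_den D i j) \<noteq> 0) \<and>
     length w = length (gf_terms D) \<and>
     (\<forall>i\<in>gf_index D. length (w ! i) = gf_len D i + 1) \<and>
     (\<forall>P. polytope_in (gf_dim D) P \<and> represents D P \<longrightarrow>
        of_nat (card (lattice_points P)) =
          (\<Sum>i\<in>gf_index D. gf_coeff D i *
             (\<Sum>l=0..gf_len D i. w ! i ! l * dot (gf_dim D) lam (gf_num D i) ^ l))) \<and>
     (\<forall>P v. integral_polytope_in (gf_dim D) P \<and>
        (\<forall>i\<in>gf_index D. v i \<in> vecs (gf_dim D)) \<and>
        (\<forall>k\<ge>1. rat_fun D (\<lambda>i. gf_num D i + frag_cmul (int k - 1) (v i)) =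
                  to_fract (gen_fun (dilate k P))) \<longrightarrow>
        (\<forall>k\<ge>1. of_nat (card (lattice_points (dilate k P))) =
          (\<Sum>m | int m \<le> min (int (Max (gf_len D ` gf_index D))) (affine_dim P).
             (\<Sum>i\<in>gf_index D. gf_coeff D i * dot (gf_dim D) lam (v i) ^ m *
                (\<Sum>l=m..gf_len D i. of_nat (l choose m) * w ! i ! l *
                   dot (gf_dim D) lam (gf_num D i - v i) ^ (l - m))) *
             of_nat k ^ m)))"

definition weight_lists :: "gf_data \<Rightarrow> (nat \<Rightarrow>\<^sub>0 rat) \<Rightarrow> rat list list" where
  "weight_lists D lam =
     map (\<lambda>i. map (gf_weight D lam i) [0..<Suc (gf_len D i)]) [0..<length (gf_terms D)]"

lemma nth_weight_lists:
  "i \<in> gf_index D \<Longrightarrow> l \<le> gf_len D i \<Longrightarrow> weight_lists D lam ! i ! l = gf_weight D lam i l"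
  by (simp add: weight_lists_def gf_index_def del: upt_Suc)

lemma counting_weights_weight_lists:
  assumes "lam \<in> vecs (gf_dim D)" and gen: "generic_for lam D"
  shows "counting_weights D lam (weight_lists D lam)"
  unfolding counting_weights_def
proof (intro conjI ballI allI impI)
  show "dot (gf_dim D) lam (gf_den D i j) \<noteq> 0" if "i \<in> gf_index D" "j < gf_len D i" for i j
    using gen that by (simp add: generic_for_def)
  show "length (weight_lists D lam) = length (gf_terms D)" by (simp add: weight_lists_def)
  show "length (weight_lists D lam ! i) = gf_len D i + 1" if "i \<in> gf_index D" for i
    using that by (simp add: weight_lists_def gf_index_def del: upt_Suc)
  show "of_nat (card (lattice_points P)) = (\<Sum>i\<in>gf_index D. gf_coeff D i *
      (\<Sum>l=0..gf_len D i. weight_lists D lam ! i ! l * dot (gf_dim D) lam (gf_num D i) ^ l))"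
    if "polytope_in (gf_dim D) P \<and> represents D P" for P
    using card_lattice_points_eq[OF gen, of "gf_num D" P] that
    by (simp add: represents_def weighted_sum_def nth_weight_lists cong: sum.cong_simp)
  show "of_nat (card (lattice_points (dilate k P))) =
      (\<Sum>m | int m \<le> min (int (Max (gf_len D ` gf_index D))) (affine_dim P).
         (\<Sum>i\<in>gf_index D. gf_coeff D i * dot (gf_dim D) lam (v i) ^ m *
            (\<Sum>l=m..gf_len D i. of_nat (l choose m) * weight_lists D lam ! i ! l *
               dot (gf_dim D) lam (gf_num D i - v i) ^ (l - m))) * of_nat k ^ m)"
    if "integral_polytope_in (gf_dim D) P \<and> (\<forall>i\<in>gf_index D. v i \<in> vecs (gf_dim D)) \<and>
      (\<forall>k\<ge>1. rat_fun D (\<lambda>i. gf_num D i + frag_cmul (int k - 1) (v i)) =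
        to_fract (gen_fun (dilate k P)))" "1 \<le> k" for P v k
    using ehrhart_polynomial_eq[OF gen, of "gf_dim D" P v k] that
    by (simp add: integral_polytope_in_def nth_weight_lists cong: sum.cong_simp)
qed (rule assms(1))

section \<open>Sizes of integers\<close>

lemma bit_size_le_iff: "bit_size x \<le> Suc b \<longleftrightarrow> \<bar>x\<bar> < 2 ^ b"
proof -
  have "bit_size x \<le> Suc b \<longleftrightarrow> floorlog 2 (nat \<bar>x\<bar>) \<le> b"
    by (simp add: bit_size_def)
  also have "\<dots> \<longleftrightarrow> nat \<bar>x\<bar> < 2 ^ b"
    by (subst floorlog_le_iff) auto
  also have "\<dots> \<longleftrightarrow> \<bar>x\<bar> < 2 ^ b"
    by (metis abs_ge_zero nat_less_iff of_nat_numeral of_nat_power)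
  finally show ?thesis .
qed

lemma bit_size_pos [simp]: "0 < bit_size x"
  by (simp add: bit_size_def)

lemma one_le_bit_size: "Suc 0 \<le> bit_size x"
  by (simp add: Suc_le_eq)

lemma bit_sizeE:
  obtains b where "bit_size x = Suc b" "\<bar>x\<bar> < 2 ^ b"
  using bit_size_le_iff[of x] by (metis bit_size_pos gr0_implies_Suc le_refl)

lemma bit_size_0 [simp]: "bit_size 0 = 1"
  by (simp add: bit_size_def floorlog_def)

lemma bit_size_1 [simp]: "bit_size 1 = 2"
  by (simp add: bit_size_def floorlog_def)

lemma bit_size_mono: "\<bar>x\<bar> \<le> \<bar>y\<bar> \<Longrightarrow> bit_size x \<le> bit_size y"
  by (simp add: bit_size_def floorlog_mono nat_mono)

lemma bit_size_le_pow2: "\<bar>x\<bar> \<le> 2 ^ b \<Longrightarrow> bit_size x \<le> b + 2"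
  using bit_size_le_iff[of x "Suc b"] by simp (smt (verit) zero_less_power)

lemma abs_le_of_bit_size: "bit_size x \<le> b \<Longrightarrow> \<bar>x\<bar> \<le> 2 ^ b"
  by (metis bit_size_le_iff le_SucI less_imp_le)

lemma bit_size_of_nat: "bit_size (int k) \<le> Suc k"
  by (simp add: bit_size_le_iff)

lemma abs_div_le: "\<bar>x div y\<bar> \<le> \<bar>x\<bar>" for x y :: int
proof -
  have pos: "\<bar>a div b\<bar> \<le> \<bar>a\<bar>" if "b > 0" for a b :: int
  proof (cases "a \<ge> 0")
    case True
    then show ?thesis using that zdiv_mono2[of a 1 b] by (simp add: pos_imp_zdiv_nonneg_iff)
  next
    case False
    then show ?thesis using that zdiv_mono2_neg[of a 1 b]
      by (simp add: neg_imp_zdiv_neg_iff div_neg_pos_less0 abs_of_neg)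
  qed
  consider "y = 0" | "y > 0" | "y < 0" by linarith
  then show ?thesis
    using pos[of y x] pos[of "- y" "- x"] by cases simp_all
qed

lemma bit_size_binop: "bit_size (binop_val f x y) \<le> bit_size x + bit_size y"
proof -
  obtain a where a: "bit_size x = Suc a" "\<bar>x\<bar> < 2 ^ a" by (rule bit_sizeE)
  obtain b where b: "bit_size y = Suc b" "\<bar>y\<bar> < 2 ^ b" by (rule bit_sizeE)
  have "\<bar>binop_val f x y\<bar> \<le> \<bar>x\<bar> + \<bar>y\<bar> + 1 \<or> \<bar>binop_val f x y\<bar> = \<bar>x\<bar> * \<bar>y\<bar>"
    using abs_div_le[of x y] by (cases f) (auto simp: abs_mult)
  moreover have "0 \<le> \<bar>x\<bar> * \<bar>y\<bar>" by simp
  ultimately have "\<bar>binop_val f x y\<bar> \<le> \<bar>x\<bar> * \<bar>y\<bar> + \<bar>x\<bar> + \<bar>y\<bar> + 1" by linarith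
  also have "\<dots> = (\<bar>x\<bar> + 1) * (\<bar>y\<bar> + 1)" by (simp add: algebra_simps)
  also have "\<dots> \<le> 2 ^ a * 2 ^ b" using a b by (intro mult_mono) auto
  also have "\<dots> < 2 ^ Suc (a + b)" by (simp add: power_add)
  finally have "bit_size (binop_val f x y) \<le> Suc (Suc (a + b))" by (simp only: bit_size_le_iff)
  then show ?thesis using a b by simp
qed

lemma bit_size_mult: "bit_size (x * y) \<le> bit_size x + bit_size y"
  using bit_size_binop[of Mul x y] by simp

lemma bit_size_div: "bit_size (x div y) \<le> bit_size x"
  by (intro bit_size_mono abs_div_le)

lemma bit_size_minus [simp]: "bit_size (- x) = bit_size x"
  by (simp add: bit_size_def)

lemma bit_size_add_le:
  assumes "bit_size x \<le> b" "bit_size y \<le> b"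
  shows "bit_size (x + y) \<le> Suc b"
proof -
  obtain c where "b = Suc c" using assms(1) by (metis bit_size_pos gr0_conv_Suc not_less le_zero_eq)
  then show ?thesis using assms by (auto simp: bit_size_le_iff)
qed

lemma bit_size_sum:
  assumes "\<And>i. i \<in> A \<Longrightarrow> bit_size (f i) \<le> b" "1 \<le> b"
  shows "bit_size (sum f A) \<le> card A + b"
  using assms(1)
proof (induction A rule: infinite_finite_induct)
  case (insert i A)
  then have "bit_size (f i + sum f A) \<le> Suc (card A + b)"
    by (intro bit_size_add_le) (auto intro: trans_le_add2)
  then show ?case using insert by simp
qed (use assms(2) in auto)

lemma bit_size_power:
  assumes "bit_size x \<le> b"
  shows "bit_size (x ^ k) \<le> k * b + 2"
proof (induction k)
  case (Suc k)
  have "bit_size (x ^ Suc k) \<le> bit_size x + bit_size (x ^ k)" by (simp add: bit_size_mult)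
  with Suc assms show ?case by simp
qed simp

lemma bit_size_prod_list:
  assumes "\<And>x. x \<in> set xs \<Longrightarrow> bit_size x \<le> b"
  shows "bit_size (prod_list xs) \<le> length xs * b + 2"
  using assms
proof (induction xs)
  case (Cons x xs)
  have "bit_size (prod_list (x # xs)) \<le> bit_size x + bit_size (prod_list xs)"
    by (simp add: bit_size_mult)
  also have "\<dots> \<le> b + (length xs * b + 2)" using Cons by (intro add_mono) auto
  finally show ?case by simp
qed simp

lemma bit_size_fact: "bit_size (fact k) \<le> k * Suc k + 2"
proof (induction k)
  case (Suc k)
  have "bit_size (fact (Suc k)) \<le> bit_size (int (Suc k)) + bit_size (fact k :: int)"
    using bit_size_mult[of "int (Suc k)" "fact k"] by simp
  with Suc bit_size_of_nat[of "Suc k"] show ?case by simp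
qed simp

lemma length_le_tape_size: "length xs \<le> tape_size xs"
  using sum_list_mono[of xs "\<lambda>_. 1" bit_size]
  by (simp add: tape_size_def sum_list_triv one_le_bit_size)

lemma tape_size_append [simp]: "tape_size (xs @ ys) = tape_size xs + tape_size ys"
  by (simp add: tape_size_def)

lemma bit_size_le_tape_size: "x \<in> set xs \<Longrightarrow> bit_size x \<le> tape_size xs"
  unfolding tape_size_def by (intro member_le_sum_list) auto

section \<open>Resource-bounded weakest preconditions\<close>

definition mem_bounded :: "nat \<Rightarrow> mem \<Rightarrow> bool" where
  "mem_bounded B m \<longleftrightarrow> (\<forall>x i. bit_size (m x i) \<le> B)"

lemma mem_bounded_pos: "mem_bounded B m \<Longrightarrow> 1 \<le> B"
  unfolding mem_bounded_def using bit_size_pos by (metis One_nat_def Suc_leI order_trans)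

lemma mem_bounded_upd:
  "mem_bounded B m \<Longrightarrow> bit_size v \<le> B \<Longrightarrow> mem_bounded B (m(x := (m x)(i := v)))"
  by (auto simp: mem_bounded_def)

fun value_factor :: "aexp \<Rightarrow> nat" where
  "value_factor (Const c) = bit_size c"
| "value_factor (Cell x e) = 1"
| "value_factor (Op f e1 e2) = value_factor e1 + value_factor e2"

fun cost_factor :: "aexp \<Rightarrow> nat" where
  "cost_factor (Const c) = bit_size c"
| "cost_factor (Cell x e) = cost_factor e + 1"
| "cost_factor (Op f e1 e2) = cost_factor e1 + cost_factor e2 + value_factor (Op f e1 e2)"

lemma bit_size_aval: "mem_bounded B m \<Longrightarrow> bit_size (aval m e) \<le> value_factor e * B"
proof (induction e)
  case (Const c)
  then show ?case using mem_bounded_pos[of B m] by simp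
next
  case (Cell x e)
  then show ?case by (simp add: mem_bounded_def)
next
  case (Op f e1 e2)
  then show ?case
    using bit_size_binop[of f "aval m e1" "aval m e2"] by (simp add: algebra_simps)
qed

lemma acost_le: "mem_bounded B m \<Longrightarrow> acost m e \<le> cost_factor e * B"
proof (induction e)
  case (Const c)
  then show ?case using mem_bounded_pos[of B m] by simp
next
  case (Cell x e)
  then have "acost m e \<le> cost_factor e * B" "bit_size (m x (aval m e)) \<le> B"
    by (simp_all add: mem_bounded_def)
  then show ?case by simp
next
  case (Op f e1 e2)
  then show ?case
    using bit_size_aval[OF Op.prems, of "Op f e1 e2"] by (simp add: algebra_simps)
qed

type_synonym state = "mem \<times> int list \<times> int list"

definition terminates_within :: "nat \<Rightarrow> nat \<Rightarrow> com \<Rightarrow> (state \<Rightarrow> bool) \<Rightarrow> state \<Rightarrow> bool" where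
  "terminates_within T B c Q s \<longleftrightarrow>
     (\<exists>t s'. exec c s t s' \<and> t \<le> T * B \<and> Q s' \<and> mem_bounded B (fst s'))"

lemma terminates_withinI:
  "exec c s t s' \<Longrightarrow> t \<le> T * B \<Longrightarrow> Q s' \<Longrightarrow> mem_bounded B (fst s') \<Longrightarrow> terminates_within T B c Q s"
  unfolding terminates_within_def by blast

lemma terminates_withinE:
  assumes "terminates_within T B c Q s"
  obtains t s' where "exec c s t s'" "t \<le> T * B" "Q s'" "mem_bounded B (fst s')"
  using assms unfolding terminates_within_def by blast

lemma terminates_within_Skip: "Q s \<Longrightarrow> mem_bounded B (fst s) \<Longrightarrow> terminates_within 1 B Skip Q s"
  using mem_bounded_pos by (intro terminates_withinI[OF exec.Skip]) simp_all

lemma terminates_within_Assign: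
  assumes "mem_bounded B m" "bit_size (aval m f) \<le> B"
    and "Q (m(x := (m x)(aval m e := aval m f)), inp, out)"
  shows "terminates_within (1 + cost_factor e + cost_factor f) B (Assign x e f) Q (m, inp, out)"
proof (rule terminates_withinI[OF exec.Assign])
  show "1 + acost m e + acost m f \<le> (1 + cost_factor e + cost_factor f) * B"
    using acost_le[OF assms(1), of e] acost_le[OF assms(1), of f] mem_bounded_pos[OF assms(1)]
    by (simp add: algebra_simps)
qed (use assms mem_bounded_upd in simp_all)

lemma terminates_within_Read:
  assumes "mem_bounded B m" "bit_size z \<le> B"
    and "Q (m(x := (m x)(aval m e := z)), inp, out)"
  shows "terminates_within (2 + cost_factor e) B (Read x e) Q (m, z # inp, out)"
proof (rule terminates_withinI[OF exec.Read])
  show "1 + acost m e + bit_size z \<le> (2 + cost_factor e) * B"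
    using acost_le[OF assms(1), of e] mem_bounded_pos[OF assms(1)] assms(2)
    by (simp add: algebra_simps)
qed (use assms mem_bounded_upd in simp_all)

lemma terminates_within_Write:
  assumes "mem_bounded B m" "Q (m, inp, out @ [aval m e])"
  shows "terminates_within (1 + cost_factor e) B (Write e) Q (m, inp, out)"
proof (rule terminates_withinI[OF exec.Write])
  show "1 + acost m e \<le> (1 + cost_factor e) * B"
    using acost_le[OF assms(1), of e] mem_bounded_pos[OF assms(1)] by (simp add: algebra_simps)
qed (use assms in simp_all)

lemma terminates_within_Seq:
  assumes "mem_bounded B (fst s)" "terminates_within T1 B c1 R s"
    and "\<And>s. R s \<Longrightarrow> mem_bounded B (fst s) \<Longrightarrow> terminates_within T2 B c2 Q s"
  shows "terminates_within (1 + T1 + T2) B (Seq c1 c2) Q s"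
proof -
  obtain t1 s1 where first: "exec c1 s t1 s1" "t1 \<le> T1 * B" "R s1" "mem_bounded B (fst s1)"
    using assms(2) by (rule terminates_withinE)
  obtain t2 s2 where rest: "exec c2 s1 t2 s2" "t2 \<le> T2 * B" "Q s2" "mem_bounded B (fst s2)"
    using assms(3)[OF first(3,4)] by (rule terminates_withinE)
  have "1 + t1 + t2 \<le> (1 + T1 + T2) * B"
    using first(2) rest(2) mem_bounded_pos[OF assms(1)] by (simp add: algebra_simps)
  then show ?thesis using terminates_withinI[OF exec.Seq[OF first(1) rest(1)]] rest(3,4) by blast
qed

lemma terminates_within_Cond:
  assumes "mem_bounded B (fst s)"
    and "aval (fst s) e \<noteq> 0 \<Longrightarrow> terminates_within T1 B c1 Q s"
    and "aval (fst s) e = 0 \<Longrightarrow> terminates_within T2 B c2 Q s"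
  shows "terminates_within (1 + cost_factor e + T1 + T2) B (Cond e c1 c2) Q s"
proof -
  have test: "1 + acost (fst s) e \<le> (1 + cost_factor e) * B"
    using acost_le[OF assms(1), of e] mem_bounded_pos[OF assms(1)] by simp
  show ?thesis
  proof (cases "aval (fst s) e = 0")
    case True
    obtain t s' where branch: "exec c2 s t s'" "t \<le> T2 * B" "Q s'" "mem_bounded B (fst s')"
      using assms(3)[OF True] by (rule terminates_withinE)
    have "1 + acost (fst s) e + t \<le> (1 + cost_factor e + T1 + T2) * B"
      using test branch(2) by (simp add: algebra_simps)
    then show ?thesis
      using terminates_withinI[OF exec.CondFalse[OF True branch(1)]] branch(3,4) by blast
  next
    case False
    obtain t s' where branch: "exec c1 s t s'" "t \<le> T1 * B" "Q s'" "mem_bounded B (fst s')"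
      using assms(2)[OF False] by (rule terminates_withinE)
    have "1 + acost (fst s) e + t \<le> (1 + cost_factor e + T1 + T2) * B"
      using test branch(2) by (simp add: algebra_simps)
    then show ?thesis
      using terminates_withinI[OF exec.CondTrue[OF False branch(1)]] branch(3,4) by blast
  qed
qed

lemma terminates_within_While:
  assumes "mem_bounded B (fst s)"
    and body: "\<And>R s. body R s \<Longrightarrow> mem_bounded B (fst s) \<Longrightarrow> terminates_within T B c R s"
    and "((\<lambda>R s. aval (fst s) e \<noteq> 0 \<and> body R s) ^^ k) (\<lambda>s. aval (fst s) e = 0 \<and> Q s) s" "k \<le> K"
  shows "terminates_within (Suc K * (1 + cost_factor e + T)) B (While e c) Q s"
  using assms(1,3,4)
proof (induction k arbitrary: s K)
  case 0
  have "1 + acost (fst s) e \<le> Suc K * (1 + cost_factor e + T) * B"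
    using acost_le[OF 0(1), of e] mem_bounded_pos[OF 0(1)] by (simp add: algebra_simps)
  moreover have "aval (fst s) e = 0" "Q s" using 0(2) by simp_all
  ultimately show ?case using terminates_withinI[OF exec.WhileFalse] 0(1) by blast
next
  case (Suc k)
  let ?I = "((\<lambda>R s. aval (fst s) e \<noteq> 0 \<and> body R s) ^^ k) (\<lambda>s. aval (fst s) e = 0 \<and> Q s)"
  obtain K' where K': "K = Suc K'" "k \<le> K'" using Suc.prems(3) by (cases K) auto
  from Suc.prems(2) have test: "aval (fst s) e \<noteq> 0" and "body ?I s" by simp_all
  from body[OF this(2) Suc.prems(1)] obtain t1 s1 where
    first: "exec c s t1 s1" "t1 \<le> T * B" "?I s1" "mem_bounded B (fst s1)"
    by (rule terminates_withinE)
  from Suc.IH[OF first(4,3) K'(2)] obtain t2 s2 where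
    rest: "exec (While e c) s1 t2 s2" "t2 \<le> Suc K' * (1 + cost_factor e + T) * B" "Q s2"
      "mem_bounded B (fst s2)"
    by (rule terminates_withinE)
  have "1 + acost (fst s) e + t1 + t2 \<le> Suc K * (1 + cost_factor e + T) * B"
    using acost_le[OF Suc.prems(1), of e] mem_bounded_pos[OF Suc.prems(1)] first(2) rest(2)
    unfolding K'(1) by (simp add: algebra_simps)
  then show ?case
    using terminates_withinI[OF exec.WhileTrue[OF test first(1) rest(1)]] rest(3,4) by blast
qed

text \<open>A weakest precondition for termination with two resource bounds: no loop makes more than \<open>K\<close>
  iterations, and no value stored in memory has more than \<open>B\<close> bits. They bound the running time.\<close>

primrec wp :: "nat \<Rightarrow> nat \<Rightarrow> com \<Rightarrow> (state \<Rightarrow> bool) \<Rightarrow> state \<Rightarrow> bool" where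
  "wp K B Skip Q = Q"
| "wp K B (Assign x e f) Q = (\<lambda>(m, inp, out). bit_size (aval m f) \<le> B \<and>
     Q (m(x := (m x)(aval m e := aval m f)), inp, out))"
| "wp K B (Read x e) Q = (\<lambda>(m, inp, out). inp \<noteq> [] \<and> bit_size (hd inp) \<le> B \<and>
     Q (m(x := (m x)(aval m e := hd inp)), tl inp, out))"
| "wp K B (Write e) Q = (\<lambda>(m, inp, out). Q (m, inp, out @ [aval m e]))"
| "wp K B (Seq c1 c2) Q = wp K B c1 (wp K B c2 Q)"
| "wp K B (Cond e c1 c2) Q =
     (\<lambda>s. if aval (fst s) e \<noteq> 0 then wp K B c1 Q s else wp K B c2 Q s)"
| "wp K B (While e c) Q = (\<lambda>s. \<exists>k\<le>K. ((\<lambda>R s. aval (fst s) e \<noteq> 0 \<and> wp K B c R s) ^^ k)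
     (\<lambda>s. aval (fst s) e = 0 \<and> Q s) s)"

primrec time_bound :: "com \<Rightarrow> nat poly" where
  "time_bound Skip = 1"
| "time_bound (Assign x e f) = [:1 + cost_factor e + cost_factor f:]"
| "time_bound (Read x e) = [:2 + cost_factor e:]"
| "time_bound (Write e) = [:1 + cost_factor e:]"
| "time_bound (Seq c1 c2) = 1 + time_bound c1 + time_bound c2"
| "time_bound (Cond e c1 c2) = [:1 + cost_factor e:] + time_bound c1 + time_bound c2"
| "time_bound (While e c) = [:1, 1:] * ([:1 + cost_factor e:] + time_bound c)"

theorem wp_sound:
  assumes "wp K B c Q s" "mem_bounded B (fst s)"
  shows "terminates_within (poly (time_bound c) K) B c Q s"
  using assms
proof (induction c arbitrary: Q s)
  case Skip
  then show ?case by (simp add: terminates_within_Skip[simplified])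
next
  case (Assign x e f)
  then show ?case by (cases s) (simp add: terminates_within_Assign[simplified])
next
  case (Read x e)
  then show ?case
    by (cases s; cases "fst (snd s)") (auto simp: terminates_within_Read[simplified])
next
  case (Write e)
  then show ?case by (cases s) (simp add: terminates_within_Write[simplified])
next
  case (Seq c1 c2)
  then have "terminates_within (1 + poly (time_bound c1) K + poly (time_bound c2) K) B
      (Seq c1 c2) Q s"
    by (intro terminates_within_Seq[where R = "wp K B c2 Q"]) auto
  then show ?case by simp
next
  case (Cond e c1 c2)
  then have "terminates_within
      (1 + cost_factor e + poly (time_bound c1) K + poly (time_bound c2) K) B
      (Cond e c1 c2) Q s"
    by (intro terminates_within_Cond) (auto split: if_splits)
  then show ?case by simp
next
  case (While e c)
  then obtain k where "k \<le> K"
    "((\<lambda>R s. aval (fst s) e \<noteq> 0 \<and> wp K B c R s) ^^ k) (\<lambda>s. aval (fst s) e = 0 \<and> Q s) s" by auto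
  then have "terminates_within (Suc K * (1 + cost_factor e + poly (time_bound c) K)) B
      (While e c) Q s"
    using While by (intro terminates_within_While[where body = "wp K B c"])
  then show ?case by (simp add: algebra_simps)
qed

theorem polytime_algorithmI:
  fixes k b :: "nat poly"
  assumes wp: "\<And>x. promise x \<Longrightarrow>
      wp (poly k (tape_size (enc x))) (poly b (tape_size (enc x))) c (\<lambda>(_, _, out). correct x out)
        (\<lambda>_ _. 0, enc x, [])"
    and pos: "\<And>x. promise x \<Longrightarrow> 1 \<le> poly b (tape_size (enc x))"
  shows "polytime_algorithm c enc promise correct"
  unfolding polytime_algorithm_def
proof (intro exI[of _ "pcompose (time_bound c) k * b"] allI impI)
  fix x assume x: "promise x"
  let ?N = "tape_size (enc x)"
  have "mem_bounded (poly b ?N) (\<lambda>_ _. 0)" using pos[OF x] by (simp add: mem_bounded_def)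
  with wp_sound[OF wp[OF x]] obtain t s where
    "exec c (\<lambda>_ _. 0, enc x, []) t s" "t \<le> poly (time_bound c) (poly k ?N) * poly b ?N"
    "case s of (_, _, out) \<Rightarrow> correct x out"
    by (auto elim: terminates_withinE)
  then show "\<exists>t ys. computes c (enc x) t ys \<and> t \<le> poly (pcompose (time_bound c) k * b) ?N \<and>
      correct x ys"
    unfolding computes_def by (cases s) (auto simp: poly_pcompose)
qed

primrec modifies :: "com \<Rightarrow> string set" where
  "modifies Skip = {}"
| "modifies (Assign x e f) = {x}"
| "modifies (Read x e) = {x}"
| "modifies (Write e) = {}"
| "modifies (Seq c1 c2) = modifies c1 \<union> modifies c2"
| "modifies (Cond e c1 c2) = modifies c1 \<union> modifies c2"
| "modifies (While e c) = modifies c"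

primrec silent :: "com \<Rightarrow> bool" where
  "silent Skip = True"
| "silent (Assign x e f) = True"
| "silent (Read x e) = True"
| "silent (Write e) = False"
| "silent (Seq c1 c2) = (silent c1 \<and> silent c2)"
| "silent (Cond e c1 c2) = (silent c1 \<and> silent c2)"
| "silent (While e c) = silent c"

definition framed :: "com \<Rightarrow> state \<Rightarrow> state \<Rightarrow> bool" where
  "framed c s s' \<longleftrightarrow>
     (\<forall>x. x \<notin> modifies c \<longrightarrow> fst s' x = fst s x) \<and> (silent c \<longrightarrow> snd (snd s') = snd (snd s))"

lemma framed_refl: "framed c s s"
  by (simp add: framed_def)

lemma framed_trans: "framed c s s' \<Longrightarrow> framed c s' s'' \<Longrightarrow> framed c s s''"
  by (simp add: framed_def)

lemma framed_seq: "framed c1 s s' \<Longrightarrow> framed c2 s' s'' \<Longrightarrow> framed (Seq c1 c2) s s''"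
  by (simp add: framed_def)

theorem wp_conseq:
  assumes "wp K B c Q s" "\<And>s'. Q s' \<Longrightarrow> framed c s s' \<Longrightarrow> Q' s'"
  shows "wp K B c Q' s"
  using assms
proof (induction c arbitrary: Q Q' s)
  case (Seq c1 c2)
  from Seq.prems(1) have "wp K B c1 (wp K B c2 Q) s" by simp
  then have "wp K B c1 (wp K B c2 Q') s"
  proof (rule Seq.IH(1))
    fix s' assume "wp K B c2 Q s'" "framed c1 s s'"
    then show "wp K B c2 Q' s'" using Seq.IH(2) Seq.prems(2) framed_seq by blast
  qed
  then show ?case by simp
next
  case (Cond e c1 c2)
  have "wp K B c1 Q' s" if "wp K B c1 Q s"
    by (rule Cond.IH(1)[OF that], rule Cond.prems(2)) (auto simp: framed_def)
  moreover have "wp K B c2 Q' s" if "wp K B c2 Q s"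
    by (rule Cond.IH(2)[OF that], rule Cond.prems(2)) (auto simp: framed_def)
  ultimately show ?case using Cond.prems(1) by (auto split: if_splits)
next
  case (While e c)
  let ?F = "\<lambda>R s. aval (fst s) e \<noteq> 0 \<and> wp K B c R s"
  let ?E = "\<lambda>Q s. aval (fst s) e = 0 \<and> Q s"
  have "(?F ^^ k) (?E Q') s" if "(?F ^^ k) (?E Q) s" "\<And>s'. Q s' \<Longrightarrow> framed c s s' \<Longrightarrow> Q' s'" for k s
    using that
  proof (induction k arbitrary: s)
    case 0
    then show ?case using framed_refl[of c s] by simp
  next
    case (Suc k)
    then have "wp K B c ((?F ^^ k) (?E Q)) s" by simp
    then have "wp K B c ((?F ^^ k) (?E Q')) s"
      by (rule While.IH) (use Suc framed_trans in blast)
    then show ?case using Suc.prems(1) by simp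
  qed
  moreover have "framed (While e c) s s' = framed c s s'" for s' by (simp add: framed_def)
  ultimately show ?case using While.prems unfolding wp.simps by blast
qed (auto simp: framed_def split: prod.splits)

lemma wp_While:
  assumes "I 0 s"
    and "\<And>k s. k < N \<Longrightarrow> I k s \<Longrightarrow> aval (fst s) e \<noteq> 0 \<and> wp K B c (I (Suc k)) s"
    and "\<And>s. I N s \<Longrightarrow> aval (fst s) e = 0"
    and "N \<le> K"
  shows "wp K B (While e c) (I N) s"
proof -
  let ?F = "\<lambda>R s. aval (fst s) e \<noteq> 0 \<and> wp K B c R s"
  have "I (N - k) s \<Longrightarrow> k \<le> N \<Longrightarrow> (?F ^^ k) (\<lambda>s. aval (fst s) e = 0 \<and> I N s) s" for k s
  proof (induction k arbitrary: s)
    case (Suc k)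
    have "aval (fst s) e \<noteq> 0 \<and> wp K B c (I (Suc (N - Suc k))) s"
      using assms(2)[of "N - Suc k" s] Suc.prems by simp
    moreover have "Suc (N - Suc k) = N - k" using Suc.prems by simp
    ultimately show ?case using Suc.IH Suc.prems by (auto elim!: wp_conseq)
  qed (use assms(3) in auto)
  from this[of N s] show ?thesis using assms(1,4) by auto
qed

lemma wp_frameI:
  assumes "wp K B c (\<lambda>(m, inp, out). R m inp out) (m, inp, out)"
    and "\<And>m' inp' out'. R m' inp' out' \<Longrightarrow> (\<And>x. x \<notin> modifies c \<Longrightarrow> m' x = m x) \<Longrightarrow>
      (silent c \<Longrightarrow> out' = out) \<Longrightarrow> Q (m', inp', out')"
  shows "wp K B c Q (m, inp, out)"
  using assms(1) by (rule wp_conseq) (use assms(2) in \<open>force simp: framed_def\<close>)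

lemma wp_seqI:
  assumes "wp K B c1 (\<lambda>(m, inp, out). R m inp out) (m, inp, out)"
    and "\<And>m' inp' out'. R m' inp' out' \<Longrightarrow> (\<And>x. x \<notin> modifies c1 \<Longrightarrow> m' x = m x) \<Longrightarrow>
      (silent c1 \<Longrightarrow> out' = out) \<Longrightarrow> wp K B c2 Q (m', inp', out')"
  shows "wp K B (Seq c1 c2) Q (m, inp, out)"
  using wp_frameI[where R = R and Q = "wp K B c2 Q", OF assms(1)] assms(2) by simp

abbreviation Var :: "string \<Rightarrow> aexp" where "Var x \<equiv> Cell x (Const 0)"

abbreviation assign_var :: "string \<Rightarrow> aexp \<Rightarrow> com" (infix "::=" 61) where
  "x ::= e \<equiv> Assign x (Const 0) e"

abbreviation seq (infixr ";;" 60) where "c1 ;; c2 \<equiv> Seq c1 c2"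

abbreviation set_var :: "mem \<Rightarrow> string \<Rightarrow> int \<Rightarrow> mem" ("_\<langle>_ := _\<rangle>" [1000, 0, 0] 1000) where
  "m\<langle>x := v\<rangle> \<equiv> m(x := (m x)(0 := v))"

abbreviation plus_exp (infixl "[+]" 65) where "e [+] f \<equiv> Op Add e f"
abbreviation minus_exp (infixl "[-]" 65) where "e [-] f \<equiv> Op Sub e f"
abbreviation times_exp (infixl "[*]" 70) where "e [*] f \<equiv> Op Mul e f"
abbreviation quot_exp (infixl "['/]" 70) where "e [/] f \<equiv> Op Quo e f"

definition For :: "string \<Rightarrow> aexp \<Rightarrow> com \<Rightarrow> com" where
  "For x e c = (x ::= Const 0 ;;
     While (Op Less (Var x) e) (c ;; x ::= Var x [+] Const 1))"

lemma modifies_For [simp]: "modifies (For x e c) = insert x (modifies c)"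
  by (auto simp: For_def)

lemma silent_For [simp]: "silent (For x e c) = silent c"
  by (simp add: For_def)

primrec arrays :: "aexp \<Rightarrow> string set" where
  "arrays (Const c) = {}"
| "arrays (Cell x e) = insert x (arrays e)"
| "arrays (Op f e1 e2) = arrays e1 \<union> arrays e2"

lemma aval_cong: "(\<And>x. x \<in> arrays e \<Longrightarrow> m x = m' x) \<Longrightarrow> aval m e = aval m' e"
  by (induction e) auto

locale resource_bounds =
  fixes K B :: nat
  assumes K_pos: "1 \<le> K" and bit_size_small_nat: "\<And>k. k \<le> K \<Longrightarrow> bit_size (int k) \<le> B"
begin

lemma two_le_B: "2 \<le> B"
  using bit_size_small_nat[of 1] K_pos by simp

lemma wp_For:
  fixes I :: "nat \<Rightarrow> mem \<Rightarrow> int list \<Rightarrow> int list \<Rightarrow> bool"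
  assumes guard: "aval m e = int N" "arrays e \<inter> insert x (modifies c) = {}"
    and counter: "x \<notin> modifies c"
    and indep: "\<And>k m inp out f. I k m inp out \<Longrightarrow> I k (m(x := f)) inp out"
    and init: "I 0 m inp out"
    and body: "\<And>k m' inp' out'. k < N \<Longrightarrow> m' x 0 = int k \<Longrightarrow> I k m' inp' out' \<Longrightarrow>
      (\<And>y. y \<notin> insert x (modifies c) \<Longrightarrow> m' y = m y) \<Longrightarrow> (silent c \<Longrightarrow> out' = out) \<Longrightarrow>
      wp K B c (\<lambda>(m, inp, out). I (Suc k) m inp out) (m', inp', out')"
    and N: "N \<le> K"
  shows "wp K B (For x e c) (\<lambda>(m, inp, out). I N m inp out) (m, inp, out)"
proof -
  let ?c = "c ;; x ::= Var x [+] Const 1"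
  let ?J = "\<lambda>k (m', inp', out'). k \<le> N \<and> m' x 0 = int k \<and> I k m' inp' out' \<and>
    framed ?c (m, inp, out) (m', inp', out')"
  have "wp K B (While (Op Less (Var x) e) ?c) (?J N) (m\<langle>x := 0\<rangle>, inp, out)"
  proof (rule wp_While[where I = ?J and N = N])
    fix k s
    assume k: "k < N" and J: "?J k s"
    obtain m' inp' out' where s: "s = (m', inp', out')" by (cases s)
    have frame: "m' y = m y" if "y \<notin> insert x (modifies c)" for y
      using J that unfolding s framed_def by simp
    have "silent c \<Longrightarrow> out' = out" using J unfolding s framed_def by simp
    with k J frame have "wp K B c (\<lambda>(m, inp, out). I (Suc k) m inp out) s"
      unfolding s by (intro body) auto
    then have "wp K B ?c (?J (Suc k)) s" unfolding s
    proof (rule wp_seqI)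
      fix m'' inp'' out''
      assume I: "I (Suc k) m'' inp'' out''" and frame': "\<And>y. y \<notin> modifies c \<Longrightarrow> m'' y = m' y"
        and "silent c \<Longrightarrow> out'' = out'"
      then have "framed ?c (m, inp, out) (m''\<langle>x := int k + 1\<rangle>, inp'', out'')"
        using J unfolding s framed_def by simp
      moreover have "m'' x 0 = int k" using frame'[OF counter] J s by simp
      ultimately show "wp K B (x ::= Var x [+] Const 1) (?J (Suc k)) (m'', inp'', out'')"
        using I k N indep bit_size_small_nat[of "Suc k"] by (simp add: ac_simps)
    qed
    moreover have "aval m' e = aval m e"
      using guard(2) frame by (intro aval_cong) blast
    ultimately show "aval (fst s) (Op Less (Var x) e) \<noteq> 0 \<and> wp K B ?c (?J (Suc k)) s"
      using J k unfolding s by (simp del: wp.simps add: guard(1))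
  next
    fix s assume J: "?J N s"
    then have "aval (fst s) e = aval m e"
      using guard(2) by (intro aval_cong) (auto simp: framed_def)
    then show "aval (fst s) (Op Less (Var x) e) = 0" using J guard(1) by auto
  qed (use init indep N in \<open>auto simp: framed_def\<close>)
  then have "wp K B (While (Op Less (Var x) e) ?c) (\<lambda>(m, inp, out). I N m inp out)
      (m\<langle>x := 0\<rangle>, inp, out)"
    by (rule wp_conseq) auto
  then show ?thesis using two_le_B by (simp add: For_def)
qed

end

section \<open>Todd series over the integers\<close>

text \<open>The division is exact in the range used: \<open>fact (Suc k)\<close> will divide \<open>b\<close> for \<open>k > 0\<close>.\<close>

definition todd_coeff :: "int \<Rightarrow> nat \<Rightarrow> int" where
  "todd_coeff b k = b ^ k div fact (Suc k)"

fun div_todd :: "int \<Rightarrow> (nat \<Rightarrow> int) \<Rightarrow> nat \<Rightarrow> int" where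
  "div_todd b r 0 = r 0"
| "div_todd b r (Suc k) =
     r (Suc k) - (\<Sum>i<Suc k. todd_coeff b (Suc i) * div_todd b r (k - i))"

definition div_todd_partial :: "int \<Rightarrow> (nat \<Rightarrow> int) \<Rightarrow> nat \<Rightarrow> nat \<Rightarrow> int" where
  "div_todd_partial b r k h =
     r (Suc k) - (\<Sum>i<h. todd_coeff b (Suc i) * div_todd b r (k - i))"

definition int_todd_series :: "int list \<Rightarrow> nat \<Rightarrow> int" where
  "int_todd_series bs = foldl (\<lambda>r b. div_todd b r) (\<lambda>k. if k = 0 then 1 else 0) bs"

definition neg_prod :: "int list \<Rightarrow> int" where
  "neg_prod bs = (\<Prod>b\<leftarrow>bs. - b)"

lemma div_todd_Suc: "div_todd b r (Suc k) = div_todd_partial b r k (Suc k)"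
  by (simp add: div_todd_partial_def)

lemma int_todd_series_Nil: "int_todd_series [] = (\<lambda>k. if k = 0 then 1 else 0)"
  and int_todd_series_snoc: "int_todd_series (bs @ [b]) = div_todd b (int_todd_series bs)"
  by (simp_all add: int_todd_series_def)

lemma neg_prod_Nil: "neg_prod [] = 1"
  and neg_prod_snoc: "neg_prod (bs @ [b]) = neg_prod bs * - b"
  by (simp_all add: neg_prod_def)

lemma of_int_todd_coeff:
  assumes "fact (Suc k) dvd b" "0 < k"
  shows "of_int (todd_coeff b k) = fps_nth (todd_factor (of_int b)) k"
proof -
  have "fact (Suc k) dvd b ^ k" using assms dvd_power[of k b] dvd_trans by blast
  then show ?thesis by (simp add: todd_coeff_def todd_factor_def of_int_div del: fact_Suc)
qed

lemma div_todd_correct: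
  assumes r: "\<And>k. k \<le> s \<Longrightarrow> of_int (r k) = fps_nth f k" and b: "fact (Suc s) dvd b" and k: "k \<le> s"
  shows "of_int (div_todd b r k) = fps_nth (f * inverse (todd_factor (of_int b))) k"
  using k
proof (induction k rule: less_induct)
  case (less k)
  let ?t = "todd_factor (of_int b)"
  let ?g = "f * inverse ?t"
  have factor: "f = ?t * ?g" by (simp add: mult.left_commute todd_factor_inverse)
  show ?case
  proof (cases k)
    case 0
    then show ?thesis using r[of 0] by simp
  next
    case (Suc j)
    have coeff: "of_int (todd_coeff b (Suc i)) = fps_nth ?t (Suc i)" if "i < Suc j" for i
      using that less.prems Suc
      by (intro of_int_todd_coeff dvd_trans[OF fact_dvd b]) auto
    have "fps_nth f (Suc j) = fps_nth (?t * ?g) (Suc j)" by (rule arg_cong[OF factor])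
    also have "\<dots> = (\<Sum>i=0..Suc j. fps_nth ?t i * fps_nth ?g (Suc j - i))" by (rule fps_mult_nth)
    also have "\<dots> = fps_nth ?g (Suc j) + (\<Sum>i<Suc j. fps_nth ?t (Suc i) * fps_nth ?g (j - i))"
      unfolding atLeast0AtMost lessThan_Suc_atMost[symmetric]
      by (subst sum.lessThan_Suc_shift) simp
    finally have "fps_nth ?g (Suc j) =
        fps_nth f (Suc j) - (\<Sum>i<Suc j. fps_nth ?t (Suc i) * fps_nth ?g (j - i))" by simp
    also have "(\<Sum>i<Suc j. fps_nth ?t (Suc i) * fps_nth ?g (j - i)) =
        (\<Sum>i<Suc j. of_int (todd_coeff b (Suc i)) * of_int (div_todd b r (j - i)))"
      using coeff less Suc by (intro sum.cong refl arg_cong2[where f = "(*)"]) auto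
    also have "fps_nth f (Suc j) = of_int (r (Suc j))" using r[of "Suc j"] less.prems Suc by simp
    finally show ?thesis
      unfolding Suc div_todd.simps of_int_diff of_int_sum of_int_mult by (rule sym)
  qed
qed

lemma int_todd_series_correct:
  assumes "\<And>b. b \<in> set bs \<Longrightarrow> fact (Suc s) dvd b" "k \<le> s"
  shows "of_int (int_todd_series bs k) = fps_nth (todd_series (map of_int bs)) k"
  using assms
proof (induction bs arbitrary: k rule: rev_induct)
  case Nil
  then show ?case by (simp add: int_todd_series_Nil todd_series_def)
next
  case (snoc b bs)
  have "of_int (div_todd b (int_todd_series bs) k) =
      fps_nth (todd_series (map of_int bs) * inverse (todd_factor (of_int b))) k"
    using snoc by (intro div_todd_correct[of s]) auto
  then show ?case by (simp add: int_todd_series_snoc todd_series_def)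
qed

lemma weight_of_int:
  assumes "\<And>b. b \<in> set bs \<Longrightarrow> fact (Suc (length bs)) dvd b"
  shows "weight (map of_int bs) l =
    of_int (int_todd_series bs (length bs - l)) / of_int (fact l * neg_prod bs)"
proof -
  have "(of_int (neg_prod bs) :: rat) = (\<Prod>b\<leftarrow>map of_int bs. - b)"
    by (induction bs) (simp_all add: neg_prod_def)
  then show ?thesis
    using int_todd_series_correct[of bs "length bs" "length bs - l"] assms by (simp add: weight_def)
qed

lemma weighted_powers_of_int:
  assumes "\<And>b. b \<in> set bs \<Longrightarrow> fact (Suc (length bs)) dvd b" and a: "fact (Suc (length bs)) dvd a"
  shows "(\<Sum>l=0..length bs. weight (map of_int bs) l * of_int a ^ l) =
    of_int (\<Sum>l<Suc (length bs). int_todd_series bs (length bs - l) * (a ^ l div fact l)) /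
      of_int (neg_prod bs)"
proof -
  have "weight (map of_int bs) l * of_int a ^ l =
      of_int (int_todd_series bs (length bs - l) * (a ^ l div fact l)) / of_int (neg_prod bs)"
    if "l < Suc (length bs)" for l
  proof -
    have "fact l dvd a" using that by (intro dvd_trans[OF fact_dvd a]) simp
    then have "fact l dvd a ^ l" by (cases l) (auto intro: dvd_mult2)
    then show ?thesis by (simp add: weight_of_int[OF assms(1)] of_int_div)
  qed
  then show ?thesis
    unfolding of_int_sum sum_divide_distrib atLeast0AtMost lessThan_Suc_atMost[symmetric]
    by (intro sum.cong) auto
qed

section \<open>Size of the Todd coefficients\<close>

lemma abs_todd_coeff_le:
  assumes "\<bar>b\<bar> \<le> G"
  shows "\<bar>todd_coeff b k\<bar> \<le> G ^ k"
proof -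
  have "\<bar>todd_coeff b k\<bar> \<le> \<bar>b\<bar> ^ k"
    unfolding todd_coeff_def power_abs[symmetric] by (rule abs_div_le)
  also have "\<dots> \<le> G ^ k" using assms by (intro power_mono) auto
  finally show ?thesis .
qed

lemma convolution_geometric_le:
  fixes G Z :: int
  assumes "0 \<le> G" "2 * G \<le> Z"
  shows "(\<Sum>i<Suc k. G ^ Suc i * Z ^ (k - i)) \<le> 2 * G * Z ^ k"
proof (induction k)
  case 0
  then show ?case using assms by simp
next
  case (Suc k)
  have Z: "0 \<le> Z" using assms by simp
  have "(\<Sum>i<Suc (Suc k). G ^ Suc i * Z ^ (Suc k - i)) =
      G * Z ^ Suc k + (\<Sum>i<Suc k. G ^ Suc (Suc i) * Z ^ (k - i))"
    by (subst sum.lessThan_Suc_shift) simp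
  also have "(\<Sum>i<Suc k. G ^ Suc (Suc i) * Z ^ (k - i)) = G * (\<Sum>i<Suc k. G ^ Suc i * Z ^ (k - i))"
    by (simp only: sum_distrib_left power_Suc mult.assoc)
  also have "G * Z ^ Suc k + \<dots> \<le> G * Z ^ Suc k + G * (2 * G * Z ^ k)"
    using Suc assms by (intro add_left_mono mult_left_mono) auto
  also have "\<dots> \<le> G * Z ^ Suc k + G * (Z * Z ^ k)"
    using assms Z by (intro add_left_mono mult_left_mono mult_right_mono) auto
  finally show ?case by simp
qed

lemma abs_div_todd_partial_le:
  assumes r: "\<bar>r (Suc k)\<bar> \<le> H ^ Suc k" and "0 \<le> H" "\<bar>b\<bar> \<le> G"
    and IH: "\<And>i. i \<le> k \<Longrightarrow> \<bar>div_todd b r i\<bar> \<le> (H + 2 * G) ^ i" and "h \<le> Suc k"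
  shows "\<bar>div_todd_partial b r k h\<bar> \<le> (H + 2 * G) ^ Suc k"
proof -
  let ?Z = "H + 2 * G"
  have G: "0 \<le> G" using assms(3) by simp
  have "\<bar>\<Sum>i<h. todd_coeff b (Suc i) * div_todd b r (k - i)\<bar> \<le>
      (\<Sum>i<h. \<bar>todd_coeff b (Suc i) * div_todd b r (k - i)\<bar>)"
    by (rule sum_abs)
  also have "\<dots> \<le> (\<Sum>i<h. G ^ Suc i * ?Z ^ (k - i))"
    unfolding abs_mult using IH assms(3) G by (intro sum_mono mult_mono abs_todd_coeff_le) auto
  also have "\<dots> \<le> (\<Sum>i<Suc k. G ^ Suc i * ?Z ^ (k - i))"
    using assms(2,5) G by (intro sum_mono2) auto
  also have "\<dots> \<le> 2 * G * ?Z ^ k" using G assms(2) by (intro convolution_geometric_le) auto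
  finally have "\<bar>div_todd_partial b r k h\<bar> \<le> H * H ^ k + 2 * G * ?Z ^ k"
    using r unfolding div_todd_partial_def power_Suc by linarith
  also have "H * H ^ k \<le> H * ?Z ^ k"
    using assms(2) G by (intro mult_left_mono power_mono) auto
  finally show ?thesis by (simp add: algebra_simps)
qed

lemma abs_div_todd_le:
  assumes "\<And>i. \<bar>r i\<bar> \<le> H ^ i" "0 \<le> H" "\<bar>b\<bar> \<le> G"
  shows "\<bar>div_todd b r k\<bar> \<le> (H + 2 * G) ^ k"
proof (induction k rule: less_induct)
  case (less k)
  show ?case
  proof (cases k)
    case 0
    then show ?thesis using assms(1)[of 0] by simp
  next
    case (Suc j)
    show ?thesis unfolding Suc div_todd_Suc
      by (rule abs_div_todd_partial_le) (use assms less Suc in \<open>auto simp del: power_Suc\<close>)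
  qed
qed

lemma abs_int_todd_series_le:
  assumes "\<And>b. b \<in> set bs \<Longrightarrow> \<bar>b\<bar> \<le> G" "0 \<le> G"
  shows "\<bar>int_todd_series bs k\<bar> \<le> (1 + 2 * int (length bs) * G) ^ k"
  using assms(1)
proof (induction bs arbitrary: k rule: rev_induct)
  case Nil
  then show ?case by (simp add: int_todd_series_Nil)
next
  case (snoc b bs)
  have "\<bar>div_todd b (int_todd_series bs) k\<bar> \<le> ((1 + 2 * int (length bs) * G) + 2 * G) ^ k"
    using snoc assms(2) by (intro abs_div_todd_le) auto
  then show ?case by (simp add: int_todd_series_snoc algebra_simps)
qed

lemma bit_size_power_affine_le:
  assumes "j \<le> J"
  shows "bit_size ((1 + 2 * int j * 2 ^ g) ^ k) \<le> k * (2 * J + 1 + g) + 2"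
proof (rule bit_size_le_pow2)
  have "1 + 2 * int j * 2 ^ g \<le> 2 ^ g + 2 * int J * 2 ^ g"
    using assms by (intro add_mono mult_right_mono) auto
  also have "\<dots> = int (2 * J + 1) * 2 ^ g" by (simp add: distrib_right)
  also have "\<dots> \<le> 2 ^ (2 * J + 1) * 2 ^ g"
    by (intro mult_right_mono less_imp_le[OF of_nat_less_two_power]) auto
  finally have "1 + 2 * int j * 2 ^ g \<le> 2 ^ (2 * J + 1 + g)" by (simp only: power_add)
  then have "(1 + 2 * int j * 2 ^ g) ^ k \<le> (2 ^ (2 * J + 1 + g)) ^ k" by (intro power_mono) auto
  also have "\<dots> = 2 ^ (k * (2 * J + 1 + g))" by (simp only: power_mult[symmetric] mult.commute)
  finally show "\<bar>(1 + 2 * int j * 2 ^ g) ^ k\<bar> \<le> 2 ^ (k * (2 * J + 1 + g))" by simp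
qed

lemma bit_size_int_todd_series:
  assumes "\<And>b. b \<in> set bs \<Longrightarrow> bit_size b \<le> g"
  shows "bit_size (int_todd_series bs k) \<le> k * (2 * length bs + 1 + g) + 2"
proof -
  have "\<bar>int_todd_series bs k\<bar> \<le> (1 + 2 * int (length bs) * 2 ^ g) ^ k"
    using assms by (intro abs_int_todd_series_le abs_le_of_bit_size) auto
  then have "bit_size (int_todd_series bs k) \<le> bit_size ((1 + 2 * int (length bs) * 2 ^ g) ^ k)"
    by (intro bit_size_mono) simp
  then show ?thesis using bit_size_power_affine_le[of "length bs" "length bs" g k] by simp
qed

lemma bit_size_div_todd_partial:
  assumes "\<And>b. b \<in> set bs \<Longrightarrow> bit_size b \<le> g" "j < length bs" "h \<le> Suc k"
  shows "bit_size (div_todd_partial (bs ! j) (int_todd_series (take j bs)) k h) \<le>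
    Suc k * (2 * length bs + 1 + g) + 2"
proof -
  let ?H = "1 + 2 * int j * 2 ^ g" and ?r = "int_todd_series (take j bs)"
  have b: "\<bar>b\<bar> \<le> 2 ^ g" if "b \<in> set bs" for b using assms(1)[OF that] by (rule abs_le_of_bit_size)
  have r: "\<bar>?r i\<bar> \<le> ?H ^ i" for i
    using abs_int_todd_series_le[of "take j bs" "2 ^ g" i] b assms(2)
    by (auto dest: in_set_takeD simp: min_absorb2)
  have "\<bar>div_todd_partial (bs ! j) ?r k h\<bar> \<le> (?H + 2 * 2 ^ g) ^ Suc k"
    using assms(2,3) by (intro abs_div_todd_partial_le abs_div_todd_le r b) auto
  also have "?H + 2 * 2 ^ g = 1 + 2 * int (Suc j) * 2 ^ g" by (simp add: algebra_simps)
  finally have "bit_size (div_todd_partial (bs ! j) ?r k h) \<le>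
      bit_size ((1 + 2 * int (Suc j) * 2 ^ g) ^ Suc k)"
    by (intro bit_size_mono) simp
  then show ?thesis
    using bit_size_power_affine_le[of "Suc j" "length bs" g "Suc k"] assms(2) by linarith
qed

lemma bit_size_neg_prod:
  assumes "\<And>b. b \<in> set bs \<Longrightarrow> bit_size b \<le> g"
  shows "bit_size (neg_prod bs) \<le> length bs * g + 2"
proof -
  have "bit_size (prod_list (map uminus bs)) \<le> length (map uminus bs) * g + 2"
    using assms by (intro bit_size_prod_list) auto
  then show ?thesis by (simp add: neg_prod_def)
qed

section \<open>Linear forms with coefficients on the moment curve\<close>

definition moment_form :: "int \<Rightarrow> int \<Rightarrow> int list \<Rightarrow> int" where
  "moment_form c x v = (\<Sum>l<length v. v ! l * (c * x ^ l))"

lemma moment_form_Nil [simp]: "moment_form c x [] = 0"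
  by (simp add: moment_form_def)

lemma moment_form_snoc: "moment_form c x (v @ [a]) = moment_form c x v + a * (c * x ^ length v)"
  by (simp add: moment_form_def nth_append)

lemma moment_form_take_Suc:
  "l < length v \<Longrightarrow>
    moment_form c x (take (Suc l) v) = moment_form c x (take l v) + v ! l * (c * x ^ l)"
  by (simp add: take_Suc_conv_app_nth moment_form_snoc)

lemma dvd_moment_form: "c dvd moment_form c x v"
  unfolding moment_form_def by (intro dvd_sum) (simp add: mult.left_commute)

lemma moment_form_eq_mult: "moment_form c x v = c * moment_form 1 x v"
  by (simp add: moment_form_def sum_distrib_left mult.left_commute)

lemma abs_moment_form_less:
  assumes "\<And>a. a \<in> set v \<Longrightarrow> \<bar>a\<bar> < x" "0 < x"
  shows "\<bar>moment_form 1 x v\<bar> < x ^ length v"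
  using assms(1)
proof (induction v rule: rev_induct)
  case (snoc a v)
  have "\<bar>a * x ^ length v\<bar> \<le> (x - 1) * x ^ length v"
    unfolding abs_mult using snoc.prems[of a] assms(2) by (intro mult_mono) auto
  moreover have "\<bar>moment_form 1 x v\<bar> < x ^ length v" using snoc by simp
  ultimately have "\<bar>moment_form 1 x v + a * x ^ length v\<bar> < x ^ length v + (x - 1) * x ^ length v"
    by linarith
  then show ?case by (simp add: moment_form_snoc algebra_simps)
qed simp

lemma moment_form_nonzero:
  assumes "\<And>a. a \<in> set v \<Longrightarrow> \<bar>a\<bar> < x" "\<exists>a\<in>set v. a \<noteq> 0" "c \<noteq> 0"
  shows "moment_form c x v \<noteq> 0"
proof -
  have pos: "0 < x" using assms(1,2) by fastforce
  have "moment_form 1 x v \<noteq> 0"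
    using assms(1,2)
  proof (induction v rule: rev_induct)
    case (snoc a v)
    show ?case
    proof (cases "a = 0")
      case False
      then have "1 * x ^ length v \<le> \<bar>a\<bar> * \<bar>x ^ length v\<bar>" using pos by (intro mult_mono) auto
      then have "x ^ length v \<le> \<bar>a * x ^ length v\<bar>" by (simp add: abs_mult)
      moreover have "\<bar>moment_form 1 x v\<bar> < x ^ length v"
        using snoc.prems(1) pos by (intro abs_moment_form_less) auto
      ultimately show ?thesis by (simp add: moment_form_snoc)
    qed (use snoc in \<open>auto simp: moment_form_snoc\<close>)
  qed simp
  then show ?thesis using assms(3) moment_form_eq_mult[of c] by simp
qed

lemma bit_size_moment_form_take:
  assumes "\<And>a. a \<in> set v \<Longrightarrow> bit_size a \<le> g"
    and "\<And>l. l < length v \<Longrightarrow> bit_size (c * x ^ l) \<le> d" "l \<le> length v"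
  shows "bit_size (moment_form c x (take l v)) \<le> l + Suc (g + d)"
proof -
  have "bit_size (v ! k * (c * x ^ k)) \<le> Suc (g + d)" if "k < l" for k
    using bit_size_mult[of "v ! k" "c * x ^ k"] assms(1)[of "v ! k"] assms(2)[of k] assms(3) that
    by simp
  then show ?thesis
    using bit_size_sum[of "{..<l}" "\<lambda>k. v ! k * (c * x ^ k)" "Suc (g + d)"] assms(3)
    by (simp add: moment_form_def min_absorb2)
qed

section \<open>Sums of fractions\<close>

definition add_frac :: "int \<times> int \<Rightarrow> int \<times> int \<Rightarrow> int \<times> int" where
  "add_frac = (\<lambda>(p, q) (a, b). (p * b + q * a, q * b))"

definition sum_fracs :: "(int \<times> int) list \<Rightarrow> int \<times> int" where
  "sum_fracs fs = foldl add_frac (0, 1) fs"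

lemma sum_fracs_Nil: "sum_fracs [] = (0, 1)"
  and sum_fracs_snoc: "sum_fracs (fs @ [f]) = add_frac (sum_fracs fs) f"
  by (simp_all add: sum_fracs_def)

lemma sum_fracs_correct:
  assumes "\<And>a b. (a, b) \<in> set fs \<Longrightarrow> b \<noteq> 0"
  shows "snd (sum_fracs fs) \<noteq> 0 \<and> of_int (fst (sum_fracs fs)) / of_int (snd (sum_fracs fs)) =
    (\<Sum>(a, b)\<leftarrow>fs. of_int a / of_int b :: rat)"
  using assms
proof (induction fs rule: rev_induct)
  case (snoc f fs)
  obtain a b p q where split: "f = (a, b)" "sum_fracs fs = (p, q)" by fastforce
  have "b \<noteq> 0" using snoc.prems[of a b] split by simp
  then show ?case using snoc split
    by (auto simp: sum_fracs_snoc add_frac_def add_divide_distrib add.commute)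
qed (simp add: sum_fracs_Nil)

lemma bit_size_sum_fracs:
  assumes "\<And>a b. (a, b) \<in> set fs \<Longrightarrow> bit_size a \<le> g \<and> bit_size b \<le> g"
  shows "bit_size (fst (sum_fracs fs)) \<le> length fs * Suc g + 2 \<and>
    bit_size (snd (sum_fracs fs)) \<le> length fs * Suc g + 2"
  using assms
proof (induction fs rule: rev_induct)
  case (snoc f fs)
  obtain a b p q where split: "f = (a, b)" "sum_fracs fs = (p, q)" by fastforce
  let ?d = "length fs * Suc g + 2 + g"
  have "bit_size p \<le> length fs * Suc g + 2" "bit_size q \<le> length fs * Suc g + 2"
    "bit_size a \<le> g" "bit_size b \<le> g" using snoc split by auto
  then have "bit_size (p * b) \<le> ?d" "bit_size (q * a) \<le> ?d" "bit_size (q * b) \<le> ?d"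
    using bit_size_mult[of p b] bit_size_mult[of q a] bit_size_mult[of q b] by linarith+
  then show ?case
    using bit_size_add_le[of "p * b" ?d "q * a"] by (simp add: sum_fracs_snoc add_frac_def split)
qed (simp add: sum_fracs_Nil)

section \<open>Programs for arithmetic\<close>

text \<open>The input is stored in the array \<open>G\<close>, and \<open>pos\<close> points to the next number in it.\<close>

definition stored :: "(int \<Rightarrow> int) \<Rightarrow> nat \<Rightarrow> int list \<Rightarrow> bool" where
  "stored g p xs \<longleftrightarrow> (\<forall>k<length xs. g (int (p + k)) = xs ! k)"

lemma stored_nth: "stored g p xs \<Longrightarrow> k < length xs \<Longrightarrow> g (int p + int k) = xs ! k"
  by (simp add: stored_def)

lemma stored_append:
  "stored g p (xs @ ys) \<longleftrightarrow> stored g p xs \<and> stored g (p + length xs) ys"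
proof (intro iffI conjI)
  assume "stored g p (xs @ ys)"
  then have nth: "g (int (p + k)) = (xs @ ys) ! k" if "k < length xs + length ys" for k
    using that by (simp add: stored_def)
  show "stored g p xs" using nth by (simp add: stored_def nth_append)
  show "stored g (p + length xs) ys"
    using nth[of "length xs + _"] by (simp add: stored_def nth_append add.assoc)
next
  assume xy: "stored g p xs \<and> stored g (p + length xs) ys"
  have "g (int (p + k)) = (xs @ ys) ! k" if "k < length (xs @ ys)" for k
  proof (cases "k < length xs")
    case False
    then obtain j where "k = length xs + j" by (metis le_Suc_ex not_less)
    then show ?thesis using xy that by (simp add: stored_def nth_append add.assoc)
  qed (use xy in \<open>simp add: stored_def nth_append\<close>)
  then show "stored g p (xs @ ys)" by (simp add: stored_def)
qed

lemma concat_split_nth: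
  "j < length xss \<Longrightarrow> concat xss = concat (take j xss) @ xss ! j @ concat (drop (Suc j) xss)"
  by (metis concat.simps(2) concat_append id_take_nth_drop)

lemma stored_concat:
  "stored g p (concat xss) \<Longrightarrow> j < length xss \<Longrightarrow>
    stored g (p + length (concat (take j xss))) (xss ! j)"
  by (subst (asm) concat_split_nth[of j]) (auto simp: stored_append)

lemma length_concat_uniform: "(\<And>v. v \<in> set vs \<Longrightarrow> length v = n) \<Longrightarrow> length (concat vs) = length vs * n"
  by (induction vs) auto

definition dot_step_com :: "string \<Rightarrow> com" where
  "dot_step_com x = (x ::= Var x [+] Cell ''G'' (Var ''pos'') [*] Var ''pw'' ;;
     ''pos'' ::= Var ''pos'' [+] Const 1 ;;
     ''pw'' ::= Var ''pw'' [*] Var ''X'')"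

definition dot_com :: "string \<Rightarrow> com" where
  "dot_com x = (x ::= Const 0 ;; ''pw'' ::= Var ''Phi'' ;; For ''l'' (Var ''n'') (dot_step_com x))"

definition todd_step_com :: com where
  "todd_step_com = (''u'' ::= Var ''u'' [*] Var ''be'' ;;
     ''e'' ::= Var ''e'' [*] (Var ''h'' [+] Const 2) ;;
     ''y'' ::= Var ''y'' [-] Var ''u'' [/] Var ''e'' [*] Cell ''R'' (Var ''k'' [-] Var ''h''))"

definition todd_coeff_com :: com where
  "todd_coeff_com = (''y'' ::= Cell ''R'' (Var ''k'' [+] Const 1) ;;
     ''u'' ::= Const 1 ;; ''e'' ::= Const 1 ;;
     For ''h'' (Var ''k'' [+] Const 1) todd_step_com ;;
     Assign ''R'' (Var ''k'' [+] Const 1) (Var ''y''))"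

definition div_todd_com :: com where
  "div_todd_com = For ''k'' (Var ''s'') todd_coeff_com"

lemma modifies_dot_com [simp]: "modifies (dot_com x) = {x, ''pw'', ''l'', ''pos''}"
  by (auto simp: dot_com_def dot_step_com_def)

lemma modifies_todd_coeff_com [simp]:
  "modifies todd_coeff_com = {''y'', ''u'', ''e'', ''h'', ''R''}"
  by (auto simp: todd_coeff_com_def todd_step_com_def)

lemma modifies_div_todd_com [simp]:
  "modifies div_todd_com = {''k'', ''y'', ''u'', ''e'', ''h'', ''R''}"
  by (simp add: div_todd_com_def)

lemma silent_arithmetic [simp]: "silent (dot_com x)" "silent div_todd_com"
  by (simp_all add: dot_com_def dot_step_com_def div_todd_com_def todd_coeff_com_def
    todd_step_com_def)

context resource_bounds
begin

lemma wp_dot: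
  assumes fresh: "x \<notin> {''l'', ''pw'', ''pos'', ''n'', ''X'', ''Phi'', ''G''}"
    and m: "m ''n'' 0 = int (length v)" "m ''pos'' 0 = int p" "m ''Phi'' 0 = c" "m ''X'' 0 = b"
      "stored (m ''G'') p v"
    and bounds: "p + length v \<le> K" "\<And>l. l \<le> length v \<Longrightarrow> bit_size (c * b ^ l) \<le> B"
      "\<And>l. l \<le> length v \<Longrightarrow> bit_size (moment_form c b (take l v)) \<le> B"
  shows "wp K B (dot_com x)
    (\<lambda>(m', _, _). m' x 0 = moment_form c b v \<and> m' ''pos'' 0 = int (p + length v)) (m, inp, out)"
proof -
  have distinct: "\<forall>y\<in>{''l'', ''pw'', ''pos'', ''n'', ''X'', ''Phi'', ''G''}. y \<noteq> x"
    using fresh by auto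
  let ?I = "\<lambda>k (m' :: mem). m' x 0 = moment_form c b (take k v) \<and>
    m' ''pos'' 0 = int (p + k) \<and> m' ''pw'' 0 = c * b ^ k"
  let ?m = "m\<langle>x := 0\<rangle>\<langle>''pw'' := c\<rangle>"
  have "wp K B (For ''l'' (Var ''n'') (dot_step_com x)) (\<lambda>(m', _, _). ?I (length v) m')
      (?m, inp, out)"
  proof (rule wp_For[where I = "\<lambda>k m' _ _. ?I k m'" and N = "length v"])
    fix k m' inp' out'
    assume k: "k < length v" "m' ''l'' 0 = int k" and I: "?I k m'"
      and frame: "\<And>y. y \<notin> insert ''l'' (modifies (dot_step_com x)) \<Longrightarrow> m' y = ?m y"
    have "m' ''G'' (int p + int k) = v ! k"
      using stored_nth[OF m(5) k(1)] frame[of "''G''"] fresh distinct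
      by (simp add: dot_step_com_def)
    moreover have "m' ''X'' 0 = b" using frame[of "''X''"] fresh distinct m(4)
      by (simp add: dot_step_com_def)
    moreover have "bit_size (int p + int k + 1) \<le> B"
      using bit_size_small_nat[of "p + k + 1"] bounds(1) k by (simp add: ac_simps)
    ultimately show "wp K B (dot_step_com x) (\<lambda>(m', _, _). ?I (Suc k) m') (m', inp', out')"
      using I k fresh distinct bounds(2,3)[of "Suc k"]
      by (simp add: dot_step_com_def moment_form_take_Suc ac_simps)
  qed (use fresh distinct m bounds(1) in \<open>auto simp: dot_step_com_def\<close>)
  then have "wp K B (For ''l'' (Var ''n'') (dot_step_com x))
      (\<lambda>(m', _, _). m' x 0 = moment_form c b v \<and> m' ''pos'' 0 = int (p + length v)) (?m, inp, out)"
    by (rule wp_frameI) auto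
  then show ?thesis
    using fresh distinct m bounds(2)[of 0] two_le_B by (simp add: dot_com_def)
qed

lemma wp_todd_step:
  assumes m: "m ''k'' 0 = int k" "m ''h'' 0 = int h" "m ''be'' 0 = b"
      "m ''R'' (int k - int h) = div_todd b r (k - h)" "m ''y'' 0 = div_todd_partial b r k h"
      "m ''u'' 0 = b ^ h" "m ''e'' 0 = fact (Suc h)"
    and bounds: "bit_size (b ^ Suc h) \<le> B" "bit_size (fact (Suc (Suc h))) \<le> B"
      "bit_size (div_todd_partial b r k (Suc h)) \<le> B"
  shows "wp K B todd_step_com (\<lambda>(m', _, _). m' ''y'' 0 = div_todd_partial b r k (Suc h) \<and>
    m' ''u'' 0 = b ^ Suc h \<and> m' ''e'' 0 = fact (Suc (Suc h))) (m, inp, out)"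
proof -
  have "todd_coeff b (Suc h) = b ^ h * b div (fact (Suc h) * (int h + 2))"
    by (simp add: todd_coeff_def algebra_simps)
  then have "div_todd_partial b r k (Suc h) = div_todd_partial b r k h -
      (b ^ h * b div (fact (Suc h) * (int h + 2))) * div_todd b r (k - h)"
    by (simp add: div_todd_partial_def)
  moreover have "bit_size (b ^ h * b) \<le> B" using bounds(1) by (simp add: mult.commute)
  moreover have "fact (Suc (Suc h)) = (fact (Suc h) * (int h + 2))" by (simp add: algebra_simps)
  moreover have "bit_size (fact (Suc h) * (int h + 2)) \<le> B"
    using bounds(2) by (simp add: algebra_simps)
  ultimately show ?thesis
    using m bounds(3) by (simp add: todd_step_com_def mult.commute[of b] del: fact_Suc)
qed

lemma wp_todd_coeff:
  assumes m: "m ''k'' 0 = int k" "m ''be'' 0 = b"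
      "\<And>i. i \<le> k \<Longrightarrow> m ''R'' (int i) = div_todd b r i" "m ''R'' (int k + 1) = r (Suc k)"
    and bounds: "Suc k \<le> K" "\<And>h. h \<le> Suc k \<Longrightarrow> bit_size (b ^ h) \<le> B"
      "\<And>h. h \<le> Suc k \<Longrightarrow> bit_size (fact (Suc h)) \<le> B"
      "\<And>h. h \<le> Suc k \<Longrightarrow> bit_size (div_todd_partial b r k h) \<le> B"
  shows "wp K B todd_coeff_com
    (\<lambda>(m', _, _). m' ''R'' = (m ''R'')(int k + 1 := div_todd b r (Suc k))) (m, inp, out)"
proof -
  let ?I = "\<lambda>h (m' :: mem). m' ''y'' 0 = div_todd_partial b r k h \<and>
    m' ''u'' 0 = b ^ h \<and> m' ''e'' 0 = fact (Suc h)"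
  let ?m = "m\<langle>''y'' := r (Suc k)\<rangle>\<langle>''u'' := 1\<rangle>\<langle>''e'' := 1\<rangle>"
  have "wp K B (For ''h'' (Var ''k'' [+] Const 1) todd_step_com) (\<lambda>(m', _, _). ?I (Suc k) m')
      (?m, inp, out)"
  proof (rule wp_For[where I = "\<lambda>k m' _ _. ?I k m'" and N = "Suc k"])
    fix h m' inp' out'
    assume h: "h < Suc k" "m' ''h'' 0 = int h" and I: "?I h m'"
      and frame: "\<And>y. y \<notin> insert ''h'' (modifies todd_step_com) \<Longrightarrow> m' y = ?m y"
    have "m' ''k'' 0 = int k" "m' ''be'' 0 = b" "m' ''R'' (int k - int h) = div_todd b r (k - h)"
      using frame m m(3)[of "k - h"] h by (simp_all add: todd_step_com_def of_nat_diff)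
    with I h show "wp K B todd_step_com (\<lambda>(m', _, _). ?I (Suc h) m') (m', inp', out')"
      by (intro wp_todd_step bounds) auto
  qed (use m bounds(1) in \<open>auto simp: todd_step_com_def div_todd_partial_def\<close>)
  then have "wp K B (For ''h'' (Var ''k'' [+] Const 1) todd_step_com ;;
      Assign ''R'' (Var ''k'' [+] Const 1) (Var ''y''))
      (\<lambda>(m', _, _). m' ''R'' = (m ''R'')(int k + 1 := div_todd b r (Suc k))) (?m, inp, out)"
    by (rule wp_seqI)
      (use m bounds(4)[of "Suc k"] in
          \<open>simp add: todd_step_com_def div_todd_Suc del: div_todd.simps\<close>)
  moreover have "bit_size (r (Suc k)) \<le> B" using bounds(4)[of 0] by (simp add: div_todd_partial_def)
  ultimately show ?thesis using m two_le_B by (simp add: todd_coeff_com_def)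
qed

lemma wp_div_todd:
  assumes m: "m ''s'' 0 = int s" "m ''be'' 0 = b" "\<And>i. i \<le> s \<Longrightarrow> m ''R'' (int i) = r i"
    and bounds: "s \<le> K" "\<And>h. h \<le> s \<Longrightarrow> bit_size (b ^ h) \<le> B"
      "\<And>h. h \<le> s \<Longrightarrow> bit_size (fact (Suc h)) \<le> B"
      "\<And>k h. k < s \<Longrightarrow> h \<le> Suc k \<Longrightarrow> bit_size (div_todd_partial b r k h) \<le> B"
  shows "wp K B div_todd_com (\<lambda>(m', _, _). \<forall>i\<le>s. m' ''R'' (int i) = div_todd b r i) (m, inp, out)"
proof -
  let ?I = "\<lambda>k (m' :: mem).
    \<forall>i\<le>s. m' ''R'' (int i) = (if i \<le> k then div_todd b r i else r i)"
  have "wp K B div_todd_com (\<lambda>(m', _, _). ?I s m') (m, inp, out)"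
    unfolding div_todd_com_def
  proof (rule wp_For[where I = "\<lambda>k m' _ _. ?I k m'" and N = s])
    fix k m' inp' out'
    assume k: "k < s" "m' ''k'' 0 = int k" and I: "?I k m'"
      and frame: "\<And>y. y \<notin> insert ''k'' (modifies todd_coeff_com) \<Longrightarrow> m' y = m y"
    have "m' ''R'' (int (Suc k)) = r (Suc k)" using I k(1) by (simp del: of_nat_Suc)
    then have "wp K B todd_coeff_com
        (\<lambda>(m'', _, _). m'' ''R'' = (m' ''R'')(int k + 1 := div_todd b r (Suc k))) (m', inp', out')"
      using I k frame m bounds by (intro wp_todd_coeff) (auto simp: add.commute)
    then show "wp K B todd_coeff_com (\<lambda>(m', _, _). ?I (Suc k) m') (m', inp', out')"
    proof (rule wp_frameI, clarify)
      fix m'' :: mem and i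
      assume "m'' ''R'' = (m' ''R'')(int k + 1 := div_todd b r (Suc k))" "i \<le> s"
      then show "m'' ''R'' (int i) = (if i \<le> Suc k then div_todd b r i else r i)"
        using I k(1) by (cases "i = Suc k") (auto simp del: div_todd.simps)
    qed
  qed (use m bounds(1) in auto)
  then show ?thesis by (rule wp_frameI) auto
qed

end

section \<open>The two algorithms\<close>

datatype summand =
  Summand (coeff_num: int) (coeff_den: int) (num_exp: "int list") (den_exps: "int list list")

abbreviation pole_order :: "summand \<Rightarrow> nat" where
  "pole_order t \<equiv> length (den_exps t)"

definition enc_summand :: "summand \<Rightarrow> int list" where
  "enc_summand t = [coeff_num t, coeff_den t, int (pole_order t)] @ num_exp t @ concat (den_exps t)"

text \<open>While the input is being stored, \<open>X\<close> and \<open>Phi\<close> are updated so that finally \<open>X\<close> exceeds the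
  absolute values of all numbers read and \<open>Phi\<close> is the factorial of their number.\<close>

definition scan_com :: com where
  "scan_com = (Read ''G'' (Var ''pos'') ;;
     ''X'' ::= Var ''X'' [+] Cell ''G'' (Var ''pos'') [*] Cell ''G'' (Var ''pos'') ;;
     ''pos'' ::= Var ''pos'' [+] Const 1 ;;
     ''Phi'' ::= Var ''Phi'' [*] Var ''pos'')"

definition scan_summand_com :: com where
  "scan_summand_com = (For ''k'' (Const 3) scan_com ;;
     ''c'' ::= Var ''n'' [*] (Const 1 [+] Cell ''G'' (Var ''pos'' [-] Const 1)) ;;
     For ''k'' (Var ''c'') scan_com)"

definition scan_dim_com :: com where
  "scan_dim_com = (Read ''z'' (Const 0) ;;
     While (Var ''z'') (''n'' ::= Var ''n'' [+] Const 1 ;; Read ''z'' (Const 0)))"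

definition scan_input_com :: com where
  "scan_input_com = (''X'' ::= Const 1 ;; ''Phi'' ::= Const 1 ;; scan_dim_com ;;
     Read ''N'' (Const 0) ;; For ''i'' (Var ''N'') scan_summand_com)"

definition denominator_com :: com where
  "denominator_com = (dot_com ''be'' ;;
     ''den'' ::= Var ''den'' [*] (Const 0 [-] Var ''be'') ;; div_todd_com)"

definition todd_com :: com where
  "todd_com = (For ''k'' (Var ''s'' [+] Const 1) (Assign ''R'' (Var ''k'') (Const 0)) ;;
     Assign ''R'' (Const 0) (Const 1) ;; ''den'' ::= Const 1 ;;
     For ''j'' (Var ''s'') denominator_com)"

definition prepare_com :: com where
  "prepare_com = (''p'' ::= Cell ''G'' (Var ''pos'') ;;
     ''q'' ::= Cell ''G'' (Var ''pos'' [+] Const 1) ;;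
     ''s'' ::= Cell ''G'' (Var ''pos'' [+] Const 2) ;;
     ''pos'' ::= Var ''pos'' [+] Const 3 ;;
     dot_com ''al'' ;; todd_com)"

definition add_term_com :: com where
  "add_term_com = (''v'' ::= Var ''v'' [+]
       Cell ''R'' (Var ''s'' [-] Var ''o'') [*] (Var ''ap'' [/] Var ''lf'') ;;
     ''ap'' ::= Var ''ap'' [*] Var ''al'' ;;
     ''lf'' ::= Var ''lf'' [*] (Var ''o'' [+] Const 1))"

definition add_value_com :: com where
  "add_value_com =
     (''RP'' ::= Var ''RP'' [*] (Var ''q'' [*] Var ''den'') [+]
        Var ''RQ'' [*] (Var ''p'' [*] Var ''v'') ;;
      ''RQ'' ::= Var ''RQ'' [*] (Var ''q'' [*] Var ''den''))"

definition add_summand_com :: com where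
  "add_summand_com = (''v'' ::= Const 0 ;; ''ap'' ::= Const 1 ;; ''lf'' ::= Const 1 ;;
     For ''o'' (Var ''s'' [+] Const 1) add_term_com ;; add_value_com)"

definition value_com :: com where
  "value_com = (scan_input_com ;; ''pos'' ::= Const 0 ;; ''RP'' ::= Const 0 ;; ''RQ'' ::= Const 1 ;;
     For ''i'' (Var ''N'') (prepare_com ;; add_summand_com) ;;
     Write (Var ''RP'' [*] Var ''RQ'') ;; Write (Var ''RQ'' [*] Var ''RQ''))"

definition write_lambda_com :: com where
  "write_lambda_com = (''pw'' ::= Var ''Phi'' ;;
     For ''l'' (Var ''n'')
       (Write (Var ''pw'') ;; Write (Const 1) ;; ''pw'' ::= Var ''pw'' [*] Var ''X''))"

definition write_weight_com :: com where
  "write_weight_com = (''d'' ::= Var ''lf'' [*] Var ''den'' ;;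
     Write (Cell ''R'' (Var ''s'' [-] Var ''o'') [*] Var ''d'') ;;
     Write (Var ''d'' [*] Var ''d'') ;;
     ''lf'' ::= Var ''lf'' [*] (Var ''o'' [+] Const 1))"

definition write_weights_com :: com where
  "write_weights_com = (''lf'' ::= Const 1 ;; For ''o'' (Var ''s'' [+] Const 1) write_weight_com)"

definition weights_com :: com where
  "weights_com = (scan_input_com ;; write_lambda_com ;; ''pos'' ::= Const 0 ;;
     For ''i'' (Var ''N'') (prepare_com ;; write_weights_com))"

lemma modifies_scan [simp]:
  "modifies scan_com = {''G'', ''X'', ''pos'', ''Phi''}"
  "modifies scan_summand_com = {''G'', ''X'', ''pos'', ''Phi'', ''k'', ''c''}"
  "modifies scan_dim_com = {''n'', ''z''}"
  by (auto simp: scan_com_def scan_summand_com_def scan_dim_com_def)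

lemma modifies_todd [simp]:
  "modifies denominator_com =
    {''be'', ''pw'', ''l'', ''pos'', ''den'', ''k'', ''y'', ''u'', ''e'', ''h'', ''R''}"
  "modifies todd_com = insert ''j'' (modifies denominator_com)"
  "modifies prepare_com = {''p'', ''q'', ''s'', ''al''} \<union> modifies todd_com"
  by (auto simp: denominator_com_def todd_com_def prepare_com_def)

lemma modifies_output [simp]:
  "modifies add_term_com = {''v'', ''ap'', ''lf''}"
  "modifies add_summand_com = {''v'', ''ap'', ''lf'', ''o'', ''RP'', ''RQ''}"
  "modifies write_lambda_com = {''pw'', ''l''}"
  "modifies write_weight_com = {''d'', ''lf''}"
  "modifies write_weights_com = {''d'', ''lf'', ''o''}"
  by (auto simp: add_term_com_def add_value_com_def add_summand_com_def write_lambda_com_def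
    write_weight_com_def write_weights_com_def)

lemma silent_programs [simp]:
  "silent scan_com" "silent scan_summand_com" "silent scan_dim_com" "silent scan_input_com"
  "silent denominator_com" "silent todd_com" "silent prepare_com" "silent add_summand_com"
  by (simp_all add: scan_com_def scan_summand_com_def scan_dim_com_def scan_input_com_def
      denominator_com_def todd_com_def prepare_com_def add_summand_com_def add_term_com_def
      add_value_com_def)

section \<open>Sizes of the numbers involved\<close>

definition square_bound :: "int list \<Rightarrow> int" where
  "square_bound xs = 1 + (\<Sum>x\<leftarrow>xs. x * x)"

lemma square_bound_Nil: "square_bound [] = 1"
  and square_bound_snoc: "square_bound (xs @ [x]) = square_bound xs + x * x"
  by (simp_all add: square_bound_def)

lemma sum_list_squares_nonneg: "0 \<le> (\<Sum>x\<leftarrow>xs. x * x)" for xs :: "int list"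
  by (rule sum_list_nonneg) auto

lemma square_bound_pos: "1 \<le> square_bound xs"
  by (simp add: square_bound_def sum_list_squares_nonneg)

lemma abs_less_square_bound:
  assumes "x \<in> set xs"
  shows "\<bar>x\<bar> < square_bound xs"
proof -
  obtain ys zs where "xs = ys @ x # zs" using assms by (auto simp: in_set_conv_decomp)
  then have "x * x \<le> (\<Sum>x\<leftarrow>xs. x * x)"
    using sum_list_squares_nonneg[of ys] sum_list_squares_nonneg[of zs] by simp
  moreover have "\<bar>x\<bar> * 1 \<le> \<bar>x\<bar> * \<bar>x\<bar>" by (cases "x = 0") (simp, intro mult_left_mono, auto)
  ultimately show ?thesis by (simp add: square_bound_def)
qed

lemma bit_size_square_bound: "bit_size (square_bound xs) \<le> 2 * tape_size xs + 2"
proof (rule bit_size_le_pow2)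
  have "square_bound xs \<le> 2 ^ (2 * tape_size xs)"
  proof (induction xs rule: rev_induct)
    case Nil
    then show ?case by (simp add: square_bound_Nil)
  next
    case (snoc x xs)
    obtain b where b: "bit_size x = Suc b" "\<bar>x\<bar> < 2 ^ b" by (rule bit_sizeE)
    have "\<bar>x\<bar> * \<bar>x\<bar> \<le> (2 ^ b - 1) * 2 ^ b" using b(2) by (intro mult_mono) auto
    moreover have "1 \<le> (2 :: int) ^ b" by simp
    ultimately have square: "1 + x * x \<le> 2 ^ b * 2 ^ b"
      unfolding left_diff_distrib abs_mult_self_eq by linarith
    have "square_bound (xs @ [x]) \<le> (1 + x * x) * square_bound xs"
      using mult_left_mono[OF square_bound_pos[of xs], of "x * x"]
      by (simp add: square_bound_snoc distrib_right)
    also have "\<dots> \<le> (2 ^ b * 2 ^ b) * 2 ^ (2 * tape_size xs)"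
      using square snoc square_bound_pos[of xs] by (intro mult_mono) auto
    also have "\<dots> = 2 ^ (2 * b + 2 * tape_size xs)" by (simp add: power_add mult_2)
    also have "\<dots> \<le> 2 ^ (2 * tape_size (xs @ [x]))"
      using b(1) by (intro power_increasing) (auto simp: tape_size_def)
    finally show ?case .
  qed
  then show "\<bar>square_bound xs\<bar> \<le> 2 ^ (2 * tape_size xs)" using square_bound_pos[of xs] by simp
qed

locale gf_tape =
  fixes n :: nat and ts :: "summand list"
  assumes length_num_exp: "t \<in> set ts \<Longrightarrow> length (num_exp t) = n"
    and length_den_exps: "t \<in> set ts \<Longrightarrow> v \<in> set (den_exps t) \<Longrightarrow> length v = n"
    and den_exps_dim_0: "t \<in> set ts \<Longrightarrow> n = 0 \<Longrightarrow> den_exps t = []"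
begin

definition entries :: "int list" where
  "entries = concat (map enc_summand ts)"

definition tape :: "int list" where
  "tape = replicate n 1 @ [0, int (length ts)] @ entries"

definition X :: int where
  "X = square_bound entries"

definition \<Phi> :: int where
  "\<Phi> = fact (length entries)"

definition lam_form :: "int list \<Rightarrow> int" where
  "lam_form = moment_form \<Phi> X"

definition alpha :: "summand \<Rightarrow> int" where
  "alpha t = lam_form (num_exp t)"

definition betas :: "summand \<Rightarrow> int list" where
  "betas t = map lam_form (den_exps t)"

definition todd :: "summand \<Rightarrow> nat \<Rightarrow> int" where
  "todd t = int_todd_series (betas t)"

definition beta_prod :: "summand \<Rightarrow> int" where
  "beta_prod t = neg_prod (betas t)"

definition partial_value :: "summand \<Rightarrow> nat \<Rightarrow> int" where
  "partial_value t h = (\<Sum>l<h. todd t (pole_order t - l) * (alpha t ^ l div fact l))"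

definition value_frac :: "summand \<Rightarrow> int \<times> int" where
  "value_frac t =
     (coeff_num t * partial_value t (Suc (pole_order t)), coeff_den t * beta_prod t)"

definition offset :: "nat \<Rightarrow> nat" where
  "offset i = length (concat (map enc_summand (take i ts)))"

definition K :: nat where
  "K = tape_size tape + 2"

definition B :: nat where
  "B = 12 * K ^ 4"

lemma length_betas [simp]: "length (betas t) = pole_order t"
  by (simp add: betas_def)

lemma length_enc_summand:
  assumes "t \<in> set ts"
  shows "length (enc_summand t) = 3 + n + pole_order t * n"
  using length_concat_uniform[of "den_exps t" n] length_den_exps[OF assms] length_num_exp[OF assms]
  by (simp add: enc_summand_def)

lemma pole_order_le:
  assumes "t \<in> set ts"
  shows "pole_order t + 3 \<le> length (enc_summand t)"
  using den_exps_dim_0[OF assms] by (cases n) (simp_all add: length_enc_summand[OF assms])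

lemma offset_0 [simp]: "offset 0 = 0"
  and offset_Suc: "i < length ts \<Longrightarrow> offset (Suc i) = offset i + length (enc_summand (ts ! i))"
  and offset_all: "offset (length ts) = length entries"
  by (simp_all add: offset_def entries_def take_Suc_conv_app_nth)

lemma entries_split:
  "i < length ts \<Longrightarrow> entries = concat (map enc_summand (take i ts)) @ enc_summand (ts ! i) @
    concat (map enc_summand (drop (Suc i) ts))"
  using concat_split_nth[of i "map enc_summand ts"] by (simp add: entries_def take_map drop_map)

lemma nth_entries:
  "i < length ts \<Longrightarrow> k < length (enc_summand (ts ! i)) \<Longrightarrow>
      entries ! (offset i + k) = enc_summand (ts ! i) ! k"
  by (subst entries_split) (auto simp: offset_def nth_append)

lemma offset_le: "i < length ts \<Longrightarrow> offset i + length (enc_summand (ts ! i)) \<le> length entries"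
  by (subst entries_split) (auto simp: offset_def)

lemma length_enc_summand_le: "t \<in> set ts \<Longrightarrow> length (enc_summand t) \<le> length entries"
  using offset_le by (fastforce simp: in_set_conv_nth)

lemma length_ts_le: "length ts \<le> length entries"
proof -
  have "length us \<le> length (concat (map enc_summand us))" for us
    by (induction us) (auto simp: enc_summand_def)
  then show ?thesis by (simp add: entries_def)
qed

lemma K_ge: "n + length entries + 4 \<le> K" "tape_size entries + 4 \<le> K"
  using length_le_tape_size[of tape]
  by (auto simp: K_def tape_def tape_size_def intro: trans_le_add2 one_le_bit_size)

lemma K_powers: "4 \<le> K" "4 * K \<le> K ^ 2" "4 * K ^ 2 \<le> K ^ 3" "K * K ^ 3 = K ^ 4"
proof -
  show K: "4 \<le> K" using K_ge by simp
  then show "4 * K \<le> K ^ 2" by (simp add: power2_eq_square)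
  from K show "4 * K ^ 2 \<le> K ^ 3" by (simp add: power3_eq_cube power2_eq_square)
  show "K * K ^ 3 = K ^ 4" by (simp add: power_numeral_reduce)
qed

lemma mult_K_power_le:
  assumes "Suc k \<le> K"
  shows "k * (c * K ^ i) + c * K ^ i \<le> c * K ^ Suc i"
proof -
  have "Suc k * (c * K ^ i) \<le> K * (c * K ^ i)" using assms by (rule mult_le_mono1)
  then show ?thesis by (simp add: algebra_simps)
qed

lemma le_B: "x \<le> 48 * K ^ 3 \<Longrightarrow> x \<le> B"
  using mult_le_mono1[OF K_powers(1), of "K ^ 3"] K_powers(4) unfolding B_def by linarith

lemma le_B_square: "x \<le> 48 * K ^ 2 \<Longrightarrow> x \<le> B"
  using K_powers(3) by (intro le_B) linarith

lemma le_B_linear: "x \<le> 48 * K \<Longrightarrow> x \<le> B"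
  using K_powers(2) by (intro le_B_square) linarith

sublocale resource_bounds K B
proof
  show "1 \<le> K" using K_powers by simp
  fix k assume "k \<le> K"
  then show "bit_size (int k) \<le> B"
    using bit_size_of_nat[of k] K_powers(1) by (intro le_B_linear) linarith
qed

lemma bit_size_entries: "x \<in> set entries \<Longrightarrow> bit_size x \<le> K"
  using bit_size_le_tape_size[of x entries] K_ge(2) by simp

lemma set_enc_summand:
  "t \<in> set ts \<Longrightarrow> set (enc_summand t) \<subseteq> set entries"
  by (auto simp: entries_def)

lemma bit_size_exponent:
  assumes "t \<in> set ts" "v = num_exp t \<or> v \<in> set (den_exps t)" "a \<in> set v"
  shows "bit_size a \<le> K"
  using assms set_enc_summand[OF assms(1)] by (intro bit_size_entries) (auto simp: enc_summand_def)

lemma bit_size_square_bound_take: "bit_size (square_bound (take k entries)) \<le> 2 * K"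
proof -
  have "tape_size (take k entries) \<le> tape_size entries"
    using tape_size_append[of "take k entries" "drop k entries"] by simp
  then show ?thesis using bit_size_square_bound[of "take k entries"] K_ge(2) by simp
qed

lemma bit_size_fact_less:
  assumes "k < K"
  shows "bit_size (fact k) \<le> K ^ 2"
proof -
  have "k * Suc k + Suc k \<le> K * K" using assms mult_mono[of "Suc k" K "Suc k" K] by simp
  moreover have "k * Suc k + 2 \<le> K * K"
    using K_powers(1) calculation mult_mono[of 4 K 4 K] by (cases k) simp_all
  ultimately show ?thesis using bit_size_fact[of k] by (simp add: power2_eq_square)
qed

lemma bit_size_lambda: "l \<le> n \<Longrightarrow> bit_size (\<Phi> * X ^ l) \<le> 3 * K ^ 2"
proof -
  assume l: "l \<le> n"
  have "bit_size (X ^ l) \<le> l * (2 * K) + 2"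
    using bit_size_square_bound_take[of "length entries"]
    by (intro bit_size_power) (simp add: X_def)
  moreover have "l * (2 * K ^ 1) + 2 * K ^ 1 \<le> 2 * K ^ Suc 1"
    using l K_ge(1) by (intro mult_K_power_le) simp
  moreover have "bit_size \<Phi> \<le> K ^ 2" unfolding \<Phi>_def using K_ge(1)
    by (intro bit_size_fact_less) simp
  ultimately show "bit_size (\<Phi> * X ^ l) \<le> 3 * K ^ 2"
    using bit_size_mult[of \<Phi> "X ^ l"] K_powers(1) by (simp add: power2_eq_square)
qed

lemma bit_size_partial_lam_form:
  assumes "t \<in> set ts" "v = num_exp t \<or> v \<in> set (den_exps t)" "l \<le> n"
  shows "bit_size (moment_form \<Phi> X (take l v)) \<le> 4 * K ^ 2"
proof -
  have v: "length v = n" using assms length_num_exp length_den_exps by auto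
  have "bit_size (moment_form \<Phi> X (take l v)) \<le> l + Suc (K + 3 * K ^ 2)"
    using assms v bit_size_lambda bit_size_exponent[OF assms(1,2)]
    by (intro bit_size_moment_form_take) auto
  then show ?thesis using assms(3) K_ge(1) K_powers(2) by simp
qed

lemma bit_size_alpha: "t \<in> set ts \<Longrightarrow> bit_size (alpha t) \<le> 4 * K ^ 2"
  using bit_size_partial_lam_form[of t "num_exp t" n] length_num_exp
  by (simp add: alpha_def lam_form_def)

lemma bit_size_betas:
  assumes "t \<in> set ts" "b \<in> set (betas t)"
  shows "bit_size b \<le> 4 * K ^ 2"
proof -
  obtain v where "v \<in> set (den_exps t)" "b = lam_form v" using assms(2) by (auto simp: betas_def)
  then show ?thesis
    using bit_size_partial_lam_form[of t v n] length_den_exps[of t v] assms(1)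
    by (simp add: lam_form_def)
qed

lemma pole_order_less_K: "t \<in> set ts \<Longrightarrow> pole_order t + 7 \<le> K"
  using pole_order_le[of t] length_enc_summand_le[of t] K_ge(1) by simp

lemma bit_size_power_less_K:
  assumes "bit_size b \<le> 4 * K ^ 2" "h < K"
  shows "bit_size (b ^ h) \<le> 4 * K ^ 3"
proof -
  have "bit_size (b ^ h) \<le> h * (4 * K ^ 2) + 2"
    using assms(1) by (rule bit_size_power)
  then show ?thesis using mult_K_power_le[of h 4 2] assms(2) K_powers by simp
qed

lemma bit_size_partial_beta_prod: "t \<in> set ts \<Longrightarrow> bit_size (neg_prod (take j (betas t))) \<le> 4 * K ^ 3"
proof -
  assume t: "t \<in> set ts"
  let ?j = "length (take j (betas t))"
  have "bit_size (neg_prod (take j (betas t))) \<le> ?j * (4 * K ^ 2) + 2"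
    using bit_size_betas[OF t] by (intro bit_size_neg_prod) (auto dest: in_set_takeD)
  moreover have "?j * (4 * K ^ 2) + 4 * K ^ 2 \<le> 4 * K ^ Suc 2"
    using pole_order_less_K[OF t] by (intro mult_K_power_le) simp
  ultimately show ?thesis using K_powers by simp
qed

lemma bit_size_beta_prod: "t \<in> set ts \<Longrightarrow> bit_size (beta_prod t) \<le> 4 * K ^ 3"
  using bit_size_partial_beta_prod[of t "pole_order t"] by (simp add: beta_prod_def)

lemma todd_bound_le:
  assumes "t \<in> set ts" "Suc k \<le> K"
  shows "k * (2 * pole_order t + 1 + 4 * K ^ 2) + 2 \<le> 5 * K ^ 3"
proof -
  have "2 * pole_order t + 1 + 4 * K ^ 2 \<le> 5 * K ^ 2"
    using pole_order_less_K[OF assms(1)] K_powers(2) by linarith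
  then have "k * (2 * pole_order t + 1 + 4 * K ^ 2) \<le> k * (5 * K ^ 2)" by (rule mult_le_mono2)
  then show ?thesis using mult_K_power_le[OF assms(2), of 5 2] K_powers by simp
qed

lemma bit_size_todd: "t \<in> set ts \<Longrightarrow> k \<le> pole_order t \<Longrightarrow> bit_size (todd t k) \<le> 5 * K ^ 3"
  using bit_size_int_todd_series[of "betas t" "4 * K ^ 2" k] bit_size_betas[of t]
    todd_bound_le[of t k] pole_order_less_K[of t] by (simp add: todd_def)

lemma bit_size_partial_todd:
  assumes "t \<in> set ts" "j < pole_order t" "k < pole_order t" "h \<le> Suc k"
  shows "bit_size (div_todd_partial (betas t ! j) (int_todd_series (take j (betas t))) k h) \<le>
      5 * K ^ 3"
  using bit_size_div_todd_partial[of "betas t" "4 * K ^ 2" j h k] bit_size_betas[of t]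
    todd_bound_le[of t "Suc k"] pole_order_less_K[of t] assms by simp

lemma bit_size_partial_value:
  assumes "t \<in> set ts" "h \<le> Suc (pole_order t)"
  shows "bit_size (partial_value t h) \<le> 10 * K ^ 3"
proof -
  have "bit_size (todd t (pole_order t - l) * (alpha t ^ l div fact l)) \<le> 9 * K ^ 3"
      if "l < h" for l
  proof -
    have "bit_size (alpha t ^ l) \<le> 4 * K ^ 3"
      using that assms pole_order_less_K[OF assms(1)]
      by (intro bit_size_power_less_K bit_size_alpha) auto
    then show ?thesis
      using bit_size_mult[of "todd t (pole_order t - l)" "alpha t ^ l div fact l"]
        bit_size_div[of "alpha t ^ l" "fact l"] bit_size_todd[OF assms(1), of "pole_order t - l"]
      by simp
  qed
  then have "bit_size (partial_value t h) \<le> h + 9 * K ^ 3"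
    unfolding partial_value_def using K_powers
      bit_size_sum[of "{..<h}" "\<lambda>l. todd t (pole_order t - l) * (alpha t ^ l div fact l)"
        "9 * K ^ 3"]
    by simp
  then show ?thesis using assms pole_order_less_K[OF assms(1)] K_powers by simp
qed

lemma bit_size_coeff:
  assumes "t \<in> set ts"
  shows "bit_size (coeff_num t) \<le> K" "bit_size (coeff_den t) \<le> K"
  using set_enc_summand[OF assms] by (auto simp: enc_summand_def intro: bit_size_entries)

lemma bit_size_value_frac:
  assumes "t \<in> set ts"
  shows "bit_size (fst (value_frac t)) \<le> 11 * K ^ 3 \<and> bit_size (snd (value_frac t)) \<le> 11 * K ^ 3"
  using bit_size_mult[of "coeff_num t" "partial_value t (Suc (pole_order t))"]
    bit_size_mult[of "coeff_den t" "beta_prod t"] bit_size_coeff[OF assms]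
    bit_size_beta_prod[OF assms] bit_size_partial_value[OF assms order_refl] K_powers
  by (simp add: value_frac_def)

lemma bit_size_sum_value_fracs:
  "bit_size (fst (sum_fracs (map value_frac (take i ts)))) \<le> B \<and>
   bit_size (snd (sum_fracs (map value_frac (take i ts)))) \<le> B"
proof -
  let ?fs = "map value_frac (take i ts)"
  have "length ?fs * Suc (11 * K ^ 3) \<le> length ?fs * (12 * K ^ 3)"
    using K_powers by (intro mult_le_mono2) simp
  moreover have "length ?fs * (12 * K ^ 3) + 12 * K ^ 3 \<le> B"
    using mult_K_power_le[of "length ?fs" 12 3] length_ts_le K_ge(1) by (simp add: B_def)
  ultimately have "length ?fs * Suc (11 * K ^ 3) + 2 \<le> B"
    using K_powers(1-3) by linarith
  moreover have "bit_size (fst (sum_fracs ?fs)) \<le> length ?fs * Suc (11 * K ^ 3) + 2 \<and>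
      bit_size (snd (sum_fracs ?fs)) \<le> length ?fs * Suc (11 * K ^ 3) + 2"
  proof (rule bit_size_sum_fracs)
    fix a b assume "(a, b) \<in> set ?fs"
    then obtain t where "t \<in> set ts" "value_frac t = (a, b)" by (auto dest: in_set_takeD)
    then show "bit_size a \<le> 11 * K ^ 3 \<and> bit_size b \<le> 11 * K ^ 3"
      using bit_size_value_frac[of t] by simp
  qed
  ultimately show ?thesis by linarith
qed

section \<open>Verification of the algorithms\<close>

definition reading :: "nat \<Rightarrow> mem \<Rightarrow> int list \<Rightarrow> bool" where
  "reading k m inp \<longleftrightarrow> inp = drop k entries \<and> stored (m ''G'') 0 (take k entries) \<and>
     m ''pos'' 0 = int k \<and> m ''X'' 0 = square_bound (take k entries) \<and>
     m ''Phi'' 0 = fact k"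

definition scanned :: "mem \<Rightarrow> bool" where
  "scanned m \<longleftrightarrow> m ''n'' 0 = int n \<and> m ''N'' 0 = int (length ts) \<and> stored (m ''G'') 0 entries \<and>
     m ''X'' 0 = X \<and> m ''Phi'' 0 = \<Phi>"

lemma wp_scan:
  assumes "reading k m inp" "k < length entries"
  shows "wp K B scan_com (\<lambda>(m', inp', _). reading (Suc k) m' inp') (m, inp, out)"
proof -
  have m: "stored (m ''G'') 0 (take k entries)" "m ''pos'' 0 = int k"
    "m ''X'' 0 = square_bound (take k entries)" "m ''Phi'' 0 = fact k" and "inp = drop k entries"
    using assms(1) by (simp_all add: reading_def)
  then have inp: "inp = entries ! k # drop (Suc k) entries"
    using assms(2) by (simp add: Cons_nth_drop_Suc)
  have take: "take (Suc k) entries = take k entries @ [entries ! k]"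
    using assms(2) by (simp add: take_Suc_conv_app_nth)
  have "bit_size (square_bound (take (Suc k) entries)) \<le> B"
    using bit_size_square_bound_take[of "Suc k"] by (intro le_B_linear) linarith
  moreover have "bit_size (fact (Suc k)) \<le> B"
    using bit_size_fact_less[of "Suc k"] assms(2) K_ge(1) by (intro le_B_square) linarith
  moreover have "bit_size (entries ! k) \<le> B"
    using bit_size_entries[of "entries ! k"] assms(2) by (intro le_B_linear) simp
  moreover have "bit_size (int (Suc k)) \<le> B"
    using assms(2) K_ge(1) by (intro bit_size_small_nat) simp
  ultimately show ?thesis
    using m assms(2) unfolding scan_com_def inp
    by (auto simp: reading_def take square_bound_snoc stored_def less_Suc_eq nth_append ac_simps)
qed

lemma wp_scans:
  assumes "reading p m inp" "p + c \<le> length entries"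
    and "aval m e = int c" "arrays e \<inter> {''k'', ''G'', ''X'', ''pos'', ''Phi''} = {}"
  shows "wp K B (For ''k'' e scan_com) (\<lambda>(m', inp', _). reading (p + c) m' inp') (m, inp, out)"
proof (rule wp_For[where I = "\<lambda>k m' inp' _. reading (p + k) m' inp'" and N = c])
  fix k m' inp' out'
  assume "k < c" "reading (p + k) m' inp'"
  then show "wp K B scan_com (\<lambda>(m', inp', _). reading (p + Suc k) m' inp') (m', inp', out')"
    using wp_scan[of "p + k" m' inp' out'] assms(2) by simp
qed (use assms K_ge(1) in \<open>auto simp: reading_def\<close>)

lemma wp_scan_summand:
  assumes i: "i < length ts" and "reading (offset i) m inp" "m ''n'' 0 = int n"
  shows "wp K B scan_summand_com (\<lambda>(m', inp', _). reading (offset (Suc i)) m' inp') (m, inp, out)"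
proof -
  let ?t = "ts ! i" and ?c = "n * (1 + pole_order (ts ! i))"
  have next_offset: "offset (Suc i) = offset i + 3 + ?c"
    using offset_Suc[OF i] length_enc_summand[of ?t] i by (simp add: algebra_simps)
  have in_range: "offset (Suc i) \<le> length entries" using offset_le[OF i] offset_Suc[OF i] by simp
  have "wp K B (For ''k'' (Const 3) scan_com) (\<lambda>(m', inp', _). reading (offset i + 3) m' inp')
      (m, inp, out)"
    using assms(2) next_offset in_range by (intro wp_scans) auto
  then show ?thesis unfolding scan_summand_com_def
  proof (rule wp_seqI)
    fix m' inp' out'
    assume r: "reading (offset i + 3) m' inp'"
      and frame: "\<And>x. x \<notin> modifies (For ''k'' (Const 3) scan_com) \<Longrightarrow> m' x = m x"
    then have "m' ''G'' (2 + int (offset i)) = int (pole_order ?t)"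
      using stored_nth[of "m' ''G''" 0 "take (offset i + 3) entries" "offset i + 2"]
        nth_entries[OF i, of 2] next_offset in_range
      by (simp add: reading_def enc_summand_def)
    moreover have "bit_size (int ?c) \<le> B" using next_offset in_range K_ge(1)
      by (intro bit_size_small_nat) simp
    moreover have "wp K B (For ''k'' (Var ''c'') scan_com)
        (\<lambda>(m', inp', _). reading (offset i + 3 + ?c) m' inp') (m'\<langle>''c'' := int ?c\<rangle>, inp', out')"
      using r next_offset in_range by (intro wp_scans) (auto simp: reading_def)
    ultimately show "wp K B
        (''c'' ::= Var ''n'' [*] (Const 1 [+] Cell ''G'' (Var ''pos'' [-] Const 1)) ;;
         For ''k'' (Var ''c'') scan_com)
        (\<lambda>(m', inp', _). reading (offset (Suc i)) m' inp') (m', inp', out')"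
      using r assms(3) frame[of "''n''"] by (simp add: reading_def next_offset distrib_left)
  qed
qed

lemma wp_scan_dim:
  assumes "m ''n'' 0 = 0"
  shows "wp K B scan_dim_com (\<lambda>(m', inp', _). m' ''n'' 0 = int n \<and> inp' = xs)
    (m, replicate n 1 @ 0 # xs, out)"
proof -
  let ?inp = "replicate n 1 @ 0 # xs"
  let ?I = "\<lambda>k (m' :: mem, inp', _ :: int list). k \<le> n \<and> m' ''n'' 0 = int k \<and>
    m' ''z'' 0 # inp' = replicate (n - k) 1 @ 0 # xs"
  have "wp K B (While (Var ''z'') (''n'' ::= Var ''n'' [+] Const 1 ;; Read ''z'' (Const 0))) (?I n)
    (m\<langle>''z'' := hd ?inp\<rangle>, tl ?inp, out)"
  proof (rule wp_While[where I = ?I])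
    fix k s
    assume k: "k < n" and I: "?I k s"
    obtain m inp out where s: "s = (m, inp, out)" by (cases s)
    have "replicate (n - k) 1 = 1 # replicate (n - Suc k) (1::int)"
      using k by (metis Suc_diff_Suc replicate_Suc)
    then have inp: "m ''z'' 0 = 1" "inp = replicate (n - Suc k) 1 @ 0 # xs"
      using I s by simp_all
    then have "inp \<noteq> []" "bit_size (hd inp) \<le> B" "hd inp # tl inp = inp"
      using two_le_B by (cases "n - Suc k"; simp)+
    moreover have "bit_size (int (Suc k)) \<le> B" using k K_ge(1) by (intro bit_size_small_nat) simp
    ultimately show "aval (fst s) (Var ''z'') \<noteq> 0 \<and>
        wp K B (''n'' ::= Var ''n'' [+] Const 1 ;; Read ''z'' (Const 0)) (?I (Suc k)) s"
      using I k s inp by (simp add: ac_simps)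
  qed (use assms K_ge(1) in auto)
  then have "wp K B (While (Var ''z'') (''n'' ::= Var ''n'' [+] Const 1 ;; Read ''z'' (Const 0)))
    (\<lambda>(m', inp', _). m' ''n'' 0 = int n \<and> inp' = xs) (m\<langle>''z'' := hd ?inp\<rangle>, tl ?inp, out)"
    by (rule wp_conseq) auto
  moreover have "bit_size (hd ?inp) \<le> B" using two_le_B by (cases n) auto
  ultimately show ?thesis by (simp add: scan_dim_com_def del: wp.simps(7))
qed

lemma wp_scan_input: "wp K B scan_input_com (\<lambda>(m, _, _). scanned m) (\<lambda>_ _. 0, tape, [])"
proof -
  let ?rest = "Read ''N'' (Const 0) ;; For ''i'' (Var ''N'') scan_summand_com"
  let ?m0 = "(\<lambda>_ _. 0)\<langle>''X'' := 1\<rangle>\<langle>''Phi'' := 1\<rangle> :: mem"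
  have "wp K B scan_dim_com (\<lambda>(m, inp, _). m ''n'' 0 = int n \<and> inp = int (length ts) # entries)
      (?m0, tape, [])"
    using wp_scan_dim[of ?m0 "int (length ts) # entries" "[]"] by (simp add: tape_def)
  then have "wp K B (scan_dim_com ;; ?rest) (\<lambda>(m, _, _). scanned m) (?m0, tape, [])"
  proof (rule wp_seqI)
    fix m and inp out :: "int list"
    assume dim: "m ''n'' 0 = int n \<and> inp = int (length ts) # entries"
      and frame: "\<And>x. x \<notin> modifies scan_dim_com \<Longrightarrow> m x = ?m0 x"
    let ?m = "m\<langle>''N'' := int (length ts)\<rangle>"
    let ?I = "\<lambda>i m inp. reading (offset i) m inp \<and> m ''n'' 0 = int n"
    have "reading 0 ?m entries"
      using frame by (simp add: reading_def stored_def square_bound_Nil)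
    then have "wp K B (For ''i'' (Var ''N'') scan_summand_com) (\<lambda>(m, inp, _). ?I (length ts) m inp)
        (?m, entries, out)"
    proof (intro wp_For[where I = "\<lambda>i m inp _. ?I i m inp" and N = "length ts"])
      fix i m' inp' out'
      assume i: "i < length ts" and I: "?I i m' inp'"
      then have "wp K B scan_summand_com (\<lambda>(m', inp', _). reading (offset (Suc i)) m' inp')
          (m', inp', out')"
        by (intro wp_scan_summand) auto
      then show "wp K B scan_summand_com (\<lambda>(m, inp, _). ?I (Suc i) m inp) (m', inp', out')"
        by (rule wp_frameI) (use I in auto)
    qed (use dim length_ts_le K_ge(1) in \<open>auto simp: reading_def\<close>)
    then have "wp K B (For ''i'' (Var ''N'') scan_summand_com) (\<lambda>(m, _, _). scanned m)
        (?m, entries, out)"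
      by (rule wp_frameI) (auto simp: reading_def scanned_def offset_all X_def \<Phi>_def)
    moreover have "bit_size (int (length ts)) \<le> B"
      using length_ts_le K_ge(1) by (intro bit_size_small_nat) simp
    ultimately show "wp K B ?rest (\<lambda>(m, _, _). scanned m) (m, inp, out)" using dim by simp
  qed
  then show ?thesis using two_le_B by (simp add: scan_input_com_def)
qed

definition partial_todd :: "summand \<Rightarrow> nat \<Rightarrow> nat \<Rightarrow> mem \<Rightarrow> bool" where
  "partial_todd t p j m \<longleftrightarrow> m ''pos'' 0 = int (p + j * n) \<and>
     m ''den'' 0 = neg_prod (take j (betas t)) \<and>
     (\<forall>k\<le>pole_order t. m ''R'' (int k) = int_todd_series (take j (betas t)) k)"

definition prepared :: "summand \<Rightarrow> mem \<Rightarrow> bool" where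
  "prepared t m \<longleftrightarrow> m ''p'' 0 = coeff_num t \<and> m ''q'' 0 = coeff_den t \<and>
     m ''s'' 0 = int (pole_order t) \<and> m ''al'' 0 = alpha t \<and> m ''den'' 0 = beta_prod t \<and>
     (\<forall>k\<le>pole_order t. m ''R'' (int k) = todd t k)"

lemma wp_lam_form:
  assumes t: "t \<in> set ts" "v = num_exp t \<or> v \<in> set (den_exps t)" and m: "scanned m"
    and "m ''pos'' 0 = int p" "stored (m ''G'') p v" "p + n \<le> length entries"
      "x = ''al'' \<or> x = ''be''"
  shows "wp K B (dot_com x) (\<lambda>(m', _, _). m' x 0 = lam_form v \<and> m' ''pos'' 0 = int (p + n))
      (m, inp, out)"
proof -
  have v: "length v = n" using t length_num_exp length_den_exps by auto
  have "wp K B (dot_com x)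
      (\<lambda>(m', _, _). m' x 0 = moment_form \<Phi> X v \<and> m' ''pos'' 0 = int (p + length v)) (m, inp, out)"
  proof (rule wp_dot)
    fix l assume "l \<le> length v"
    then have l: "l \<le> n" by (simp add: v)
    show "bit_size (\<Phi> * X ^ l) \<le> B" using bit_size_lambda[OF l] by (intro le_B_square) linarith
    show "bit_size (moment_form \<Phi> X (take l v)) \<le> B"
      using bit_size_partial_lam_form[OF t l] by (intro le_B_square) linarith
  qed (use assms(4-7) v m K_ge(1) in \<open>auto simp: scanned_def\<close>)
  then show ?thesis by (simp add: lam_form_def v)
qed

lemma wp_div_beta:
  assumes t: "t \<in> set ts" "j < pole_order t"
    and "m ''s'' 0 = int (pole_order t)" "m ''be'' 0 = betas t ! j"
    and "\<And>k. k \<le> pole_order t \<Longrightarrow> m ''R'' (int k) = int_todd_series (take j (betas t)) k"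
  shows "wp K B div_todd_com
    (\<lambda>(m', _, _). \<forall>k\<le>pole_order t. m' ''R'' (int k) = int_todd_series (take (Suc j) (betas t)) k)
    (m, inp, out)"
proof -
  have "wp K B div_todd_com
      (\<lambda>(m', _, _). \<forall>k\<le>pole_order t.
         m' ''R'' (int k) = div_todd (betas t ! j) (int_todd_series (take j (betas t))) k)
      (m, inp, out)"
  proof (rule wp_div_todd)
    show "bit_size (betas t ! j ^ h) \<le> B" if "h \<le> pole_order t" for h
      using bit_size_power_less_K[OF bit_size_betas[OF t(1)], of "betas t ! j" h] that t(2)
        pole_order_less_K[OF t(1)] by (intro le_B) simp
    show "bit_size (fact (Suc h)) \<le> B" if "h \<le> pole_order t" for h
      using bit_size_fact_less[of "Suc h"] that pole_order_less_K[OF t(1)]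
      by (intro le_B_square) linarith
    show "bit_size (div_todd_partial (betas t ! j) (int_todd_series (take j (betas t))) k h) \<le> B"
      if "k < pole_order t" "h \<le> Suc k" for k h
      using bit_size_partial_todd[OF t that] by (intro le_B) linarith
  qed (use assms pole_order_less_K[OF t(1)] in simp_all)
  then show ?thesis using t(2) by (simp add: take_Suc_conv_app_nth int_todd_series_snoc)
qed

lemma stored_den_exp:
  assumes "t \<in> set ts" "j < pole_order t" "stored g p (concat (den_exps t))"
  shows "stored g (p + j * n) (den_exps t ! j)"
proof -
  have "length (concat (take j (den_exps t))) = j * n"
    using length_concat_uniform[of "take j (den_exps t)" n] length_den_exps[OF assms(1)] assms(2)
    by (auto dest: in_set_takeD)
  then show ?thesis using stored_concat[OF assms(3,2)] by simp
qed

lemma wp_denominator: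
  assumes t: "t \<in> set ts" "j < pole_order t" and m: "scanned m" "m ''s'' 0 = int (pole_order t)"
    and G: "stored (m ''G'') p (concat (den_exps t))" "p + pole_order t * n \<le> length entries"
    and todd: "partial_todd t p j m"
  shows "wp K B denominator_com (\<lambda>(m', _, _). partial_todd t p (Suc j) m') (m, inp, out)"
proof -
  have beta: "betas t ! j = lam_form (den_exps t ! j)" using t(2) by (simp add: betas_def)
  have take: "take (Suc j) (betas t) = take j (betas t) @ [betas t ! j]"
    using t(2) by (simp add: take_Suc_conv_app_nth)
  have "Suc j * n \<le> pole_order t * n" using t(2) by (intro mult_le_mono1) simp
  then have "wp K B (dot_com ''be'')
      (\<lambda>(m', _, _). m' ''be'' 0 = betas t ! j \<and> m' ''pos'' 0 = int (p + j * n + n)) (m, inp, out)"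
    unfolding beta using t m stored_den_exp[OF t G(1)] G(2) todd
    by (intro wp_lam_form[of t]) (auto simp: partial_todd_def)
  then show ?thesis unfolding denominator_com_def
  proof (rule wp_seqI)
    fix m' and inp' out' :: "int list"
    assume m': "m' ''be'' 0 = betas t ! j \<and> m' ''pos'' 0 = int (p + j * n + n)"
      and frame: "\<And>x. x \<notin> modifies (dot_com ''be'') \<Longrightarrow> m' x = m x"
    let ?m = "m'\<langle>''den'' := neg_prod (take (Suc j) (betas t))\<rangle>"
    have "wp K B div_todd_com (\<lambda>(m'', _, _). \<forall>k\<le>pole_order t.
        m'' ''R'' (int k) = int_todd_series (take (Suc j) (betas t)) k) (?m, inp', out')"
      using t m' frame m(2) todd by (intro wp_div_beta) (auto simp: partial_todd_def)
    then have "wp K B div_todd_com (\<lambda>(m'', _, _). partial_todd t p (Suc j) m'') (?m, inp', out')"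
      by (rule wp_frameI) (use m' in \<open>auto simp: partial_todd_def\<close>)
    moreover have "bit_size (neg_prod (take (Suc j) (betas t))) \<le> B"
      using bit_size_partial_beta_prod[OF t(1), of "Suc j"] by (intro le_B) linarith
    ultimately show "wp K B (''den'' ::= Var ''den'' [*] (Const 0 [-] Var ''be'') ;; div_todd_com)
        (\<lambda>(m'', _, _). partial_todd t p (Suc j) m'') (m', inp', out')"
      using m' frame[of "''den''"] todd by (simp add: take neg_prod_snoc partial_todd_def)
  qed
qed

lemma wp_todd:
  assumes t: "t \<in> set ts" and m: "scanned m" "m ''s'' 0 = int (pole_order t)" "m ''pos'' 0 = int p"
    and G: "stored (m ''G'') p (concat (den_exps t))" "p + pole_order t * n \<le> length entries"
  shows "wp K B todd_com (\<lambda>(m', _, _). partial_todd t p (pole_order t) m') (m, inp, out)"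
proof -
  let ?s = "pole_order t"
  let ?clear = "For ''k'' (Var ''s'' [+] Const 1) (Assign ''R'' (Var ''k'') (Const 0))"
  let ?divide = "For ''j'' (Var ''s'') denominator_com"
  let ?zero = "\<lambda>k (m' :: mem). \<forall>i<k. m' ''R'' (int i) = 0"
  have s: "Suc ?s \<le> K" using pole_order_less_K[OF t] by simp
  have "wp K B ?clear (\<lambda>(m', _, _). ?zero (Suc ?s) m') (m, inp, out)"
    by (rule wp_For[where I = "\<lambda>k m' _ _. ?zero k m'" and N = "Suc ?s"])
      (use m s two_le_B in \<open>auto simp: less_Suc_eq\<close>)
  then show ?thesis unfolding todd_com_def
  proof (rule wp_seqI)
    fix m' and inp' out' :: "int list"
    assume "?zero (Suc ?s) m'" and frame: "\<And>x. x \<notin> modifies ?clear \<Longrightarrow> m' x = m x"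
    then have R: "m' ''R'' (int i) = 0" if "i \<le> ?s" for i using that by simp
    let ?m = "m'\<langle>''R'' := 1\<rangle>\<langle>''den'' := 1\<rangle>"
    have "wp K B ?divide (\<lambda>(m', _, _). partial_todd t p ?s m') (?m, inp', out')"
    proof (rule wp_For[where I = "\<lambda>j m' _ _. partial_todd t p j m'"])
      show "partial_todd t p 0 ?m"
        using m frame R by (simp add: partial_todd_def int_todd_series_Nil neg_prod_Nil)
      fix j m'' and inp'' out'' :: "int list"
      assume "j < ?s" "partial_todd t p j m''"
        and "\<And>y. y \<notin> insert ''j'' (modifies denominator_com) \<Longrightarrow> m'' y = ?m y"
      then show "wp K B denominator_com (\<lambda>(m', _, _). partial_todd t p (Suc j) m')
          (m'', inp'', out'')"
        using t m G frame by (intro wp_denominator) (auto simp: scanned_def)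
    qed (use m s frame in \<open>auto simp: partial_todd_def\<close>)
    then show "wp K B (Assign ''R'' (Const 0) (Const 1) ;; ''den'' ::= Const 1 ;; ?divide)
        (\<lambda>(m', _, _). partial_todd t p ?s m') (m', inp', out')"
      using two_le_B by simp
  qed
qed

lemma scanned_summand:
  assumes "scanned m" "i < length ts"
  shows "m ''G'' (int (offset i)) = coeff_num (ts ! i)"
    and "m ''G'' (int (offset i) + 1) = coeff_den (ts ! i)"
    and "m ''G'' (int (offset i) + 2) = int (pole_order (ts ! i))"
    and "stored (m ''G'') (offset i + 3) (num_exp (ts ! i))"
    and "stored (m ''G'') (offset i + 3 + n) (concat (den_exps (ts ! i)))"
proof -
  let ?head = "[coeff_num (ts ! i), coeff_den (ts ! i), int (pole_order (ts ! i))]"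
  have "stored (m ''G'') (offset i) (enc_summand (ts ! i))"
    using assms(1) entries_split[OF assms(2)] by (auto simp: scanned_def stored_append offset_def)
  then have "stored (m ''G'') (offset i) ?head"
    and "stored (m ''G'') (offset i + 3) (num_exp (ts ! i))"
    and "stored (m ''G'') (offset i + 3 + n) (concat (den_exps (ts ! i)))"
    using assms(2) length_num_exp[of "ts ! i"] unfolding enc_summand_def
    by (simp_all add: stored_append numeral_3_eq_3 del: append_Cons)
  then show "m ''G'' (int (offset i)) = coeff_num (ts ! i)"
    and "m ''G'' (int (offset i) + 1) = coeff_den (ts ! i)"
    and "m ''G'' (int (offset i) + 2) = int (pole_order (ts ! i))"
    and "stored (m ''G'') (offset i + 3) (num_exp (ts ! i))"
    and "stored (m ''G'') (offset i + 3 + n) (concat (den_exps (ts ! i)))"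
    using stored_nth[of "m ''G''" "offset i" ?head 0] stored_nth[of "m ''G''" "offset i" ?head 1]
      stored_nth[of "m ''G''" "offset i" ?head 2] by simp_all
qed

lemma wp_prepare:
  assumes i: "i < length ts" and m: "scanned m" "m ''pos'' 0 = int (offset i)"
  shows "wp K B prepare_com
    (\<lambda>(m', _, _). prepared (ts ! i) m' \<and> m' ''pos'' 0 = int (offset (Suc i))) (m, inp, out)"
proof -
  let ?t = "ts ! i" and ?p = "offset i + 3"
  let ?m = "m\<langle>''p'' := coeff_num ?t\<rangle>\<langle>''q'' := coeff_den ?t\<rangle>
    \<langle>''s'' := int (pole_order ?t)\<rangle>\<langle>''pos'' := int ?p\<rangle>"
  let ?Q = "\<lambda>(m', _, _). prepared ?t m' \<and> m' ''pos'' 0 = int (offset (Suc i))"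
  have t: "?t \<in> set ts" using i by simp
  note G = scanned_summand[OF m(1) i]
  have end_pos: "offset (Suc i) = ?p + n + pole_order ?t * n"
    using offset_Suc[OF i] length_enc_summand[OF t] by simp
  then have in_range: "?p + n + pole_order ?t * n \<le> length entries"
    using offset_le[OF i] offset_Suc[OF i] by simp
  have "wp K B (dot_com ''al'')
      (\<lambda>(m', _, _). m' ''al'' 0 = alpha ?t \<and> m' ''pos'' 0 = int (?p + n)) (?m, inp, out)"
    unfolding alpha_def using t m(1) G(4) in_range
    by (intro wp_lam_form[of ?t]) (auto simp: scanned_def)
  then have "wp K B (dot_com ''al'' ;; todd_com) ?Q (?m, inp, out)"
  proof (rule wp_seqI)
    fix m' and inp' out' :: "int list"
    assume al: "m' ''al'' 0 = alpha ?t \<and> m' ''pos'' 0 = int (?p + n)"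
      and frame: "\<And>x. x \<notin> modifies (dot_com ''al'') \<Longrightarrow> m' x = ?m x"
    then have "wp K B todd_com
        (\<lambda>(m'', _, _). partial_todd ?t (?p + n) (pole_order ?t) m'') (m', inp', out')"
      using t m(1) G(5) in_range by (intro wp_todd) (auto simp: scanned_def)
    then show "wp K B todd_com ?Q (m', inp', out')"
      by (rule wp_frameI)
        (use al frame in \<open>auto simp: partial_todd_def prepared_def todd_def beta_prod_def end_pos\<close>)
  qed
  moreover have "bit_size (coeff_num ?t) \<le> B" "bit_size (coeff_den ?t) \<le> B"
    using bit_size_coeff[OF t] by (auto intro: le_B_linear)
  moreover have "bit_size (int (pole_order ?t)) \<le> B" "bit_size (int ?p) \<le> B"
    using in_range K_ge(1) pole_order_less_K[OF t] by (simp_all only: bit_size_small_nat)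
  ultimately show ?thesis using m(2) G(1-3) by (simp add: prepare_com_def)
qed

lemma wp_for_summands:
  fixes I :: "nat \<Rightarrow> mem \<Rightarrow> int list \<Rightarrow> bool"
  assumes m: "scanned m" "m ''pos'' 0 = 0" and init: "I 0 m out"
    and disjoint: "modifies c \<inter> {''n'', ''N'', ''G'', ''X'', ''Phi'', ''pos'', ''i''} = {}"
    and indep: "\<And>i m m' out. I i m out \<Longrightarrow>
        (\<And>y. y \<notin> insert ''i'' (modifies prepare_com) \<Longrightarrow> m' y = m y) \<Longrightarrow>
      I i m' out"
    and body: "\<And>i m inp out. i < length ts \<Longrightarrow> prepared (ts ! i) m \<Longrightarrow> I i m out \<Longrightarrow>
      wp K B c (\<lambda>(m', _, out'). I (Suc i) m' out') (m, inp, out)"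
  shows "wp K B (For ''i'' (Var ''N'') (prepare_com ;; c)) (\<lambda>(m', _, out'). I (length ts) m' out')
      (m, inp, out)"
proof -
  let ?J = "\<lambda>i m out. I i m out \<and> m ''pos'' 0 = int (offset i)"
  have "wp K B (For ''i'' (Var ''N'') (prepare_com ;; c)) (\<lambda>(m', _, out'). ?J (length ts) m' out')
      (m, inp, out)"
  proof (rule wp_For[where I = "\<lambda>i m' _ out'. ?J i m' out'"])
    fix i m' out' and inp' :: "int list"
    assume i: "i < length ts" and J: "?J i m' out'"
      and "\<And>y. y \<notin> insert ''i'' (modifies (prepare_com ;; c)) \<Longrightarrow> m' y = m y"
    then have "scanned m'" using m(1) disjoint by (auto simp: scanned_def)
    then have "wp K B prepare_com
        (\<lambda>(m', _, _). prepared (ts ! i) m' \<and> m' ''pos'' 0 = int (offset (Suc i)))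
        (m', inp', out')"
      using i J by (intro wp_prepare) auto
    then show "wp K B (prepare_com ;; c) (\<lambda>(m', _, out'). ?J (Suc i) m' out') (m', inp', out')"
    proof (rule wp_seqI)
      fix m'' out'' and inp'' :: "int list"
      assume prep: "prepared (ts ! i) m'' \<and> m'' ''pos'' 0 = int (offset (Suc i))"
        and frame: "\<And>x. x \<notin> modifies prepare_com \<Longrightarrow> m'' x = m' x"
        and "silent prepare_com \<Longrightarrow> out'' = out'"
      then have "I i m'' out''" using J indep[of i m' out' m''] by auto
      with i prep have "wp K B c (\<lambda>(m', _, out'). I (Suc i) m' out') (m'', inp'', out'')"
        by (intro body) auto
      then show "wp K B c (\<lambda>(m', _, out'). ?J (Suc i) m' out') (m'', inp'', out'')"
        by (rule wp_frameI) (use prep disjoint in auto)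
    qed
  next
    show "?J k (m(''i'' := f)) out" if "?J k m out" for k m f and inp :: "int list" and out
      using that indep[of k m out "m(''i'' := f)"] by auto
  qed (use m init disjoint length_ts_le K_ge(1) in \<open>auto simp: scanned_def\<close>)
  then show ?thesis by (rule wp_frameI) auto
qed

definition lambda_out :: "nat \<Rightarrow> int list" where
  "lambda_out k = concat (map (\<lambda>l. [\<Phi> * X ^ l, 1]) [0..<k])"

text \<open>Numerators and denominators are multiplied by the denominator, because the encoding of rationals
  requires positive denominators.\<close>

definition weights_out :: "summand \<Rightarrow> nat \<Rightarrow> int list" where
  "weights_out t k = concat (map (\<lambda>l. [todd t (pole_order t - l) * (fact l * beta_prod t),
     (fact l * beta_prod t) * (fact l * beta_prod t)]) [0..<k])"

definition value_total :: "int \<times> int" where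
  "value_total = sum_fracs (map value_frac ts)"

definition value_out :: "int list" where
  "value_out = [fst value_total * snd value_total, snd value_total * snd value_total]"

lemma partial_value_Suc:
  "partial_value t (Suc l) =
    partial_value t l + todd t (pole_order t - l) * (alpha t ^ l div fact l)"
  by (simp add: partial_value_def)

lemma prepared_todd:
  "prepared t m \<Longrightarrow> l \<le> pole_order t \<Longrightarrow>
    m ''R'' (int (pole_order t) - int l) = todd t (pole_order t - l)"
  by (simp add: prepared_def flip: of_nat_diff)

lemma bit_size_fact_step:
  "t \<in> set ts \<Longrightarrow> l \<le> pole_order t \<Longrightarrow> bit_size (fact l * (int l + 1)) \<le> B"
  using bit_size_fact_less[of "Suc l"] pole_order_less_K[of t]
  by (intro le_B_square) (simp add: algebra_simps)

lemma wp_add_terms: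
  assumes t: "t \<in> set ts" and m: "prepared t m" "m ''v'' 0 = 0" "m ''ap'' 0 = 1" "m ''lf'' 0 = 1"
  shows "wp K B (For ''o'' (Var ''s'' [+] Const 1) add_term_com)
    (\<lambda>(m', _, _). m' ''v'' 0 = partial_value t (Suc (pole_order t))) (m, inp, out)"
proof -
  let ?I = "\<lambda>l (m' :: mem). m' ''v'' 0 = partial_value t l \<and> m' ''ap'' 0 = alpha t ^ l \<and>
    m' ''lf'' 0 = fact l"
  have "wp K B (For ''o'' (Var ''s'' [+] Const 1) add_term_com)
      (\<lambda>(m', _, _). ?I (Suc (pole_order t)) m') (m, inp, out)"
  proof (rule wp_For[where I = "\<lambda>l m' _ _. ?I l m'"])
    fix l m' and inp' out' :: "int list"
    assume l: "l < Suc (pole_order t)" "m' ''o'' 0 = int l" and I: "?I l m'"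
      and frame: "\<And>y. y \<notin> insert ''o'' (modifies add_term_com) \<Longrightarrow> m' y = m y"
    have m': "m' ''R'' (int (pole_order t) - int l) = todd t (pole_order t - l)"
      "m' ''s'' 0 = int (pole_order t)" "m' ''al'' 0 = alpha t"
      using prepared_todd[OF m(1), of l] m(1) frame l(1) by (simp_all add: prepared_def)
    have "bit_size (partial_value t (Suc l)) \<le> B"
      using bit_size_partial_value[OF t, of "Suc l"] l(1) by (intro le_B) linarith
    moreover have "bit_size (alpha t ^ Suc l) \<le> B"
      using bit_size_power_less_K[OF bit_size_alpha[OF t], of "Suc l"] pole_order_less_K[OF t] l(1)
      by (intro le_B) linarith
    ultimately show "wp K B add_term_com (\<lambda>(m', _, _). ?I (Suc l) m') (m', inp', out')"
      using I l m' bit_size_fact_step[OF t, of l]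
      by (simp add: add_term_com_def partial_value_Suc ac_simps)
  qed (use m pole_order_less_K[OF t] in \<open>auto simp: prepared_def partial_value_def\<close>)
  then show ?thesis by (rule wp_frameI) auto
qed

lemma wp_add_summand:
  assumes i: "i < length ts" and m: "prepared (ts ! i) m"
    and acc: "sum_fracs (map value_frac (take i ts)) = (m ''RP'' 0, m ''RQ'' 0)"
  shows "wp K B add_summand_com
    (\<lambda>(m', _, _). sum_fracs (map value_frac (take (Suc i) ts)) = (m' ''RP'' 0, m' ''RQ'' 0))
    (m, inp, out)"
proof -
  let ?t = "ts ! i"
  let ?m = "m\<langle>''v'' := 0\<rangle>\<langle>''ap'' := 1\<rangle>\<langle>''lf'' := 1\<rangle>"
  let ?loop = "For ''o'' (Var ''s'' [+] Const 1) add_term_com"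
  let ?Q = "\<lambda>(m', _, _).
    sum_fracs (map value_frac (take (Suc i) ts)) = (m' ''RP'' 0, m' ''RQ'' 0)"
  have t: "?t \<in> set ts" using i by simp
  have sum: "sum_fracs (map value_frac (take (Suc i) ts)) =
      add_frac (m ''RP'' 0, m ''RQ'' 0) (value_frac ?t)"
    using i by (simp add: take_Suc_conv_app_nth sum_fracs_snoc acc)
  have "wp K B ?loop (\<lambda>(m', _, _). m' ''v'' 0 = partial_value ?t (Suc (pole_order ?t)))
      (?m, inp, out)"
    using t m by (intro wp_add_terms) (auto simp: prepared_def)
  then have "wp K B (?loop ;; add_value_com) ?Q (?m, inp, out)"
  proof (rule wp_seqI)
    fix m' and inp' out' :: "int list"
    assume "m' ''v'' 0 = partial_value ?t (Suc (pole_order ?t))"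
      and "\<And>x. x \<notin> modifies ?loop \<Longrightarrow> m' x = ?m x"
    then show "wp K B add_value_com ?Q (m', inp', out')"
      using bit_size_sum_value_fracs[of "Suc i"] m
      by (simp add: add_value_com_def sum add_frac_def value_frac_def prepared_def)
  qed
  then show ?thesis using two_le_B by (simp add: add_summand_com_def)
qed

lemma wp_value: "wp K B value_com (\<lambda>(_, _, out). out = value_out) (\<lambda>_ _. 0, tape, [])"
  unfolding value_com_def
proof (rule wp_seqI[OF wp_scan_input])
  fix m and inp out :: "int list"
  assume m: "scanned m" and "silent scan_input_com \<Longrightarrow> out = []"
  then have out: "out = []" by simp
  let ?m = "m\<langle>''pos'' := 0\<rangle>\<langle>''RP'' := 0\<rangle>\<langle>''RQ'' := 1\<rangle>"
  let ?loop = "For ''i'' (Var ''N'') (prepare_com ;; add_summand_com)"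
  let ?write = "Write (Var ''RP'' [*] Var ''RQ'') ;; Write (Var ''RQ'' [*] Var ''RQ'')"
  let ?I = "\<lambda>i m. sum_fracs (map value_frac (take i ts)) = (m ''RP'' 0, m ''RQ'' 0)"
  have "wp K B ?loop (\<lambda>(m, _, _). ?I (length ts) m) (?m, inp, out)"
    using m by (intro wp_for_summands[where I = "\<lambda>i m _. ?I i m"] wp_add_summand)
      (auto simp: scanned_def sum_fracs_Nil)
  then have "wp K B (?loop ;; ?write) (\<lambda>(_, _, out). out = value_out) (?m, inp, out)"
    by (rule wp_seqI) (use out in \<open>simp add: value_out_def value_total_def\<close>)
  then show "wp K B
      (''pos'' ::= Const 0 ;; ''RP'' ::= Const 0 ;; ''RQ'' ::= Const 1 ;; ?loop ;; ?write)
      (\<lambda>(_, _, out). out = value_out) (m, inp, out)"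
    using two_le_B by simp
qed

lemma wp_write_lambda:
  assumes m: "scanned m"
  shows "wp K B write_lambda_com (\<lambda>(_, _, out'). out' = out @ lambda_out n) (m, inp, out)"
proof -
  let ?I = "\<lambda>l (m' :: mem) out'. m' ''pw'' 0 = \<Phi> * X ^ l \<and> out' = out @ lambda_out l"
  let ?m = "m\<langle>''pw'' := \<Phi>\<rangle>"
  let ?step = "Write (Var ''pw'') ;; Write (Const 1) ;; ''pw'' ::= Var ''pw'' [*] Var ''X''"
  have small: "bit_size (\<Phi> * X ^ l) \<le> B" if "l \<le> n" for l
    using bit_size_lambda[OF that] by (intro le_B_square) linarith
  have "wp K B (For ''l'' (Var ''n'') ?step) (\<lambda>(m', _, out'). ?I n m' out') (?m, inp, out)"
  proof (rule wp_For[where I = "\<lambda>l m' _ out'. ?I l m' out'"])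
    fix l m' out' and inp' :: "int list"
    assume "l < n" "?I l m' out'" and "\<And>y. y \<notin> insert ''l'' (modifies ?step) \<Longrightarrow> m' y = ?m y"
    then show "wp K B ?step (\<lambda>(m', _, out'). ?I (Suc l) m' out') (m', inp', out')"
      using m small[of "Suc l"] by (simp add: lambda_out_def scanned_def ac_simps)
  qed (use m K_ge(1) in \<open>auto simp: lambda_out_def scanned_def\<close>)
  then have "wp K B (For ''l'' (Var ''n'') ?step)
      (\<lambda>(_, _, out'). out' = out @ lambda_out n) (?m, inp, out)"
    by (rule wp_frameI) auto
  then show ?thesis using m small[of 0] by (simp add: write_lambda_com_def scanned_def)
qed

lemma wp_write_weights:
  assumes t: "t \<in> set ts" and m: "prepared t m"
  shows "wp K B write_weights_com
    (\<lambda>(_, _, out'). out' = out @ weights_out t (Suc (pole_order t))) (m, inp, out)"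
proof -
  let ?I = "\<lambda>l (m' :: mem) out'. m' ''lf'' 0 = fact l \<and> out' = out @ weights_out t l"
  let ?m = "m\<langle>''lf'' := 1\<rangle>"
  have "wp K B (For ''o'' (Var ''s'' [+] Const 1) write_weight_com)
      (\<lambda>(m', _, out'). ?I (Suc (pole_order t)) m' out') (?m, inp, out)"
  proof (rule wp_For[where I = "\<lambda>l m' _ out'. ?I l m' out'"])
    fix l m' out' and inp' :: "int list"
    assume l: "l < Suc (pole_order t)" "m' ''o'' 0 = int l" and I: "?I l m' out'"
      and frame: "\<And>y. y \<notin> insert ''o'' (modifies write_weight_com) \<Longrightarrow> m' y = ?m y"
    have m': "m' ''R'' (int (pole_order t) - int l) = todd t (pole_order t - l)"
      "m' ''s'' 0 = int (pole_order t)" "m' ''den'' 0 = beta_prod t"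
      using prepared_todd[OF m, of l] m frame l(1) by (simp_all add: prepared_def)
    have "bit_size (fact l * beta_prod t) \<le> B"
      using bit_size_mult[of "fact l" "beta_prod t"] bit_size_fact_less[of l]
        bit_size_beta_prod[OF t] pole_order_less_K[OF t] l(1) K_powers(3)
      by (intro le_B) linarith
    then show "wp K B write_weight_com (\<lambda>(m', _, out'). ?I (Suc l) m' out') (m', inp', out')"
      using I l m' bit_size_fact_step[OF t, of l]
      by (simp add: write_weight_com_def weights_out_def ac_simps)
  qed (use m pole_order_less_K[OF t] in \<open>auto simp: prepared_def weights_out_def\<close>)
  then have "wp K B (For ''o'' (Var ''s'' [+] Const 1) write_weight_com)
      (\<lambda>(_, _, out'). out' = out @ weights_out t (Suc (pole_order t))) (?m, inp, out)"
    by (rule wp_frameI) auto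
  then show ?thesis using two_le_B by (simp add: write_weights_com_def)
qed

lemma wp_weights:
  "wp K B weights_com
    (\<lambda>(_, _, out). out = lambda_out n @ concat (map (\<lambda>t. weights_out t (Suc (pole_order t))) ts))
    (\<lambda>_ _. 0, tape, [])"
  unfolding weights_com_def
proof (rule wp_seqI[OF wp_scan_input])
  fix m and inp out :: "int list"
  assume m: "scanned m" and "silent scan_input_com \<Longrightarrow> out = []"
  then have out: "out = []" by simp
  let ?w = "\<lambda>t. weights_out t (Suc (pole_order t))"
  let ?loop = "For ''i'' (Var ''N'') (prepare_com ;; write_weights_com)"
  let ?Q = "\<lambda>(_, _, out). out = lambda_out n @ concat (map ?w ts)"
  show "wp K B (write_lambda_com ;; ''pos'' ::= Const 0 ;; ?loop) ?Q (m, inp, out)"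
  proof (rule wp_seqI[OF wp_write_lambda[OF m]])
    fix m' and inp' out' :: "int list"
    assume out': "out' = out @ lambda_out n"
      and frame: "\<And>x. x \<notin> modifies write_lambda_com \<Longrightarrow> m' x = m x"
    let ?I = "\<lambda>i out. out = lambda_out n @ concat (map ?w (take i ts))"
    let ?m = "m'\<langle>''pos'' := 0\<rangle>"
    have "wp K B ?loop (\<lambda>(_, _, out). ?I (length ts) out) (?m, inp', out')"
    proof (rule wp_for_summands[where I = "\<lambda>i _ out. ?I i out"])
      fix i m and inp out :: "int list"
      assume i: "i < length ts" and "prepared (ts ! i) m" and I: "?I i out"
      then have "wp K B write_weights_com (\<lambda>(_, _, out'). out' = out @ ?w (ts ! i)) (m, inp, out)"
        by (intro wp_write_weights) auto
      then show "wp K B write_weights_com (\<lambda>(_, _, out). ?I (Suc i) out) (m, inp, out)"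
        by (rule wp_frameI) (use i I in \<open>simp add: take_Suc_conv_app_nth\<close>)
    qed (use m frame out out' in \<open>auto simp: scanned_def\<close>)
    then show "wp K B (''pos'' ::= Const 0 ;; ?loop) ?Q (m', inp', out')" using two_le_B by simp
  qed
qed

lemma fact_dvd_lam_form: "t \<in> set ts \<Longrightarrow> fact (Suc (pole_order t)) dvd lam_form v"
  using pole_order_le[of t] length_enc_summand_le[of t] unfolding lam_form_def
  by (intro dvd_trans[OF _ dvd_moment_form]) (simp add: \<Phi>_def fact_dvd del: fact_Suc)

lemma lam_form_nonzero:
  assumes "t \<in> set ts" "v \<in> set (den_exps t)" "\<exists>a\<in>set v. a \<noteq> 0"
  shows "lam_form v \<noteq> 0"
  unfolding lam_form_def
proof (rule moment_form_nonzero)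
  fix a assume "a \<in> set v"
  then have "a \<in> set entries"
    using assms(2) set_enc_summand[OF assms(1)] by (auto simp: enc_summand_def)
  then show "\<bar>a\<bar> < X" unfolding X_def by (rule abs_less_square_bound)
qed (use assms(3) in \<open>auto simp: \<Phi>_def\<close>)

lemma weight_betas:
  assumes "t \<in> set ts"
  shows "weight (map of_int (betas t)) l =
    of_int (todd t (pole_order t - l)) / of_int (fact l * beta_prod t)"
  using weight_of_int[of "betas t" l] fact_dvd_lam_form[OF assms]
  by (auto simp: betas_def todd_def beta_prod_def)

lemma value_frac_eq:
  assumes "t \<in> set ts"
  shows "of_int (fst (value_frac t)) / of_int (snd (value_frac t)) =
    of_int (coeff_num t) / of_int (coeff_den t) *
      (\<Sum>l=0..pole_order t. weight (map of_int (betas t)) l * of_int (alpha t) ^ l)"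
proof -
  have "(\<Sum>l=0..pole_order t. weight (map of_int (betas t)) l * of_int (alpha t) ^ l) =
      of_int (partial_value t (Suc (pole_order t))) / of_int (beta_prod t)"
    using weighted_powers_of_int[of "betas t" "alpha t"] fact_dvd_lam_form[OF assms]
    by (auto simp: alpha_def betas_def partial_value_def todd_def beta_prod_def)
  then show ?thesis by (simp add: value_frac_def)
qed

end

section \<open>Polynomial time\<close>

lemma codes_rats_append:
  assumes "codes_rats rs ys" "codes_rats rs' ys'"
  shows "codes_rats (rs @ rs') (ys @ ys')"
proof -
  obtain ps where "\<forall>(p, q)\<in>set ps. q > 0" "rs = map (\<lambda>(p, q). of_int p / of_int q) ps"
    "ys = concat (map (\<lambda>(p, q). [p, q]) ps)"
    using assms(1) unfolding codes_rats_def by blast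
  moreover obtain ps' where "\<forall>(p, q)\<in>set ps'. q > 0" "rs' = map (\<lambda>(p, q). of_int p / of_int q) ps'"
    "ys' = concat (map (\<lambda>(p, q). [p, q]) ps')"
    using assms(2) unfolding codes_rats_def by blast
  ultimately show ?thesis unfolding codes_rats_def by (intro exI[of _ "ps @ ps'"]) auto
qed

lemma codes_rats_map:
  assumes "\<And>x. x \<in> set xs \<Longrightarrow> q x > 0" "\<And>x. x \<in> set xs \<Longrightarrow> f x = of_int (p x) / of_int (q x)"
  shows "codes_rats (map f xs) (concat (map (\<lambda>x. [p x, q x]) xs))"
  unfolding codes_rats_def using assms
  by (intro exI[of _ "map (\<lambda>x. (p x, q x)) xs"]) (auto simp: comp_def)

lemma codes_rats_concat:
  "(\<And>x. x \<in> set xs \<Longrightarrow> codes_rats (f x) (g x)) \<Longrightarrow>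
    codes_rats (concat (map f xs)) (concat (map g xs))"
  by (induction xs) (use codes_rats_map[of "[]"] in \<open>auto intro: codes_rats_append\<close>)

definition summand_of :: "nat \<Rightarrow> rat \<times> (nat \<Rightarrow>\<^sub>0 int) \<times> (nat \<Rightarrow>\<^sub>0 int) list \<Rightarrow> summand" where
  "summand_of n = (\<lambda>(\<epsilon>, a, bs). Summand (fst (quotient_of \<epsilon>)) (snd (quotient_of \<epsilon>))
     (enc_vec n a) (map (enc_vec n) bs))"

definition summands :: "gf_data \<Rightarrow> summand list" where
  "summands D = map (summand_of (gf_dim D)) (gf_terms D)"

lemma length_summands [simp]: "length (summands D) = length (gf_terms D)"
  by (simp add: summands_def)

lemma summands_sel:
  assumes "i \<in> gf_index D"
  shows "coeff_num (summands D ! i) = fst (quotient_of (gf_coeff D i))"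
    and "coeff_den (summands D ! i) = snd (quotient_of (gf_coeff D i))"
    and "num_exp (summands D ! i) = enc_vec (gf_dim D) (gf_num D i)"
    and "den_exps (summands D ! i) = map (enc_vec (gf_dim D)) (gf_dens D i)"
  using assms by (simp_all add: summands_def summand_of_def gf_index_def gf_coeff_def gf_num_def
      gf_dens_def split: prod.splits)

lemma in_set_summandsE:
  assumes "t \<in> set (summands D)"
  obtains i where "i \<in> gf_index D" "t = summands D ! i"
  using assms by (auto simp: in_set_conv_nth gf_index_def)

lemma enc_vec_nonzero:
  fixes x :: "nat \<Rightarrow>\<^sub>0 'a::zero"
  assumes "x \<in> vecs n" "x \<noteq> 0"
  shows "\<exists>a\<in>set (enc_vec n x). a \<noteq> 0"
proof -
  obtain l where "Poly_Mapping.lookup x l \<noteq> 0"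
    using assms(2) by (metis lookup_zero poly_mapping_eqI)
  moreover from this have "l < n" using assms(1) by (auto simp: in_vecs_iff not_le[symmetric])
  ultimately show ?thesis by (auto simp: enc_vec_def)
qed

locale gf_instance =
  fixes D :: gf_data
  assumes valid: "valid_gf D"
begin

abbreviation "n \<equiv> gf_dim D"

lemma gf_dens_valid:
  "i \<in> gf_index D \<Longrightarrow> b \<in> set (gf_dens D i) \<Longrightarrow> b \<in> vecs n \<and> b \<noteq> 0"
  using valid unfolding valid_gf_def gf_len_eq gf_den_eq by (metis in_set_conv_nth)

sublocale gf_tape n "summands D"
proof
  fix t assume "t \<in> set (summands D)"
  then obtain i where i: "i \<in> gf_index D" "t = summands D ! i" by (rule in_set_summandsE)
  show "length (num_exp t) = n" by (simp add: i summands_sel enc_vec_def)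
  show "length v = n" if "v \<in> set (den_exps t)" for v
    using that by (auto simp: i summands_sel enc_vec_def)
  show "den_exps t = []" if "n = 0"
    using gf_dens_valid[OF i(1)] that by (cases "gf_dens D i") (auto simp: i summands_sel vecs_def)
qed

lemma summands_nth_mem: "i \<in> gf_index D \<Longrightarrow> summands D ! i \<in> set (summands D)"
  by (simp add: gf_index_def)

lemma tape_eq: "tape = enc_gf D"
  unfolding tape_def entries_def
  by (auto simp: enc_gf_def summands_def summand_of_def enc_summand_def comp_def
      intro!: arg_cong[where f = concat] map_cong)

definition lam :: "nat \<Rightarrow>\<^sub>0 rat" where
  "lam = (\<Sum>l<n. Poly_Mapping.single l (of_int (\<Phi> * X ^ l)))"

lemma lookup_lam: "Poly_Mapping.lookup lam l = (if l < n then of_int (\<Phi> * X ^ l) else 0)"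
  by (simp add: lam_def lookup_sum lookup_single when_def)

lemma lam_in_vecs: "lam \<in> vecs n"
  by (simp add: in_vecs_iff lookup_lam)

lemma dot_lam: "dot n lam a = of_int (lam_form (enc_vec n a))"
  by (simp add: dot_def lam_form_def moment_form_def enc_vec_def lookup_lam mult.commute)

lemma alpha_eq: "i \<in> gf_index D \<Longrightarrow> of_int (alpha (summands D ! i)) = dot n lam (gf_num D i)"
  by (simp add: alpha_def summands_sel dot_lam)

lemma betas_eq: "i \<in> gf_index D \<Longrightarrow>
    map of_int (betas (summands D ! i)) = map (dot n lam) (gf_dens D i)"
  by (simp add: betas_def summands_sel dot_lam)

lemma generic_lam: "generic_for lam D"
  unfolding generic_for_iff
proof
  fix i assume i: "i \<in> gf_index D"
  have "dot n lam b \<noteq> 0" if "b \<in> set (gf_dens D i)" for b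
    using lam_form_nonzero[OF summands_nth_mem[OF i], of "enc_vec n b"]
      gf_dens_valid[OF i that] that
    by (simp add: dot_lam summands_sel[OF i] enc_vec_nonzero)
  then show "0 \<notin> set (map (dot n lam) (gf_dens D i))" by force
qed

lemma beta_prod_nonzero: "i \<in> gf_index D \<Longrightarrow> beta_prod (summands D ! i) \<noteq> 0"
proof -
  assume i: "i \<in> gf_index D"
  have "0 \<notin> set (map (of_int :: int \<Rightarrow> rat) (betas (summands D ! i)))"
    using generic_lam i unfolding betas_eq[OF i] generic_for_iff by blast
  then show ?thesis by (force simp: beta_prod_def neg_prod_def prod_list_zero_iff)
qed

lemma gf_weight_lam:
  assumes "i \<in> gf_index D"
  shows "gf_weight D lam i l = of_int (todd (summands D ! i) (gf_len D i - l)) /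
    of_int (fact l * beta_prod (summands D ! i))"
  using weight_betas[OF summands_nth_mem[OF assms], of l]
  by (simp add: gf_weight_def betas_eq[OF assms] summands_sel[OF assms] gf_len_eq)

lemma value_total_eq:
  "snd value_total \<noteq> 0 \<and>
    of_int (fst value_total) / of_int (snd value_total) =
      weighted_sum D lam (gf_weight D lam) (gf_num D)"
proof -
  have frac: "snd (value_frac (summands D ! i)) \<noteq> 0 \<and>
      of_int (fst (value_frac (summands D ! i))) / of_int (snd (value_frac (summands D ! i))) =
      gf_coeff D i * (\<Sum>l=0..gf_len D i. gf_weight D lam i l * dot n lam (gf_num D i) ^ l)"
    if i: "i \<in> gf_index D" for i
  proof -
    obtain p q where coeff: "quotient_of (gf_coeff D i) = (p, q)" by fastforce
    then have "q > 0" "gf_coeff D i = of_int p / of_int q"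
      by (rule quotient_of_denom_pos, rule quotient_of_div)
    then show ?thesis
      using value_frac_eq[OF summands_nth_mem[OF i]] beta_prod_nonzero[OF i] coeff
      by (simp add: alpha_eq betas_eq i summands_sel gf_weight_def gf_len_eq value_frac_def)
  qed
  have "(\<Sum>(a, b)\<leftarrow>map value_frac (summands D). of_int a / of_int b) =
      weighted_sum D lam (gf_weight D lam) (gf_num D)"
    unfolding weighted_sum_def sum_list_sum_nth
    using frac by (intro sum.cong) (auto simp: gf_index_def case_prod_beta)
  moreover have "b \<noteq> 0" if "(a, b) \<in> set (map value_frac (summands D))" for a b
    using that frac by (auto elim!: in_set_summandsE) (metis snd_conv)
  ultimately show ?thesis
    using sum_fracs_correct[of "map value_frac (summands D)"] unfolding value_total_def by metis
qed

lemma codes_rats_value: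
  assumes "specializes_to (rat_fun D (gf_num D)) r"
  shows "codes_rats [r] value_out"
proof -
  have "r = of_int (fst value_total) / of_int (snd value_total)"
    using specialization_eq[OF generic_lam assms] value_total_eq by simp
  moreover have "snd value_total \<noteq> 0" using value_total_eq by simp
  moreover from this have "0 < snd value_total * snd value_total"
    by (simp add: zero_less_mult_iff) linarith
  ultimately show ?thesis
    using codes_rats_map[of "[()]" "\<lambda>_. snd value_total * snd value_total" "\<lambda>_. r"
      "\<lambda>_. fst value_total * snd value_total"]
    by (simp add: value_out_def)
qed

lemma codes_rats_weights_out:
  assumes i: "i \<in> gf_index D"
  shows "codes_rats (map (gf_weight D lam i) [0..<Suc (gf_len D i)])
    (weights_out (summands D ! i) (Suc (gf_len D i)))"
  unfolding weights_out_def
proof (rule codes_rats_map)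
  fix l
  let ?d = "fact l * beta_prod (summands D ! i)"
  have "?d \<noteq> 0" using beta_prod_nonzero[OF i] by simp
  then show "0 < ?d * ?d"
    by (metis not_square_less_zero linorder_neqE_linordered_idom mult_eq_0_iff)
  show "gf_weight D lam i l =
      of_int (todd (summands D ! i) (pole_order (summands D ! i) - l) * ?d) / of_int (?d * ?d)"
    using beta_prod_nonzero[OF i] by (simp add: gf_weight_lam i summands_sel gf_len_eq)
qed

lemma codes_rats_weights:
  "codes_rats (enc_vec n lam @ concat (weight_lists D lam))
    (lambda_out n @ concat (map (\<lambda>t. weights_out t (Suc (pole_order t))) (summands D)))"
proof (rule codes_rats_append)
  show "codes_rats (enc_vec n lam) (lambda_out n)"
    unfolding enc_vec_def lambda_out_def by (rule codes_rats_map) (auto simp: lookup_lam)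
  have "map (\<lambda>t. weights_out t (Suc (pole_order t))) (summands D) =
      map (\<lambda>i. weights_out (summands D ! i) (Suc (gf_len D i))) [0..<length (gf_terms D)]"
    by (rule nth_equalityI) (auto simp: summands_sel gf_index_def gf_len_eq simp del: upt_Suc)
  then show "codes_rats (concat (weight_lists D lam))
      (concat (map (\<lambda>t. weights_out t (Suc (pole_order t))) (summands D)))"
    unfolding weight_lists_def
    by (simp only:) (intro codes_rats_concat codes_rats_weights_out, simp add: gf_index_def)
qed

lemma K_poly: "K = poly [:2, 1:] (tape_size (enc_gf D))"
  and B_poly: "B = poly (smult 12 ([:2, 1:] ^ 4)) (tape_size (enc_gf D))"
  by (simp_all add: K_def B_def tape_eq poly_power add.commute)

end

theorem polytime_value_com:
  "polytime_algorithm value_com enc_gf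
    (\<lambda>D. valid_gf D \<and> (\<exists>r. specializes_to (rat_fun D (gf_num D)) r))
    (\<lambda>D ys. \<exists>r. specializes_to (rat_fun D (gf_num D)) r \<and> codes_rats [r] ys)"
proof (rule polytime_algorithmI[where k = "[:2, 1:]" and b = "smult 12 ([:2, 1:] ^ 4)"])
  fix D assume D: "valid_gf D \<and> (\<exists>r. specializes_to (rat_fun D (gf_num D)) r)"
  then interpret gf_instance D by unfold_locales simp
  show "wp (poly [:2, 1:] (tape_size (enc_gf D)))
      (poly (smult 12 ([:2, 1:] ^ 4)) (tape_size (enc_gf D)))
      value_com (\<lambda>(_, _, ys). \<exists>r. specializes_to (rat_fun D (gf_num D)) r \<and> codes_rats [r] ys)
      (\<lambda>_ _. 0, enc_gf D, [])"
    unfolding K_poly[symmetric] B_poly[symmetric] unfolding tape_eq[symmetric]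
    by (rule wp_frameI[OF wp_value]) (use D codes_rats_value in auto)
qed simp

theorem polytime_weights_com:
  "polytime_algorithm weights_com enc_gf
    (\<lambda>D. valid_gf D \<and> (\<exists>P. polytope_in (gf_dim D) P \<and> represents D P))
    (\<lambda>D ys. \<exists>lam w. codes_rats (enc_vec (gf_dim D) lam @ concat w) ys \<and> counting_weights D lam w)"
proof (rule polytime_algorithmI[where k = "[:2, 1:]" and b = "smult 12 ([:2, 1:] ^ 4)"])
  fix D assume "valid_gf D \<and> (\<exists>P. polytope_in (gf_dim D) P \<and> represents D P)"
  then interpret gf_instance D by unfold_locales simp
  show "wp (poly [:2, 1:] (tape_size (enc_gf D)))
      (poly (smult 12 ([:2, 1:] ^ 4)) (tape_size (enc_gf D)))
      weights_com (\<lambda>(_, _, ys). \<exists>lam w. codes_rats (enc_vec (gf_dim D) lam @ concat w) ys \<and>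
        counting_weights D lam w) (\<lambda>_ _. 0, enc_gf D, [])"
    unfolding K_poly[symmetric] B_poly[symmetric] unfolding tape_eq[symmetric]
    by (rule wp_frameI[OF wp_weights])
      (use codes_rats_weights counting_weights_weight_lists[OF lam_in_vecs generic_lam] in auto)
qed simp

theorem theorem2p22:
  shows
    "(\<exists>c. polytime_algorithm c enc_gf
        (\<lambda>D. valid_gf D \<and> (\<exists>r. specializes_to (rat_fun D (gf_num D)) r))
        (\<lambda>D ys. \<exists>r. specializes_to (rat_fun D (gf_num D)) r \<and> codes_rats [r] ys)) \<and>
     (\<exists>c. polytime_algorithm c enc_gf
        (\<lambda>D. valid_gf D \<and> (\<exists>P. polytope_in (gf_dim D) P \<and> represents D P))
        (\<lambda>D ys. \<exists>(lam :: nat \<Rightarrow>\<^sub>0 rat) (w :: rat list list).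
           codes_rats (enc_vec (gf_dim D) lam @ concat w) ys \<and>
           lam \<in> vecs (gf_dim D) \<and>
           (\<forall>i\<in>gf_index D. \<forall>j<gf_len D i. dot (gf_dim D) lam (gf_den D i j) \<noteq> 0) \<and>
           length w = length (gf_terms D) \<and>
           (\<forall>i\<in>gf_index D. length (w ! i) = gf_len D i + 1) \<and>
           (\<forall>P. polytope_in (gf_dim D) P \<and> represents D P \<longrightarrow>
              of_nat (card (lattice_points P)) =
                (\<Sum>i\<in>gf_index D. gf_coeff D i *
                   (\<Sum>l=0..gf_len D i. w ! i ! l * dot (gf_dim D) lam (gf_num D i) ^ l))) \<and>
           (\<forall>P v. integral_polytope_in (gf_dim D) P \<and>
              (\<forall>i\<in>gf_index D. v i \<in> vecs (gf_dim D)) \<and>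
              (\<forall>k\<ge>1. rat_fun D (\<lambda>i. gf_num D i + frag_cmul (int k - 1) (v i)) =
                        to_fract (gen_fun (dilate k P))) \<longrightarrow>
              (\<forall>k\<ge>1. of_nat (card (lattice_points (dilate k P))) =
                (\<Sum>m | int m \<le> min (int (Max (gf_len D ` gf_index D))) (affine_dim P).
                   (\<Sum>i\<in>gf_index D. gf_coeff D i * dot (gf_dim D) lam (v i) ^ m *
                      (\<Sum>l=m..gf_len D i. of_nat (l choose m) * w ! i ! l *
                         dot (gf_dim D) lam (gf_num D i - v i) ^ (l - m))) *
                   of_nat k ^ m)))))"
  using polytime_value_com polytime_weights_com unfolding counting_weights_def by blast

end
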